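(* Let $\{X_k:k\in\mathbb{Z}\}$ be a $d$-variate ARMA process with associated functions $h,h_\sharp$, and assume $K\ge 1$. Let $\phi_{n,j}$ be its finite predictor coefficients. Then, for $n\ge \max(m_0,1)$ and $j\in\{1,\dots,n\}$, $$\phi_{n,j}=c_0a_j + c_0\, \mathbf{p}_0^{\top} (I_{dM} - \tilde{G}_n G_n)^{-1} (\Pi_n \Theta)^* \{\Lambda^{\top} \Pi_n \Theta v_j + \tilde{v}_{n-j+1}\},$$ where the matrix $I_{dM}-\tilde G_nG_n$ is invertible.
   Context: Notation: $\mathbb{N}=\{1,2,\dots\}$, $d\in\mathbb{N}$; $\mathbb{D}$, $\overline{\mathbb{D}}$ are the open and closed unit disks. For a complex matrix $a$: $a^\top$ is the transpose, $\overline{a}$ the entrywise conjugate, $a^*=\overline{a}^\top$. $I_n$ is the $n\times n$ identity. Empty sums are $0$. ARMA process: $\{X_k\}$ is a $\mathbb{C}^d$-valued, centered, weakly stationary process on a probability space with $E[X_mX_n^*]=\int_{-\pi}^{\pi}e^{-i(m-n)\theta}w(e^{i\theta})\,d\theta/(2\pi)$, where $w(e^{i\theta})=h(e^{i\theta})h(e^{i\theta})^*=h_\sharp(e^{i\theta})^*h_\sharp(e^{i\theta})$, and $h,h_\sharp$ are $\mathbb{C}^{d\times d}$-valued functions with rational entries having no poles in $\overline{\mathbb{D}}$ and with determinants having no zeros in $\overline{\mathbb{D}}$ (given $h$, such $h_\sharp$ exists and is unique up to a constant unitary factor). Finite predictor coefficients: $\phi_{n,j}\in\mathbb{C}^{d\times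 d}$ are defined by $P_{[-n,-1]}X_0=\phi_{n,1}X_{-1}+\cdots+\phi_{n,n}X_{-n}$, where $P_{[-n,-1]}$ is the orthogonal projection in $L^2$ (inner product $E[x\overline{y}]$), applied to each entry, onto the complex linear span of all entries of $X_{-n},\dots,X_{-1}$. Partial fractions: $h(z)^{-1}=-\rho_0-\sum_{\mu=1}^K\sum_{j=1}^{m_\mu}(1-\overline{p}_\mu z)^{-j}\rho_{\mu,j}-\sum_{j=1}^{m_0}z^j\rho_{0,j}$ with $p_1,\dots,p_K\in\mathbb{D}\setminus\{0\}$ distinct, $m_\mu\in\mathbb{N}$ ($1\le\mu\le K$), $m_0\in\mathbb{N}\cup\{0\}$, coefficients in $\mathbb{C}^{d\times d}$, $\rho_{\mu,m_\mu}\ne0$ for $1\le\mu\le K$, and $\rho_{0,m_0}\neq0$ if $m_0\ge1$. $M:=\sum_{\mu=1}^Km_\mu$. ($K\ge1$ means the process is not an AR process.) Power series: with $\tilde h(z):=\{h_\sharp(\overline z)\}^*$, for $z\in\mathbb{D}$: $h(z)=\sum_{k\ge0}z^kc_k$, $-h(z)^{-1}=\sum_{k\ge0}z^ka_k$, $-\tilde h(z)^{-1}=\sum_{k\ge0}z^k\tilde a_k$. Blocks: for $\mu\in\{1,\dots,K\}$, $i\in\mathbb{N}$, $n\in\mathbb{N}\cup\{0\}$, $p_{\mu,i}(n):=\binom{n}{i-1}p_\mu^{n-i+1}$ and $\mathbf{p}_{\mu,i}(n):=p_{\mu,i}(n)I_d$; $\mathbf{p}_n:=(\mathbf{p}_{1,1}(n),\dots,\mathbf{p}_{1,m_1}(n)\,|\,\cdots\,|\,\mathbf{p}_{K,1}(n),\dots,\mathbf{p}_{K,m_K}(n))^\top\in\mathbb{C}^{dM\times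 d}$. $\Lambda:=\sum_{\ell=0}^\infty\mathbf{p}_\ell\mathbf{p}_\ell^*\in\mathbb{C}^{dM\times dM}$. For $n\in\mathbb{N}$: $v_n:=\sum_{\ell=0}^\infty\mathbf{p}_\ell a_{n+\ell}$, $\tilde v_n:=\sum_{\ell=0}^\infty\overline{\mathbf{p}}_\ell\tilde a_{n+\ell}$, both in $\mathbb{C}^{dM\times d}$. With $h^\dagger(z):=h(1/\overline z)^*$, for $\mu\in\{1,\dots,K\}$ and $j\in\{1,\dots,m_\mu\}$, $$\theta_{\mu,j}:=-\lim_{z\to p_\mu}\frac{1}{(m_\mu-j)!}\frac{d^{m_\mu-j}}{dz^{m_\mu-j}}\{(z-p_\mu)^{m_\mu}h_\sharp(z)h^\dagger(z)^{-1}\}\in\mathbb{C}^{d\times d}.$$ $\Theta\in\mathbb{C}^{dM\times dM}$ is block diagonal with diagonal blocks $\Theta_1,\dots,\Theta_K$, where $\Theta_\mu\in\mathbb{C}^{dm_\mu\times dm_\mu}$ has $(i,j)$ block $\theta_{\mu,i+j-1}$ if $i+j-1\le m_\mu$ and $0$ otherwise. $\Pi_n\in\mathbb{C}^{dM\times dM}$ ($n\ge0$) is block diagonal with diagonal blocks $\Pi_{1,n},\dots,\Pi_{K,n}$, where $\Pi_{\mu,n}\in\mathbb{C}^{dm_\mu\times dm_\mu}$ has $(i,j)$ block $\mathbf{p}_{\mu,j-i+1}(n)$ if $j\ge i$ and $0$ otherwise. $G_n:=\Pi_n\Theta\Lambda$ and $\tilde G_n:=(\Pi_n\Theta)^*\Lambda^\top$.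 *)

theory Defs
  imports
    "HOL-Probability.Probability"
    "HOL-Computational_Algebra.Computational_Algebra"
    "Jordan_Normal_Form.Schur_Decomposition"
begin

text \<open>
  The dimension \<open>d * M\<close> depends on the poles of the process, so all matrices are those of
  \<open>Jordan_Normal_Form\<close>, with explicit carriers and indices starting from 0.
\<close>

unbundle no vec_syntax

abbreviation mat_cnj :: "complex mat \<Rightarrow> complex mat" where
  "mat_cnj \<equiv> map_mat cnj"

text \<open>Inverse of a square matrix; unspecified if the matrix is singular.\<close>

definition minv :: "complex mat \<Rightarrow> complex mat" where
  "minv A = the (mat_inverse A)"

text \<open>
  The type of matrices is not an additive monoid, since its zero depends on the format.
  Finite sums and series of matrices are therefore taken entrywise.
\<close>

definition mat_sum :: "nat \<Rightarrow> nat \<Rightarrow> ('i \<Rightarrow> complex mat) \<Rightarrow> 'i set \<Rightarrow> complex mat" where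
  "mat_sum nr nc F A = mat nr nc (\<lambda>(r, c). \<Sum>x\<in>A. F x $$ (r, c))"

definition mat_suminf :: "nat \<Rightarrow> nat \<Rightarrow> (nat \<Rightarrow> complex mat) \<Rightarrow> complex mat" where
  "mat_suminf nr nc F = mat nr nc (\<lambda>(r, c). \<Sum>l. F l $$ (r, c))"

text \<open>Block matrix with \<open>d \<times> d\<close> blocks, whose block rows and columns are labelled by two lists.\<close>

definition block_mat :: "nat \<Rightarrow> 'r list \<Rightarrow> 'c list \<Rightarrow> ('r \<Rightarrow> 'c \<Rightarrow> complex mat) \<Rightarrow> complex mat" where
  "block_mat d rs cs B = mat (d * length rs) (d * length cs)
     (\<lambda>(r, c). B (rs ! (r div d)) (cs ! (c div d)) $$ (r mod d, c mod d))"

text \<open>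
  \<open>f\<close> is a rational function without poles in the closed unit disk. As \<open>p / q\<close> is in lowest
  terms, the zeros of \<open>q\<close> are exactly the poles, and the values of \<open>f\<close> there are irrelevant.
\<close>

definition rational_no_poles :: "(complex \<Rightarrow> complex) \<Rightarrow> bool" where
  "rational_no_poles f \<longleftrightarrow> (\<exists>p q :: complex poly. coprime p q \<and>
     (\<forall>z\<in>cball 0 1. poly q z \<noteq> 0) \<and>
     (\<forall>z. poly q z \<noteq> 0 \<longrightarrow> f z = poly p z / poly q z))"

definition outer_rational :: "nat \<Rightarrow> (complex \<Rightarrow> complex mat) \<Rightarrow> bool" where
  "outer_rational d h \<longleftrightarrow>
     (\<forall>z. h z \<in> carrier_mat d d) \<and>
     (\<forall>i<d. \<forall>j<d. rational_no_poles (\<lambda>z. h z $$ (i, j))) \<and>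
     (\<forall>z\<in>cball 0 1. Determinant.det (h z) \<noteq> 0)"

definition covariance_entry ::
    "'w measure \<Rightarrow> (int \<Rightarrow> 'w \<Rightarrow> complex Matrix.vec) \<Rightarrow> int \<Rightarrow> int \<Rightarrow> nat \<Rightarrow> nat \<Rightarrow> complex" where
  "covariance_entry P X k l i j = (LINT \<omega>|P. X k \<omega> $ i * cnj (X l \<omega> $ j))"

definition centered_weakly_stationary ::
    "'w measure \<Rightarrow> nat \<Rightarrow> (int \<Rightarrow> 'w \<Rightarrow> complex Matrix.vec) \<Rightarrow> bool" where
  "centered_weakly_stationary P d X \<longleftrightarrow>
     (\<forall>k. \<forall>\<omega>\<in>space P. X k \<omega> \<in> carrier_vec d) \<and>
     (\<forall>k. \<forall>i<d. (\<lambda>\<omega>. X k \<omega> $ i) \<in> borel_measurable P \<and>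
        integrable P (\<lambda>\<omega>. (cmod (X k \<omega> $ i))\<^sup>2) \<and> (LINT \<omega>|P. X k \<omega> $ i) = 0) \<and>
     (\<forall>k l t. \<forall>i<d. \<forall>j<d.
        covariance_entry P X (k + t) (l + t) i j = covariance_entry P X k l i j)"

definition arma_process ::
    "'w measure \<Rightarrow> nat \<Rightarrow> (int \<Rightarrow> 'w \<Rightarrow> complex Matrix.vec) \<Rightarrow>
     (complex \<Rightarrow> complex mat) \<Rightarrow> (complex \<Rightarrow> complex mat) \<Rightarrow> bool" where
  "arma_process P d X h hs \<longleftrightarrow>
     prob_space P \<and> centered_weakly_stationary P d X \<and>
     outer_rational d h \<and> outer_rational d hs \<and>
     (\<forall>\<theta>::real. h (cis \<theta>) * mat_adjoint (h (cis \<theta>)) = mat_adjoint (hs (cis \<theta>)) * hs (cis \<theta>)) \<and>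
     (\<forall>k l. \<forall>i<d. \<forall>j<d. covariance_entry P X k l i j =
        (LINT \<theta>:{-pi..pi}|lborel.
           exp (- \<i> * of_int (k - l) * of_real \<theta>)
           * ((h (cis \<theta>) * mat_adjoint (h (cis \<theta>))) $$ (i, j))) / of_real (2 * pi))"

definition entries_span ::
    "nat \<Rightarrow> (int \<Rightarrow> 'w \<Rightarrow> complex Matrix.vec) \<Rightarrow> int set \<Rightarrow> ('w \<Rightarrow> complex) set" where
  "entries_span d X T =
     {\<lambda>\<omega>. \<Sum>k\<in>T. \<Sum>i<d. b k i * X k \<omega> $ i | b :: int \<Rightarrow> nat \<Rightarrow> complex. True}"

text \<open>
  \<open>y\<close> is (a version of) the orthogonal projection of \<open>x\<close> onto the subspace \<open>S\<close> of \<open>L\<^sup>2(P)\<close>,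
  whose elements are functions up to almost sure equality.
\<close>

definition orth_proj ::
    "'w measure \<Rightarrow> ('w \<Rightarrow> complex) set \<Rightarrow> ('w \<Rightarrow> complex) \<Rightarrow> ('w \<Rightarrow> complex) \<Rightarrow> bool" where
  "orth_proj P S x y \<longleftrightarrow>
     (\<exists>y'\<in>S. (AE \<omega> in P. y \<omega> = y' \<omega>) \<and>
        (\<forall>s\<in>S. (LINT \<omega>|P. (x \<omega> - y' \<omega>) * cnj (s \<omega>)) = 0))"

definition predictor_coeffs ::
    "'w measure \<Rightarrow> nat \<Rightarrow> (int \<Rightarrow> 'w \<Rightarrow> complex Matrix.vec) \<Rightarrow> (nat \<Rightarrow> nat \<Rightarrow> complex mat) \<Rightarrow> bool" where
  "predictor_coeffs P d X \<phi> \<longleftrightarrow> (\<forall>n\<ge>1.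
     (\<forall>j\<in>{1..n}. \<phi> n j \<in> carrier_mat d d) \<and>
     (\<forall>i<d. orth_proj P (entries_span d X {- int n..-1})
        (\<lambda>\<omega>. X 0 \<omega> $ i) (\<lambda>\<omega>. \<Sum>j=1..n. (\<phi> n j *\<^sub>v X (- int j) \<omega>) $ i)))"

text \<open>
  \<open>m 0\<close> is the degree of the polynomial part, and \<open>m \<mu>\<close> for \<open>1 \<le> \<mu> \<le> K\<close> are the
  multiplicities of the poles. Both sides of the last equation are rational, so that requiring it
  on the closed disk, where all terms are defined, makes it an identity of rational functions.
\<close>

definition partial_fractions ::
    "nat \<Rightarrow> (complex \<Rightarrow> complex mat) \<Rightarrow> nat \<Rightarrow> (nat \<Rightarrow> nat) \<Rightarrow> (nat \<Rightarrow> complex) \<Rightarrow>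
     complex mat \<Rightarrow> (nat \<Rightarrow> nat \<Rightarrow> complex mat) \<Rightarrow> bool" where
  "partial_fractions d h K m p \<rho>\<^sub>0 \<rho> \<longleftrightarrow>
     (\<forall>\<mu>\<in>{1..K}. p \<mu> \<in> ball 0 1 - {0}) \<and> inj_on p {1..K} \<and>
     (\<forall>\<mu>\<in>{1..K}. m \<mu> \<ge> 1) \<and>
     \<rho>\<^sub>0 \<in> carrier_mat d d \<and> (\<forall>\<mu>\<in>{0..K}. \<forall>j\<in>{1..m \<mu>}. \<rho> \<mu> j \<in> carrier_mat d d) \<and>
     (\<forall>\<mu>\<in>{1..K}. \<rho> \<mu> (m \<mu>) \<noteq> 0\<^sub>m d d) \<and>
     (m 0 \<ge> 1 \<longrightarrow> \<rho> 0 (m 0) \<noteq> 0\<^sub>m d d) \<and>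
     (\<forall>z\<in>cball 0 1. minv (h z) =
        - \<rho>\<^sub>0
        - mat_sum d d (\<lambda>\<mu>. mat_sum d d (\<lambda>j. (1 / (1 - cnj (p \<mu>) * z) ^ j) \<cdot>\<^sub>m \<rho> \<mu> j) {1..m \<mu>}) {1..K}
        - mat_sum d d (\<lambda>j. z ^ j \<cdot>\<^sub>m \<rho> 0 j) {1..m 0})"

definition power_series_coeffs ::
    "nat \<Rightarrow> (complex \<Rightarrow> complex mat) \<Rightarrow> (nat \<Rightarrow> complex mat) \<Rightarrow> bool" where
  "power_series_coeffs d F c \<longleftrightarrow>
     (\<forall>k. c k \<in> carrier_mat d d) \<and>
     (\<forall>z\<in>ball 0 1. \<forall>i<d. \<forall>j<d. (\<lambda>k. z ^ k * c k $$ (i, j)) sums (F z $$ (i, j)))"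

definition h_tilde :: "(complex \<Rightarrow> complex mat) \<Rightarrow> complex \<Rightarrow> complex mat" where
  "h_tilde hs z = mat_adjoint (hs (cnj z))"

definition h_dagger :: "(complex \<Rightarrow> complex mat) \<Rightarrow> complex \<Rightarrow> complex mat" where
  "h_dagger h z = mat_adjoint (h (1 / cnj z))"

text \<open>The labels \<open>(1, 1), \<dots>, (1, m 1), \<dots>, (K, 1), \<dots>, (K, m K)\<close> of the blocks.\<close>

definition block_labels :: "nat \<Rightarrow> (nat \<Rightarrow> nat) \<Rightarrow> (nat \<times> nat) list" where
  "block_labels K m = concat (map (\<lambda>\<mu>. map (\<lambda>i. (\<mu>, i)) [1..<Suc (m \<mu>)]) [1..<Suc K])"

text \<open>Truncated subtraction is harmless: the binomial coefficient is 0 for \<open>n < i - 1\<close>.\<close>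

definition p_scalar :: "(nat \<Rightarrow> complex) \<Rightarrow> nat \<Rightarrow> nat \<Rightarrow> nat \<Rightarrow> complex" where
  "p_scalar p \<mu> i n = of_nat (n choose (i - 1)) * p \<mu> ^ (n + 1 - i)"

definition p_block :: "nat \<Rightarrow> (nat \<Rightarrow> complex) \<Rightarrow> nat \<Rightarrow> nat \<Rightarrow> nat \<Rightarrow> complex mat" where
  "p_block d p \<mu> i n = p_scalar p \<mu> i n \<cdot>\<^sub>m 1\<^sub>m d"

definition p_mat :: "nat \<Rightarrow> nat \<Rightarrow> (nat \<Rightarrow> nat) \<Rightarrow> (nat \<Rightarrow> complex) \<Rightarrow> nat \<Rightarrow> complex mat" where
  "p_mat d K m p n =
     transpose_mat (block_mat d [()] (block_labels K m) (\<lambda>_ (\<mu>, i). p_block d p \<mu> i n))"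

abbreviation M_dim :: "nat \<Rightarrow> (nat \<Rightarrow> nat) \<Rightarrow> nat" where
  "M_dim K m \<equiv> (\<Sum>\<mu>=1..K. m \<mu>)"

definition Lambda_mat :: "nat \<Rightarrow> nat \<Rightarrow> (nat \<Rightarrow> nat) \<Rightarrow> (nat \<Rightarrow> complex) \<Rightarrow> complex mat" where
  "Lambda_mat d K m p = mat_suminf (d * M_dim K m) (d * M_dim K m)
     (\<lambda>l. p_mat d K m p l * mat_adjoint (p_mat d K m p l))"

definition v_mat ::
    "nat \<Rightarrow> nat \<Rightarrow> (nat \<Rightarrow> nat) \<Rightarrow> (nat \<Rightarrow> complex) \<Rightarrow> (nat \<Rightarrow> complex mat) \<Rightarrow> nat \<Rightarrow> complex mat" where
  "v_mat d K m p a n =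
     mat_suminf (d * M_dim K m) d (\<lambda>l. p_mat d K m p l * a (n + l))"

definition v_tilde_mat ::
    "nat \<Rightarrow> nat \<Rightarrow> (nat \<Rightarrow> nat) \<Rightarrow> (nat \<Rightarrow> complex) \<Rightarrow> (nat \<Rightarrow> complex mat) \<Rightarrow> nat \<Rightarrow> complex mat" where
  "v_tilde_mat d K m p a' n =
     mat_suminf (d * M_dim K m) d (\<lambda>l. mat_cnj (p_mat d K m p l) * a' (n + l))"

definition theta_mat ::
    "nat \<Rightarrow> (complex \<Rightarrow> complex mat) \<Rightarrow> (complex \<Rightarrow> complex mat) \<Rightarrow> (nat \<Rightarrow> nat) \<Rightarrow>
     (nat \<Rightarrow> complex) \<Rightarrow> nat \<Rightarrow> nat \<Rightarrow> complex mat" where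
  "theta_mat d h hs m p \<mu> j = mat d d (\<lambda>(r, c).
     - Lim (at (p \<mu>)) (\<lambda>z. 1 / fact (m \<mu> - j) *
         (deriv ^^ (m \<mu> - j))
           (\<lambda>z. (z - p \<mu>) ^ m \<mu> * ((hs z * minv (h_dagger h z)) $$ (r, c))) z))"

definition Theta_mat ::
    "nat \<Rightarrow> (complex \<Rightarrow> complex mat) \<Rightarrow> (complex \<Rightarrow> complex mat) \<Rightarrow> nat \<Rightarrow> (nat \<Rightarrow> nat) \<Rightarrow>
     (nat \<Rightarrow> complex) \<Rightarrow> complex mat" where
  "Theta_mat d h hs K m p = block_mat d (block_labels K m) (block_labels K m)
     (\<lambda>(\<mu>, i) (\<nu>, j). if \<mu> = \<nu> \<and> i + j - 1 \<le> m \<mu> then theta_mat d h hs m p \<mu> (i + j - 1)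
        else 0\<^sub>m d d)"

definition Pi_mat :: "nat \<Rightarrow> nat \<Rightarrow> (nat \<Rightarrow> nat) \<Rightarrow> (nat \<Rightarrow> complex) \<Rightarrow> nat \<Rightarrow> complex mat" where
  "Pi_mat d K m p n = block_mat d (block_labels K m) (block_labels K m)
     (\<lambda>(\<mu>, i) (\<nu>, j). if \<mu> = \<nu> \<and> i \<le> j then p_block d p \<mu> (j - i + 1) n else 0\<^sub>m d d)"

definition G_mat ::
    "nat \<Rightarrow> (complex \<Rightarrow> complex mat) \<Rightarrow> (complex \<Rightarrow> complex mat) \<Rightarrow> nat \<Rightarrow> (nat \<Rightarrow> nat) \<Rightarrow>
     (nat \<Rightarrow> complex) \<Rightarrow> nat \<Rightarrow> complex mat" where
  "G_mat d h hs K m p n = Pi_mat d K m p n * Theta_mat d h hs K m p * Lambda_mat d K m p"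

definition G_tilde_mat ::
    "nat \<Rightarrow> (complex \<Rightarrow> complex mat) \<Rightarrow> (complex \<Rightarrow> complex mat) \<Rightarrow> nat \<Rightarrow> (nat \<Rightarrow> nat) \<Rightarrow>
     (nat \<Rightarrow> complex) \<Rightarrow> nat \<Rightarrow> complex mat" where
  "G_tilde_mat d h hs K m p n =
     mat_adjoint (Pi_mat d K m p n * Theta_mat d h hs K m p) * transpose_mat (Lambda_mat d K m p)"

end

theory Submission
  imports Defs "HOL-Complex_Analysis.Complex_Analysis"
begin

text \<open>
  Write w for the spectral density h h^* = hs^* hs on the unit circle, with hs for the second outer
  factor, and let z^j represent the variable X_{-j}. Then the predictor polynomial
  \<Phi> = I - \<phi>_{n,1} z - ... - \<phi>_{n,n} z^n is characterised by the vanishing of the Fourier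
  coefficients of \<Phi> w at the exponents 1, ..., n. The closed form arises from the ansatz

    \<Phi> = U h^{-1} + z^{n+1} Q (hs^*)^{-1},

  where U has only exponents at most 0 and Q only exponents at least 0. For such a function
  \<Phi> w = U h^* + z^{n+1} Q hs, so orthogonality is automatic, and it remains to make \<Phi> a
  polynomial of degree at most n with constant term I. With the unitary phase function
  \<Omega> = hs (h^*)^{-1} = (hs^*)^{-1} h,

    \<Phi> h = U + z^{n+1} Q \<Omega>,    \<Phi> hs^* = U \<Omega>^* + z^{n+1} Q.

  The first function must have no negative exponents and constant term c_0, the second must have
  no exponents above n. These conditions involve \<Omega> only through its coefficients at the
  exponents -(n+1), -(n+2), .... As h^{-1} has the poles that p_1, ..., p_K describe and n is at least
  m_0, these form a Hankel matrix of finite rank: the coefficient at -(n+1+k+l) is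
  -p_l^T \<Pi>_n \<Theta> p_k. Hence U_k = c_0 \<delta>_{k,0} + x \<Pi>_n \<Theta> p_k and Q_l = y (\<Pi>_n \<Theta>)^* conj(p_l) with two
  row blocks x and y, and the conditions become x = y Gt_n and y = c_0 p_0^T + x G_n, where Gt_n is
  the matrix G with a tilde. So y = c_0 p_0^T (1 - Gt_n G_n)^{-1}, and the coefficient of z^j in the
  ansatz is the formula.

  To see that the ansatz gives the true predictor, let D be the difference of the two sides. Then
  D h has only positive exponents, D hs^* has only exponents at most n, and D w vanishes at
  1, ..., n. Dividing by the outer factors, D lives on the exponents 1, ..., n, so it is orthogonal
  to itself with respect to the positive definite weight w, and therefore D = 0
  (\<open>mat_coeff_D\<close>, \<open>predictor_formula\<close>). The same argument with \<Phi> = 0 and with 0 in place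
  of c_0 shows that y = y Gt_n G_n forces y = 0 (\<open>homogeneous_solution_zero\<close>), which is the
  invertibility of 1 - Gt_n G_n.

  The Hankel coefficients come from expanding \<Omega> as the product of the power series of hs
  and of the adjoint of h^{-1}. Beyond the exponent m_0 only the poles contribute to the latter, and
  Vandermonde's identity separates the resulting binomials into the entries of p_l and \<Pi>_n and
  certain Taylor coefficients at the poles (\<open>phase_coeff\<close>). Those are the \<theta>_{\<mu>,j}
  (\<open>theta_sums\<close>).
\<close>

unbundle no vec_syntax

section \<open>Fourier coefficients on the unit circle\<close>

definition fourier_coeff :: "(real \<Rightarrow> complex) \<Rightarrow> int \<Rightarrow> complex" where
  "fourier_coeff f k = (LINT t:{-pi..pi}|lborel. cis (- of_int k * t) * f t) / of_real (2 * pi)"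

text \<open>
  The exponents are enumerated by \<open>e\<close>, so that the same notion serves power series in z, power
  series in 1/z, and z^{n+1} times a power series. Absolute convergence makes products computable
  termwise.
\<close>

definition fourier_series :: "(nat \<Rightarrow> int) \<Rightarrow> (nat \<Rightarrow> complex) \<Rightarrow> (real \<Rightarrow> complex) \<Rightarrow> bool" where
  "fourier_series e g f \<longleftrightarrow>
     summable (\<lambda>l. norm (g l)) \<and> (\<forall>t. (\<lambda>l. g l * cis (of_int (e l) * t)) sums f t)"

lemma set_integrable_continuous_circle:
  fixes f :: "real \<Rightarrow> complex"
  assumes "continuous_on UNIV f"
  shows "set_integrable lborel {-pi..pi} f"
  by (rule borel_integrable_atLeastAtMost') (rule continuous_on_subset[OF assms], simp)

lemma fourier_coeff_add:
  assumes "continuous_on UNIV f" "continuous_on UNIV g"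
  shows "fourier_coeff (\<lambda>t. f t + g t) k = fourier_coeff f k + fourier_coeff g k"
  unfolding fourier_coeff_def distrib_left
  by (subst set_integral_add)
     (auto intro!: set_integrable_continuous_circle continuous_intros assms simp: add_divide_distrib)

lemma fourier_coeff_diff:
  assumes "continuous_on UNIV f" "continuous_on UNIV g"
  shows "fourier_coeff (\<lambda>t. f t - g t) k = fourier_coeff f k - fourier_coeff g k"
  unfolding fourier_coeff_def right_diff_distrib
  by (subst set_integral_diff)
     (auto intro!: set_integrable_continuous_circle continuous_intros assms simp: diff_divide_distrib)

lemma fourier_coeff_0 [simp]: "fourier_coeff (\<lambda>t. 0) k = 0"
  by (simp add: fourier_coeff_def set_lebesgue_integral_def)

lemma fourier_coeff_sum:
  assumes "finite A" "\<And>i. i \<in> A \<Longrightarrow> continuous_on UNIV (f i)"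
  shows "fourier_coeff (\<lambda>t. \<Sum>i\<in>A. f i t) k = (\<Sum>i\<in>A. fourier_coeff (f i) k)"
  using assms
proof (induction rule: finite_induct)
  case (insert x F)
  then have "fourier_coeff (\<lambda>t. f x t + (\<Sum>i\<in>F. f i t)) k = fourier_coeff (f x) k + fourier_coeff (\<lambda>t. \<Sum>i\<in>F. f i t) k"
    by (intro fourier_coeff_add continuous_on_sum) auto
  with insert show ?case by simp
qed simp

lemma fourier_coeff_shift: "fourier_coeff (\<lambda>t. cis (of_int m * t) * f t) k = fourier_coeff f (k - m)"
proof -
  have "cis (- of_int k * t) * (cis (of_int m * t) * f t) = cis (- of_int (k - m) * t) * f t" for t
    by (simp add: mult.assoc[symmetric] cis_mult) (simp add: algebra_simps)
  then show ?thesis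
    unfolding fourier_coeff_def by presburger
qed

lemma fourier_coeff_cnj: "fourier_coeff (\<lambda>t. cnj (f t)) k = cnj (fourier_coeff f (- k))"
proof -
  have "(LINT t:{-pi..pi}|lborel. cis (- of_int k * t) * cnj (f t)) =
      cnj (LINT t:{-pi..pi}|lborel. cis (- of_int (- k) * t) * f t)"
    unfolding set_lebesgue_integral_def
    by (rule trans[OF _ Bochner_Integration.integral_cnj], rule Bochner_Integration.integral_cong) (auto simp: cis_cnj)
  then show ?thesis
    by (simp add: fourier_coeff_def)
qed

lemma fourier_coeff_cis: "fourier_coeff (\<lambda>t. cis (of_int m * t)) k = of_bool (k = m)"
proof -
  have *: "(\<lambda>t. cis (of_int m * t)) = (\<lambda>t. cis (of_int m * t) * 1)" by simp
  have "fourier_coeff (\<lambda>t. 1) j = of_bool (j = 0)" for j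
  proof (cases "j = 0")
    case True
    then show ?thesis
      by (simp add: fourier_coeff_def set_lebesgue_integral_def scaleR_conv_of_real)
  next
    case False
    have "(LINT t|lborel. indicator {-pi..pi} t *\<^sub>R cis (- of_int j * t)) =
        \<i> / of_int j * cis (- of_int j * pi) - \<i> / of_int j * cis (- of_int j * (- pi))"
    proof (rule integral_FTC_atLeastAtMost)
      fix t :: real
      have "((\<lambda>z. \<i> / of_int j * exp (- \<i> * of_int j * z)) has_field_derivative
          exp (- \<i> * of_int j * of_real t)) (at (of_real t))"
        using False by (auto intro!: derivative_eq_intros)
      from has_vector_derivative_real_field[OF this]
      have "((\<lambda>t. \<i> / of_int j * exp (\<i> * complex_of_real (- of_int j * t))) has_vector_derivative
          cis (- of_int j * t)) (at t within {-pi..pi})"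
        unfolding cis_conv_exp by (simp add: mult_ac)
      then show "((\<lambda>t. \<i> / of_int j * cis (- of_int j * t)) has_vector_derivative
          cis (- of_int j * t)) (at t within {-pi..pi})"
        by (simp add: cis_conv_exp)
    qed (auto intro!: continuous_intros)
    also have "\<dots> = 0"
      by (simp add: complex_eq_iff mult.commute[of _ pi])
    finally show ?thesis
      using False by (simp add: fourier_coeff_def set_lebesgue_integral_def)
  qed
  then show ?thesis
    by (subst *, subst fourier_coeff_shift) simp
qed

lemma fourier_series_continuous:
  assumes "fourier_series e g f"
  shows "continuous_on UNIV f"
proof -
  have f: "f = (\<lambda>t. \<Sum>l. g l * cis (of_int (e l) * t))"
    using assms by (auto simp: fourier_series_def fun_eq_iff sums_iff)
  have "uniform_limit UNIV (\<lambda>n t. \<Sum>l<n. g l * cis (of_int (e l) * t))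
      (\<lambda>t. \<Sum>l. g l * cis (of_int (e l) * t)) sequentially"
    by (rule Weierstrass_m_test[where M = "\<lambda>l. norm (g l)"])
       (use assms in \<open>auto simp: fourier_series_def norm_mult\<close>)
  then show ?thesis
    unfolding f
    by (rule uniform_limit_theorem[rotated]) (auto intro!: continuous_intros eventuallyI)
qed

text \<open>
  Termwise integration. Only the second factor is expanded; the first one may be a continuous function
  whose own Fourier series is not known to converge, such as the difference D studied below.
\<close>

lemma fourier_coeff_mult_fourier_series:
  assumes f: "continuous_on UNIV f" and G: "fourier_series e g G"
  shows "(\<lambda>l. g l * fourier_coeff f (k - e l)) sums fourier_coeff (\<lambda>t. f t * G t) k"
proof -
  let ?I = "\<lambda>t. indicator {-pi..pi} t :: real"
  let ?f = "\<lambda>l t. ?I t *\<^sub>R (g l * (cis (- of_int (k - e l) * t) * f t))"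
  have int: "integrable lborel (?f l)" for l
    by (rule set_integrable_continuous_circle[unfolded set_integrable_def])
       (intro continuous_intros f)
  have norm_f: "norm (?f l t) = norm (g l) * (?I t *\<^sub>R norm (f t))" for l t
    by (simp add: norm_mult indicator_def)
  have summable: "summable (\<lambda>l. norm (g l) * c)" for c
    using G by (auto simp: fourier_series_def intro: summable_mult2)
  have "(\<lambda>l. integral\<^sup>L lborel (?f l)) sums (LINT t|lborel. (\<Sum>l. ?f l t))"
    by (rule sums_integral[OF int]) (simp_all only: norm_f integral_mult_right_zero summable, simp)
  moreover have "(\<Sum>l. ?f l t) = ?I t *\<^sub>R (cis (- of_int k * t) * (f t * G t))" for t
  proof -
    have "(\<lambda>l. ?I t *\<^sub>R (cis (- of_int k * t) * f t * (g l * cis (of_int (e l) * t)))) sums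
        (?I t *\<^sub>R (cis (- of_int k * t) * f t * G t))"
      using G by (intro sums_scaleR_right sums_mult) (auto simp: fourier_series_def)
    moreover have "cis (- of_int k * t) * f t * (g l * cis (of_int (e l) * t)) =
       g l * (cis (- of_int (k - e l) * t) * f t)" for l
    proof -
      have "cis (- of_int (k - e l) * t) = cis (- of_int k * t) * cis (of_int (e l) * t)"
        by (simp add: cis_mult algebra_simps)
      then show ?thesis by (simp only: mult_ac)
    qed
    ultimately show ?thesis
      by (simp only: sums_iff mult.assoc)
  qed
  ultimately have "(\<lambda>l. integral\<^sup>L lborel (?f l)) sums
      (LINT t:{-pi..pi}|lborel. cis (- of_int k * t) * (f t * G t))"
    unfolding set_lebesgue_integral_def by simp
  moreover have "integral\<^sup>L lborel (?f l) =
      g l * (LINT t:{-pi..pi}|lborel. cis (- of_int (k - e l) * t) * f t)" for l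
    unfolding set_lebesgue_integral_def integral_mult_right_zero[symmetric] by simp
  ultimately show ?thesis
    unfolding fourier_coeff_def using sums_divide by fastforce
qed

lemma fourier_coeff_fourier_series:
  assumes "fourier_series e g G"
  shows "(\<lambda>l. g l * of_bool (k = e l)) sums fourier_coeff G k"
proof -
  have "fourier_coeff (\<lambda>t. 1) j = of_bool (j = 0)" for j
    using fourier_coeff_cis[of 0 j] by simp
  then show ?thesis
    using fourier_coeff_mult_fourier_series[OF _ assms, of "\<lambda>t. 1" k] by simp
qed

lemma fourier_series_finite:
  assumes "\<And>l. l > N \<Longrightarrow> g l = 0"
  shows "fourier_series e g (\<lambda>t. \<Sum>l\<le>N. g l * cis (of_int (e l) * t))"
proof -
  have 0: "g l = 0" if "l \<notin> {..N}" for l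
    using assms[of l] that by simp
  have "summable (\<lambda>l. norm (g l))"
    by (rule summable_finite[of "{..N}"]) (use 0 in auto)
  then show ?thesis
    unfolding fourier_series_def
    by (intro conjI allI sums_finite) (simp_all add: 0)
qed

text \<open>
  The sum is the squared norm of a row. It is continuous and nonnegative, so it cannot have mean
  zero without vanishing.
\<close>

lemma sum_square_integral_zero:
  fixes f :: "'i \<Rightarrow> real \<Rightarrow> complex"
  assumes A: "finite A" and f: "\<And>i. i \<in> A \<Longrightarrow> continuous_on UNIV (f i)"
    and 0: "fourier_coeff (\<lambda>t. \<Sum>i\<in>A. f i t * cnj (f i t)) 0 = 0"
    and i: "i \<in> A" and t: "t \<in> {-pi..pi}"
  shows "f i t = 0"
proof -
  let ?g = "\<lambda>t. \<Sum>i\<in>A. (norm (f i t))\<^sup>2"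
  have cont: "continuous_on {-pi..pi} ?g"
    by (intro continuous_intros continuous_on_subset[OF f]) auto
  have "(\<lambda>t. \<Sum>i\<in>A. f i t * cnj (f i t)) = (\<lambda>t. complex_of_real (?g t))"
    by (simp add: fun_eq_iff flip: complex_norm_square)
  then have "complex_of_real (LINT t:{-pi..pi}|lborel. ?g t) = 0"
    using 0 by (simp add: fourier_coeff_def set_integral_complex_of_real flip: of_real_sum of_real_power)
  then have "(LINT t:{-pi..pi}|lborel. ?g t) = 0"
    using of_real_eq_0_iff by blast
  moreover have "set_integrable lborel {-pi..pi} ?g"
    by (rule borel_integrable_atLeastAtMost'[OF cont])
  ultimately have "(?g has_integral 0) (cbox (-pi) pi)"
    using set_borel_integral_eq_integral[of "{-pi..pi}" ?g] by (simp add: has_integral_iff)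
  moreover have nn: "\<not> pi \<le> 0"
    by (simp add: not_le)
  ultimately have "?g t = 0"
    by (intro has_integral_0_cbox_imp_0[of "-pi" pi ?g t])
       (use cont t nn in \<open>auto intro!: sum_nonneg simp: box_eq_empty\<close>)
  then have "(norm (f i t))\<^sup>2 = 0"
    using i A by (subst (asm) sum_nonneg_eq_0_iff) auto
  then show ?thesis by simp
qed

lemma fourier_coeff_eq_0:
  assumes "\<And>t. t \<in> {-pi..pi} \<Longrightarrow> f t = 0"
  shows "fourier_coeff f k = 0"
proof -
  have "(LINT t:{-pi..pi}|lborel. cis (- of_int k * t) * f t) = (LINT t:{-pi..pi}|lborel. 0)"
    by (rule set_lebesgue_integral_cong) (auto simp: assms)
  then show ?thesis
    by (simp add: fourier_coeff_def set_lebesgue_integral_def)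
qed

section \<open>Matrices and matrix-valued Fourier series\<close>

lemma mat_adjoint_carrier [simp]:
  assumes "A \<in> carrier_mat nr nc"
  shows "mat_adjoint A \<in> carrier_mat nc nr"
  using assms by (auto simp: mat_adjoint_def)

lemma mat_adjoint_index:
  fixes A :: "complex mat"
  assumes "A \<in> carrier_mat nr nc" "i < nc" "j < nr"
  shows "mat_adjoint A $$ (i, j) = cnj (A $$ (j, i))"
  using assms by (auto simp: mat_adjoint_def mat_of_rows_index)

lemma mat_mult_index:
  assumes "A \<in> carrier_mat nr n" "B \<in> carrier_mat n nc" "i < nr" "j < nc"
  shows "(A * B) $$ (i, j) = (\<Sum>l<n. A $$ (i, l) * B $$ (l, j))"
  using assms by (auto simp: scalar_prod_def atLeast0LessThan intro!: sum.cong)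

lemma mat_eqI:
  assumes "A \<in> carrier_mat nr nc" "B \<in> carrier_mat nr nc"
    and "\<And>i j. i < nr \<Longrightarrow> j < nc \<Longrightarrow> A $$ (i, j) = B $$ (i, j)"
  shows "A = B"
  using assms by (intro eq_matI) auto

lemma mat_add_index:
  "A \<in> carrier_mat nr nc \<Longrightarrow> B \<in> carrier_mat nr nc \<Longrightarrow> i < nr \<Longrightarrow> j < nc \<Longrightarrow>
    (A + B) $$ (i, j) = A $$ (i, j) + B $$ (i, j)"
  by auto

lemma mat_minus_index:
  "A \<in> carrier_mat nr nc \<Longrightarrow> B \<in> carrier_mat nr nc \<Longrightarrow> i < nr \<Longrightarrow> j < nc \<Longrightarrow>
    (A - B) $$ (i, j) = A $$ (i, j) - B $$ (i, j)"
  by auto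

lemma mat_uminus_index:
  "A \<in> carrier_mat nr nc \<Longrightarrow> i < nr \<Longrightarrow> j < nc \<Longrightarrow> (- A) $$ (i, j) = - (A $$ (i, j))"
  by auto

lemma mat_smult_index:
  "A \<in> carrier_mat nr nc \<Longrightarrow> i < nr \<Longrightarrow> j < nc \<Longrightarrow> (a \<cdot>\<^sub>m A) $$ (i, j) = a * A $$ (i, j)"
  by auto

lemma mat_adjoint_adjoint:
  fixes A :: "complex mat"
  assumes "A \<in> carrier_mat nr nc"
  shows "mat_adjoint (mat_adjoint A) = A"
  by (rule mat_eqI[of _ nr nc])
     (use assms in \<open>auto simp: mat_adjoint_index[of _ nc nr] mat_adjoint_index[OF assms]\<close>)

lemma mat_adjoint_mult:
  fixes A B :: "complex mat"
  assumes A: "A \<in> carrier_mat nr n" and B: "B \<in> carrier_mat n nc"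
  shows "mat_adjoint (A * B) = mat_adjoint B * mat_adjoint A"
proof (rule mat_eqI)
  fix i j assume ij: "i < nc" "j < nr"
  have "mat_adjoint (A * B) $$ (i, j) = cnj ((A * B) $$ (j, i))"
    by (rule mat_adjoint_index) (use A B ij in auto)
  also have "\<dots> = (\<Sum>l<n. cnj (B $$ (l, i)) * cnj (A $$ (j, l)))"
    by (subst mat_mult_index[OF A B]) (use ij in \<open>auto simp: mult.commute\<close>)
  also have "\<dots> = (mat_adjoint B * mat_adjoint A) $$ (i, j)"
    by (subst mat_mult_index[where n = n])
       (use A B ij in \<open>auto simp: mat_adjoint_index[OF A] mat_adjoint_index[OF B]\<close>)
  finally show "mat_adjoint (A * B) $$ (i, j) = (mat_adjoint B * mat_adjoint A) $$ (i, j)" .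
qed (rule mat_adjoint_carrier mult_carrier_mat A B)+

lemma mat_adjoint_zero [simp]: "mat_adjoint (0\<^sub>m nr nc :: complex mat) = 0\<^sub>m nc nr"
  by (rule mat_eqI[of _ nc nr]) (auto simp: mat_adjoint_index[of _ nr nc])

lemma mat_adjoint_one [simp]: "mat_adjoint (1\<^sub>m d :: complex mat) = 1\<^sub>m d"
  by (rule mat_eqI[of _ d d]) (auto simp: mat_adjoint_index[of _ d d])

lemma mat_adjoint_uminus:
  fixes A :: "complex mat"
  assumes A: "A \<in> carrier_mat nr nc"
  shows "mat_adjoint (- A) = - mat_adjoint A"
proof (rule mat_eqI)
  fix i j assume ij: "i < nc" "j < nr"
  have "mat_adjoint A \<in> carrier_mat nc nr"
    using A by simp
  then have "(- mat_adjoint A) $$ (i, j) = - (mat_adjoint A $$ (i, j))"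
    using ij by (intro index_uminus_mat) auto
  then show "mat_adjoint (- A) $$ (i, j) = (- mat_adjoint A) $$ (i, j)"
    using A ij by (simp add: mat_adjoint_index[OF A] mat_adjoint_index[of "- A" nr nc])
qed (use A in auto)

lemma mat_transpose_index:
  "A \<in> carrier_mat nr nc \<Longrightarrow> i < nc \<Longrightarrow> j < nr \<Longrightarrow> transpose_mat A $$ (i, j) = A $$ (j, i)"
  by auto

lemma mat_adjoint_transpose:
  assumes "A \<in> carrier_mat nr nc"
  shows "mat_adjoint (transpose_mat A) = mat_cnj A"
  by (rule mat_eqI[of _ nr nc]) (use assms in \<open>auto simp: mat_adjoint_index[of _ nc nr]\<close>)

lemma mat_mult_uminus:
  fixes A B :: "complex mat"
  assumes "A \<in> carrier_mat nr n" "B \<in> carrier_mat n nc"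
  shows "A * - B = - (A * B)"
  using uminus_mult_right_mat[of A B] assms by simp

lemma minus_zero_mat: "0\<^sub>m nr nc - 0\<^sub>m nr nc = (0\<^sub>m nr nc :: complex mat)"
  by (rule eq_matI) auto

lemma eq_zero_minus_minus_zero:
  fixes A :: "complex mat"
  assumes A: "A \<in> carrier_mat nr nc" and eq: "0\<^sub>m nr nc = 0\<^sub>m nr nc - A - 0\<^sub>m nr nc"
  shows "A = 0\<^sub>m nr nc"
proof (rule mat_eqI[OF A])
  fix i j assume "i < nr" "j < nc"
  then show "A $$ (i, j) = 0\<^sub>m nr nc $$ (i, j)"
    using arg_cong[OF eq, of "\<lambda>B. B $$ (i, j)"] A by simp
qed simp

lemma mat_diff_add_cancel:
  fixes A B :: "complex mat"
  assumes "A \<in> carrier_mat nr nc" "B \<in> carrier_mat nr nc"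
  shows "A - (A + B) - - B = 0\<^sub>m nr nc"
  by (rule eq_matI) (use assms in auto)

lemma mat_eq_if_diff_eq_zero:
  fixes A B :: "complex mat"
  assumes A: "A \<in> carrier_mat nr nc" and B: "B \<in> carrier_mat nr nc" and 0: "A - B = 0\<^sub>m nr nc"
  shows "A = B"
proof (rule mat_eqI[OF A B])
  fix i j assume ij: "i < nr" "j < nc"
  then show "A $$ (i, j) = B $$ (i, j)"
    using arg_cong[OF 0, of "\<lambda>M. M $$ (i, j)"] by (simp add: mat_minus_index[OF A B ij])
qed

lemma transpose_mult_vec_index:
  fixes A :: "complex mat"
  assumes A: "A \<in> carrier_mat nr nc" and v: "v \<in> carrier_vec nr" and j: "j < nc"
  shows "(transpose_mat A *\<^sub>v v) $ j = (\<Sum>l<nr. v $ l * A $$ (l, j))"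
  using assms by (auto simp: scalar_prod_def atLeast0LessThan mult.commute intro!: sum.cong)

text \<open>
  Convergence is entrywise because matrices of a given format do not form a type with a topology.
\<close>

definition mat_sums :: "nat \<Rightarrow> nat \<Rightarrow> (nat \<Rightarrow> complex mat) \<Rightarrow> complex mat \<Rightarrow> bool" where
  "mat_sums nr nc F S \<longleftrightarrow> (\<forall>l. F l \<in> carrier_mat nr nc) \<and> S \<in> carrier_mat nr nc \<and>
     (\<forall>i<nr. \<forall>j<nc. (\<lambda>l. F l $$ (i, j)) sums (S $$ (i, j)))"

lemma mat_sumsI:
  assumes "\<And>l. F l \<in> carrier_mat nr nc" "S \<in> carrier_mat nr nc"
    and "\<And>i j. i < nr \<Longrightarrow> j < nc \<Longrightarrow> (\<lambda>l. F l $$ (i, j)) sums (S $$ (i, j))"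
  shows "mat_sums nr nc F S"
  using assms by (simp add: mat_sums_def)

lemma mat_sumsD:
  assumes "mat_sums nr nc F S"
  shows "F l \<in> carrier_mat nr nc" "S \<in> carrier_mat nr nc"
    and "i < nr \<Longrightarrow> j < nc \<Longrightarrow> (\<lambda>l. F l $$ (i, j)) sums (S $$ (i, j))"
  using assms by (simp_all add: mat_sums_def)

lemma mat_sums_unique:
  assumes "mat_sums nr nc F S" "mat_sums nr nc F T"
  shows "S = T"
  by (rule mat_eqI[OF assms[THEN mat_sumsD(2)]]) (rule sums_unique2[OF assms[THEN mat_sumsD(3)]])

lemma mat_sums_mult_left:
  assumes F: "mat_sums n nc F S" and A: "A \<in> carrier_mat nr n"
  shows "mat_sums nr nc (\<lambda>l. A * F l) (A * S)"
proof (rule mat_sumsI)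
  fix i j assume ij: "i < nr" "j < nc"
  have "(\<lambda>l. \<Sum>k<n. A $$ (i, k) * F l $$ (k, j)) sums (\<Sum>k<n. A $$ (i, k) * S $$ (k, j))"
    using ij by (intro sums_sum sums_mult mat_sumsD(3)[OF F]) auto
  then show "(\<lambda>l. (A * F l) $$ (i, j)) sums (A * S) $$ (i, j)"
    by (simp only: mat_mult_index[OF A mat_sumsD(1)[OF F] ij] mat_mult_index[OF A mat_sumsD(2)[OF F] ij])
qed (rule mult_carrier_mat[OF A], rule mat_sumsD[OF F])+

lemma mat_sums_mult_right:
  assumes F: "mat_sums nr n F S" and A: "A \<in> carrier_mat n nc"
  shows "mat_sums nr nc (\<lambda>l. F l * A) (S * A)"
proof (rule mat_sumsI)
  fix i j assume ij: "i < nr" "j < nc"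
  have "(\<lambda>l. \<Sum>k<n. F l $$ (i, k) * A $$ (k, j)) sums (\<Sum>k<n. S $$ (i, k) * A $$ (k, j))"
    using ij by (intro sums_sum sums_mult2 mat_sumsD(3)[OF F]) auto
  then show "(\<lambda>l. (F l * A) $$ (i, j)) sums (S * A) $$ (i, j)"
    by (simp only: mat_mult_index[OF mat_sumsD(1)[OF F] A ij] mat_mult_index[OF mat_sumsD(2)[OF F] A ij])
qed (rule mult_carrier_mat[OF _ A], rule mat_sumsD[OF F])+

lemma mat_sums_add:
  assumes F: "mat_sums nr nc F S" and G: "mat_sums nr nc G T"
  shows "mat_sums nr nc (\<lambda>l. F l + G l) (S + T)"
proof (rule mat_sumsI)
  fix i j assume ij: "i < nr" "j < nc"
  show "(\<lambda>l. (F l + G l) $$ (i, j)) sums (S + T) $$ (i, j)"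
    using sums_add[OF mat_sumsD(3)[OF F ij] mat_sumsD(3)[OF G ij]]
    by (simp only: mat_add_index[OF mat_sumsD(1)[OF F] mat_sumsD(1)[OF G] ij]
        mat_add_index[OF mat_sumsD(2)[OF F] mat_sumsD(2)[OF G] ij])
qed (rule add_carrier_mat, rule mat_sumsD[OF G])+

lemma mat_sums_uminus:
  assumes F: "mat_sums nr nc F S"
  shows "mat_sums nr nc (\<lambda>l. - F l) (- S)"
proof (rule mat_sumsI)
  fix i j assume ij: "i < nr" "j < nc"
  show "(\<lambda>l. (- F l) $$ (i, j)) sums (- S) $$ (i, j)"
    using sums_minus[OF mat_sumsD(3)[OF F ij]]
    by (simp only: mat_uminus_index[OF mat_sumsD(1)[OF F] ij] mat_uminus_index[OF mat_sumsD(2)[OF F] ij])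
qed (use mat_sumsD(1,2)[OF F] in auto)

lemma mat_sums_single:
  assumes "A \<in> carrier_mat nr nc"
  shows "mat_sums nr nc (\<lambda>l. if l = k then A else 0\<^sub>m nr nc) A"
proof (rule mat_sumsI)
  fix i j assume ij: "i < nr" "j < nc"
  have "(\<lambda>l. if l = k then A $$ (i, j) else 0) sums A $$ (i, j)"
    using sums_single[of k "\<lambda>_. A $$ (i, j)"] by simp
  also have "(\<lambda>l. if l = k then A $$ (i, j) else 0) = (\<lambda>l. (if l = k then A else 0\<^sub>m nr nc) $$ (i, j))"
    using ij by (auto simp: fun_eq_iff)
  finally show "(\<lambda>l. (if l = k then A else 0\<^sub>m nr nc) $$ (i, j)) sums A $$ (i, j)" .
qed (use assms in auto)

lemma mat_sums_zero: "mat_sums nr nc (\<lambda>l. 0\<^sub>m nr nc) (0\<^sub>m nr nc)"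
  by (rule mat_sumsI) auto

definition mat_coeff :: "nat \<Rightarrow> nat \<Rightarrow> (real \<Rightarrow> complex mat) \<Rightarrow> int \<Rightarrow> complex mat" where
  "mat_coeff nr nc F k = mat nr nc (\<lambda>(i, j). fourier_coeff (\<lambda>t. F t $$ (i, j)) k)"

definition mat_continuous :: "nat \<Rightarrow> nat \<Rightarrow> (real \<Rightarrow> complex mat) \<Rightarrow> bool" where
  "mat_continuous nr nc F \<longleftrightarrow> (\<forall>t. F t \<in> carrier_mat nr nc) \<and>
     (\<forall>i<nr. \<forall>j<nc. continuous_on UNIV (\<lambda>t. F t $$ (i, j)))"

definition mat_series ::
    "nat \<Rightarrow> nat \<Rightarrow> (nat \<Rightarrow> int) \<Rightarrow> (nat \<Rightarrow> complex mat) \<Rightarrow> (real \<Rightarrow> complex mat) \<Rightarrow> bool" where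
  "mat_series nr nc e G F \<longleftrightarrow>
     (\<forall>l. G l \<in> carrier_mat nr nc) \<and> (\<forall>t. F t \<in> carrier_mat nr nc) \<and>
     (\<forall>i<nr. \<forall>j<nc. fourier_series e (\<lambda>l. G l $$ (i, j)) (\<lambda>t. F t $$ (i, j)))"

lemma mat_continuousI:
  assumes "\<And>t. F t \<in> carrier_mat nr nc"
    and "\<And>i j. i < nr \<Longrightarrow> j < nc \<Longrightarrow> continuous_on UNIV (\<lambda>t. F t $$ (i, j))"
  shows "mat_continuous nr nc F"
  using assms by (simp add: mat_continuous_def)

lemma mat_continuousD:
  assumes "mat_continuous nr nc F"
  shows "F t \<in> carrier_mat nr nc"
    and "i < nr \<Longrightarrow> j < nc \<Longrightarrow> continuous_on UNIV (\<lambda>t. F t $$ (i, j))"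
  using assms by (simp_all add: mat_continuous_def)

lemma mat_seriesI:
  assumes "\<And>l. G l \<in> carrier_mat nr nc" "\<And>t. F t \<in> carrier_mat nr nc"
    and "\<And>i j. i < nr \<Longrightarrow> j < nc \<Longrightarrow> fourier_series e (\<lambda>l. G l $$ (i, j)) (\<lambda>t. F t $$ (i, j))"
  shows "mat_series nr nc e G F"
  using assms by (simp add: mat_series_def)

lemma mat_seriesD:
  assumes "mat_series nr nc e G F"
  shows "G l \<in> carrier_mat nr nc" "F t \<in> carrier_mat nr nc"
    and "i < nr \<Longrightarrow> j < nc \<Longrightarrow> fourier_series e (\<lambda>l. G l $$ (i, j)) (\<lambda>t. F t $$ (i, j))"
  using assms by (simp_all add: mat_series_def)

lemma mat_coeff_carrier [simp]: "mat_coeff nr nc F k \<in> carrier_mat nr nc"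
  by (simp add: mat_coeff_def)

lemma mat_coeff_index: "i < nr \<Longrightarrow> j < nc \<Longrightarrow> mat_coeff nr nc F k $$ (i, j) = fourier_coeff (\<lambda>t. F t $$ (i, j)) k"
  by (simp add: mat_coeff_def)

lemma mat_series_continuous:
  assumes "mat_series nr nc e G F"
  shows "mat_continuous nr nc F"
  by (rule mat_continuousI)
     (rule mat_seriesD[OF assms] fourier_series_continuous | assumption)+

lemma mat_continuous_mult:
  assumes F: "mat_continuous nr n F" and G: "mat_continuous n nc G"
  shows "mat_continuous nr nc (\<lambda>t. F t * G t)"
proof (rule mat_continuousI)
  fix i j assume ij: "i < nr" "j < nc"
  show "continuous_on UNIV (\<lambda>t. (F t * G t) $$ (i, j))"
    unfolding mat_mult_index[OF mat_continuousD(1)[OF F] mat_continuousD(1)[OF G] ij]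
    using ij by (intro continuous_intros mat_continuousD(2)[OF F] mat_continuousD(2)[OF G]) auto
qed (rule mult_carrier_mat[OF mat_continuousD(1)[OF F] mat_continuousD(1)[OF G]])

lemma mat_continuous_diff:
  assumes F: "mat_continuous nr nc F" and G: "mat_continuous nr nc G"
  shows "mat_continuous nr nc (\<lambda>t. F t - G t)"
proof (rule mat_continuousI)
  fix i j assume ij: "i < nr" "j < nc"
  show "continuous_on UNIV (\<lambda>t. (F t - G t) $$ (i, j))"
    unfolding mat_minus_index[OF mat_continuousD(1)[OF F] mat_continuousD(1)[OF G] ij]
    by (intro continuous_intros mat_continuousD(2)[OF F] mat_continuousD(2)[OF G] ij)
qed (rule minus_carrier_mat[OF mat_continuousD(1)[OF G]])

lemma mat_continuous_adjoint:
  assumes F: "mat_continuous nr nc F"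
  shows "mat_continuous nc nr (\<lambda>t. mat_adjoint (F t))"
proof (rule mat_continuousI)
  fix i j assume ij: "i < nc" "j < nr"
  show "continuous_on UNIV (\<lambda>t. mat_adjoint (F t) $$ (i, j))"
    unfolding mat_adjoint_index[OF mat_continuousD(1)[OF F] ij]
    using ij by (intro continuous_intros mat_continuousD(2)[OF F])
qed (rule mat_adjoint_carrier[OF mat_continuousD(1)[OF F]])

lemma mat_coeff_diff:
  assumes F: "mat_continuous nr nc F" and G: "mat_continuous nr nc G"
  shows "mat_coeff nr nc (\<lambda>t. F t - G t) k = mat_coeff nr nc F k - mat_coeff nr nc G k"
proof (rule mat_eqI)
  fix i j assume ij: "i < nr" "j < nc"
  show "mat_coeff nr nc (\<lambda>t. F t - G t) k $$ (i, j) = (mat_coeff nr nc F k - mat_coeff nr nc G k) $$ (i, j)"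
    unfolding mat_minus_index[OF mat_coeff_carrier mat_coeff_carrier ij] mat_coeff_index[OF ij]
      mat_minus_index[OF mat_continuousD(1)[OF F] mat_continuousD(1)[OF G] ij]
    by (rule fourier_coeff_diff[OF mat_continuousD(2)[OF F ij] mat_continuousD(2)[OF G ij]])
qed (auto intro!: minus_carrier_mat)

lemma mat_coeff_adjoint:
  assumes F: "mat_continuous nr nc F"
  shows "mat_coeff nc nr (\<lambda>t. mat_adjoint (F t)) k = mat_adjoint (mat_coeff nr nc F (- k))"
proof (rule mat_eqI)
  fix i j assume ij: "i < nc" "j < nr"
  show "mat_coeff nc nr (\<lambda>t. mat_adjoint (F t)) k $$ (i, j) = mat_adjoint (mat_coeff nr nc F (- k)) $$ (i, j)"
    unfolding mat_coeff_index[OF ij] mat_adjoint_index[OF mat_continuousD(1)[OF F] ij]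
      mat_adjoint_index[OF mat_coeff_carrier ij] mat_coeff_index[OF ij(2,1)]
    by (rule fourier_coeff_cnj)
qed auto

lemma mat_coeff_mult_right:
  assumes F: "mat_continuous nr n F" and H: "mat_series n nc e G H"
  shows "mat_sums nr nc (\<lambda>l. mat_coeff nr n F (k - e l) * G l) (mat_coeff nr nc (\<lambda>t. F t * H t) k)"
proof (rule mat_sumsI)
  fix i j assume ij: "i < nr" "j < nc"
  note FH = mat_mult_index[OF mat_continuousD(1)[OF F] mat_seriesD(2)[OF H] ij]
  note cH = mat_series_continuous[OF H]
  have "(\<lambda>l. \<Sum>m<n. G l $$ (m, j) * fourier_coeff (\<lambda>t. F t $$ (i, m)) (k - e l)) sums
      (\<Sum>m<n. fourier_coeff (\<lambda>t. F t $$ (i, m) * H t $$ (m, j)) k)"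
    using ij by (intro sums_sum fourier_coeff_mult_fourier_series mat_continuousD(2)[OF F] mat_seriesD(3)[OF H]) auto
  also have "(\<Sum>m<n. fourier_coeff (\<lambda>t. F t $$ (i, m) * H t $$ (m, j)) k) = mat_coeff nr nc (\<lambda>t. F t * H t) k $$ (i, j)"
    using ij unfolding mat_coeff_index[OF ij] FH
    by (intro fourier_coeff_sum[symmetric] continuous_intros mat_continuousD(2)[OF F] mat_continuousD(2)[OF cH]) auto
  also have "(\<lambda>l. \<Sum>m<n. G l $$ (m, j) * fourier_coeff (\<lambda>t. F t $$ (i, m)) (k - e l)) =
      (\<lambda>l. (mat_coeff nr n F (k - e l) * G l) $$ (i, j))"
    unfolding mat_mult_index[OF mat_coeff_carrier mat_seriesD(1)[OF H] ij]
    by (intro ext sum.cong refl) (simp add: mat_coeff_index ij)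
  finally show "(\<lambda>l. (mat_coeff nr n F (k - e l) * G l) $$ (i, j)) sums
    mat_coeff nr nc (\<lambda>t. F t * H t) k $$ (i, j)" .
qed (rule mult_carrier_mat[OF mat_coeff_carrier mat_seriesD(1)[OF H]] mat_coeff_carrier)+

lemma mat_coeff_mult_left:
  assumes F: "mat_series nr n e G F" and H: "mat_continuous n nc H"
  shows "mat_sums nr nc (\<lambda>l. G l * mat_coeff n nc H (k - e l)) (mat_coeff nr nc (\<lambda>t. F t * H t) k)"
proof (rule mat_sumsI)
  fix i j assume ij: "i < nr" "j < nc"
  note FH = mat_mult_index[OF mat_seriesD(2)[OF F] mat_continuousD(1)[OF H] ij]
  note cF = mat_series_continuous[OF F]
  have "(\<lambda>l. \<Sum>m<n. G l $$ (i, m) * fourier_coeff (\<lambda>t. H t $$ (m, j)) (k - e l)) sums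
      (\<Sum>m<n. fourier_coeff (\<lambda>t. H t $$ (m, j) * F t $$ (i, m)) k)"
    using ij by (intro sums_sum fourier_coeff_mult_fourier_series mat_continuousD(2)[OF H] mat_seriesD(3)[OF F]) auto
  also have "(\<Sum>m<n. fourier_coeff (\<lambda>t. H t $$ (m, j) * F t $$ (i, m)) k) = mat_coeff nr nc (\<lambda>t. F t * H t) k $$ (i, j)"
    using ij unfolding mat_coeff_index[OF ij] FH mult.commute[of "H _ $$ _"]
    by (intro fourier_coeff_sum[symmetric] continuous_intros mat_continuousD(2)[OF H] mat_continuousD(2)[OF cF]) auto
  also have "(\<lambda>l. \<Sum>m<n. G l $$ (i, m) * fourier_coeff (\<lambda>t. H t $$ (m, j)) (k - e l)) =
      (\<lambda>l. (G l * mat_coeff n nc H (k - e l)) $$ (i, j))"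
    unfolding mat_mult_index[OF mat_seriesD(1)[OF F] mat_coeff_carrier ij]
    by (intro ext sum.cong refl) (simp add: mat_coeff_index ij)
  finally show "(\<lambda>l. (G l * mat_coeff n nc H (k - e l)) $$ (i, j)) sums
    mat_coeff nr nc (\<lambda>t. F t * H t) k $$ (i, j)" .
qed (rule mult_carrier_mat[OF mat_seriesD(1)[OF F] mat_coeff_carrier] mat_coeff_carrier)+

text \<open>
  The coefficient of a product at k only sees the coefficients of the left factor at the indices
  k - e l. In particular, multiplication by a power series in z preserves the absence of exponents
  below a bound, and multiplication by a power series in 1/z the absence of exponents above it.
\<close>

lemma mat_coeff_mult_right_eq_0:
  assumes F: "mat_continuous nr n F" and H: "mat_series n nc e G H"
    and 0: "\<And>l. mat_coeff nr n F (k - e l) = 0\<^sub>m nr n"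
  shows "mat_coeff nr nc (\<lambda>t. F t * H t) k = 0\<^sub>m nr nc"
proof -
  have "mat_sums nr nc (\<lambda>l. 0\<^sub>m nr nc) (mat_coeff nr nc (\<lambda>t. F t * H t) k)"
    using mat_coeff_mult_right[OF F H, of k]
    by (simp only: 0 left_mult_zero_mat[OF mat_seriesD(1)[OF H]])
  then show ?thesis
    by (rule mat_sums_unique[OF _ mat_sums_zero])
qed

lemma mat_coeff_mult_right_cong:
  assumes F: "mat_continuous nr n F" and F': "mat_continuous nr n F'"
    and H: "mat_series n nc e G H"
    and eq: "\<And>k. mat_coeff nr n F k = mat_coeff nr n F' k"
  shows "mat_coeff nr nc (\<lambda>t. F t * H t) k = mat_coeff nr nc (\<lambda>t. F' t * H t) k"
  using mat_coeff_mult_right[OF F' H, of k] unfolding eq[symmetric]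
  by (rule mat_sums_unique[OF mat_coeff_mult_right[OF F H]])

lemma mat_coeff_fourier_series:
  assumes F: "mat_series nr nc e G F" and e: "inj e"
  shows "mat_coeff nr nc F (e l) = G l"
proof (rule mat_eqI)
  fix i j assume ij: "i < nr" "j < nc"
  have "(\<lambda>r. G r $$ (i, j) * of_bool (e l = e r)) sums fourier_coeff (\<lambda>t. F t $$ (i, j)) (e l)"
    by (rule fourier_coeff_fourier_series[OF mat_seriesD(3)[OF F ij]])
  also have "(\<lambda>r. G r $$ (i, j) * of_bool (e l = e r)) = (\<lambda>r. if r = l then G r $$ (i, j) else 0)"
    using e by (auto simp: fun_eq_iff inj_eq)
  finally show "mat_coeff nr nc F (e l) $$ (i, j) = G l $$ (i, j)"
    unfolding mat_coeff_index[OF ij]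
    using sums_single[of l "\<lambda>r. G r $$ (i, j)"] by (rule sums_unique2)
qed (rule mat_coeff_carrier mat_seriesD(1)[OF F])+

lemma mat_coeff_fourier_series_eq_0:
  assumes F: "mat_series nr nc e G F" and k: "k \<notin> range e"
  shows "mat_coeff nr nc F k = 0\<^sub>m nr nc"
proof (rule mat_eqI)
  fix i j assume ij: "i < nr" "j < nc"
  have "(\<lambda>r. G r $$ (i, j) * of_bool (k = e r)) sums fourier_coeff (\<lambda>t. F t $$ (i, j)) k"
    by (rule fourier_coeff_fourier_series[OF mat_seriesD(3)[OF F ij]])
  also have "(\<lambda>r. G r $$ (i, j) * of_bool (k = e r)) = (\<lambda>r. 0)"
    using k by (auto simp: fun_eq_iff)
  finally have "fourier_coeff (\<lambda>t. F t $$ (i, j)) k = 0"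
    using sums_zero by (rule sums_unique2)
  then show "mat_coeff nr nc F k $$ (i, j) = 0\<^sub>m nr nc $$ (i, j)"
    using ij by (simp add: mat_coeff_index)
qed auto

lemma mat_series_adjoint:
  assumes F: "mat_series nr nc e G F"
  shows "mat_series nc nr (\<lambda>l. - e l) (\<lambda>l. mat_adjoint (G l)) (\<lambda>t. mat_adjoint (F t))"
proof (rule mat_seriesI)
  fix i j assume ij: "i < nc" "j < nr"
  note fs = mat_seriesD(3)[OF F ij(2,1), unfolded fourier_series_def]
  have "(\<lambda>l. cnj (G l $$ (j, i)) * cis (of_int (- e l) * t)) sums cnj (F t $$ (j, i))" for t
  proof -
    have "(\<lambda>l. cnj (G l $$ (j, i) * cis (of_int (e l) * t))) sums cnj (F t $$ (j, i))"
      using fs by (subst sums_cnj) auto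
    then show ?thesis by (simp add: cis_cnj)
  qed
  then show "fourier_series (\<lambda>l. - e l) (\<lambda>l. mat_adjoint (G l) $$ (i, j)) (\<lambda>t. mat_adjoint (F t) $$ (i, j))"
    unfolding fourier_series_def mat_adjoint_index[OF mat_seriesD(1)[OF F] ij]
      mat_adjoint_index[OF mat_seriesD(2)[OF F] ij]
    using fs by simp
qed (rule mat_adjoint_carrier, rule mat_seriesD[OF F])+

lemma mat_series_uminus:
  assumes F: "mat_series nr nc e G F"
  shows "mat_series nr nc e (\<lambda>l. - G l) (\<lambda>t. - F t)"
proof (rule mat_seriesI)
  fix i j assume ij: "i < nr" "j < nc"
  show "fourier_series e (\<lambda>l. (- G l) $$ (i, j)) (\<lambda>t. (- F t) $$ (i, j))"
    using mat_seriesD(3)[OF F ij]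
    unfolding mat_uminus_index[OF mat_seriesD(1)[OF F] ij]
      mat_uminus_index[OF mat_seriesD(2)[OF F] ij]
    by (auto simp: fourier_series_def intro: sums_minus)
qed (use mat_seriesD(1,2)[OF F] in auto)

lemma mat_series_finite:
  assumes "\<And>l. G l \<in> carrier_mat nr nc" and "\<And>l. l > N \<Longrightarrow> G l = 0\<^sub>m nr nc"
  shows "mat_series nr nc e G
    (\<lambda>t. mat nr nc (\<lambda>(i, j). \<Sum>l\<le>N. G l $$ (i, j) * cis (of_int (e l) * t)))"
  by (rule mat_seriesI) (auto intro!: fourier_series_finite simp: assms)

lemma mat_series_suminf:
  assumes G: "\<And>l. G l \<in> carrier_mat nr nc"
    and sum: "\<And>i j. i < nr \<Longrightarrow> j < nc \<Longrightarrow> summable (\<lambda>l. norm (G l $$ (i, j)))"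
  shows "mat_series nr nc e G
    (\<lambda>t. mat nr nc (\<lambda>(i, j). \<Sum>l. G l $$ (i, j) * cis (of_int (e l) * t)))"
proof -
  have "summable (\<lambda>l. G l $$ (i, j) * cis (of_int (e l) * t))" if "i < nr" "j < nc" for i j t
    by (rule summable_norm_cancel) (simp add: norm_mult sum that)
  then show ?thesis
    using assms by (intro mat_seriesI) (auto simp: fourier_series_def)
qed

lemma mat_sums_transpose:
  assumes F: "mat_sums nr nc F S"
  shows "mat_sums nc nr (\<lambda>l. transpose_mat (F l)) (transpose_mat S)"
proof (rule mat_sumsI)
  fix i j assume ij: "i < nc" "j < nr"
  have "transpose_mat A $$ (i, j) = A $$ (j, i)" if "A \<in> carrier_mat nr nc" for A :: "complex mat"
    using that ij by simp
  from this[OF mat_sumsD(1)[OF F]] this[OF mat_sumsD(2)[OF F]]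
  show "(\<lambda>l. transpose_mat (F l) $$ (i, j)) sums transpose_mat S $$ (i, j)"
    using mat_sumsD(3)[OF F ij(2,1)] by simp
qed (use mat_sumsD(1,2)[OF F] in auto)

section \<open>The phase function\<close>

text \<open>
  The functions \<open>H\<close> and \<open>S\<close> are the boundary values of the two outer factors h and hs, and \<open>Hi\<close> and
  \<open>Sti\<close> are the inverses of \<open>H\<close> and of the adjoint of \<open>S\<close>. The matrices \<open>P l\<close>, \<open>T\<close> and \<open>L\<close> stand for
  the vectors p_l, for \<Pi>_n \<Theta> and for \<Lambda>. Everything that the orthogonality argument needs to know
  about the poles is the assumption \<open>phase\<close>: the Hankel matrix of the phase function beyond the
  exponent -n factors through the finite-dimensional space with coordinates \<open>P l\<close>.
\<close>

locale phase_factorization =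
  fixes d N n :: nat and H Hi S Sti :: "real \<Rightarrow> complex mat"
    and c a s a' P :: "nat \<Rightarrow> complex mat" and T L :: "complex mat"
  assumes H: "mat_series d d int c H"
    and Hi: "mat_series d d int (\<lambda>l. - a l) Hi"
    and S: "mat_series d d int s S"
    and Sti: "mat_series d d (\<lambda>l. - int l) (\<lambda>l. - a' l) Sti"
    and HHi: "\<And>t. H t * Hi t = 1\<^sub>m d" and HiH: "\<And>t. Hi t * H t = 1\<^sub>m d"
    and SSti: "\<And>t. mat_adjoint (S t) * Sti t = 1\<^sub>m d"
    and StiS: "\<And>t. Sti t * mat_adjoint (S t) = 1\<^sub>m d"
    and spectral: "\<And>t. H t * mat_adjoint (H t) = mat_adjoint (S t) * S t"
    and P: "\<And>l. P l \<in> carrier_mat N d"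
    and P_summable: "\<And>i j. i < N \<Longrightarrow> j < d \<Longrightarrow> summable (\<lambda>l. norm (P l $$ (i, j)))"
    and T: "T \<in> carrier_mat N N"
    and L: "mat_sums N N (\<lambda>l. P l * mat_adjoint (P l)) L"
    and phase: "\<And>k l. mat_coeff d d (\<lambda>t. S t * mat_adjoint (Hi t)) (- int (n + 1 + k + l)) =
      - (transpose_mat (P l) * T * P k)"
begin

definition Omega :: "real \<Rightarrow> complex mat" where
  "Omega t = S t * mat_adjoint (Hi t)"

lemma H_carrier [simp]: "H t \<in> carrier_mat d d" and Hi_carrier [simp]: "Hi t \<in> carrier_mat d d"
  and S_carrier [simp]: "S t \<in> carrier_mat d d" and Sti_carrier [simp]: "Sti t \<in> carrier_mat d d"
  using mat_seriesD(2)[OF H] mat_seriesD(2)[OF Hi] mat_seriesD(2)[OF S]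
    mat_seriesD(2)[OF Sti] by auto

lemma Omega_carrier [simp]: "Omega t \<in> carrier_mat d d"
  unfolding Omega_def by (rule mult_carrier_mat[of _ d d]) auto

lemma L_carrier: "L \<in> carrier_mat N N"
  using mat_sumsD(2)[OF L] .

lemmas continuous_H = mat_series_continuous[OF H]
lemmas continuous_Hi = mat_series_continuous[OF Hi]
lemmas continuous_S = mat_series_continuous[OF S]
lemmas continuous_Sti = mat_series_continuous[OF Sti]

lemma continuous_Omega: "mat_continuous d d Omega"
  unfolding Omega_def[abs_def]
  by (rule mat_continuous_mult[OF continuous_S mat_continuous_adjoint[OF continuous_Hi]])

text \<open>
  Both factorizations of the spectral density define the same phase function; cancel the left factor
  in H H^* = S^* S after multiplication by the inverse of H^*.
\<close>

lemma Omega_eq: "Sti t * H t = Omega t"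
proof -
  have Ha: "mat_adjoint (H t) \<in> carrier_mat d d" and Hia: "mat_adjoint (Hi t) \<in> carrier_mat d d"
    and Sa: "mat_adjoint (S t) \<in> carrier_mat d d" by auto
  have "mat_adjoint (H t) * mat_adjoint (Hi t) = 1\<^sub>m d"
    by (subst mat_adjoint_mult[symmetric, OF Hi_carrier H_carrier]) (simp add: HiH)
  then have "H t = H t * (mat_adjoint (H t) * mat_adjoint (Hi t))"
    by (simp add: right_mult_one_mat[OF H_carrier])
  also have "\<dots> = H t * mat_adjoint (H t) * mat_adjoint (Hi t)"
    by (rule assoc_mult_mat[symmetric, of _ d d _ d _ d]) auto
  also have "\<dots> = mat_adjoint (S t) * Omega t"
    unfolding spectral Omega_def by (rule assoc_mult_mat[of _ d d _ d _ d]) auto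
  finally have "Sti t * H t = Sti t * mat_adjoint (S t) * Omega t"
    by (subst assoc_mult_mat[of _ d d _ d _ d]) auto
  then show ?thesis
    by (simp add: StiS left_mult_one_mat[OF Omega_carrier])
qed

lemma Omega_adjoint: "Hi t * mat_adjoint (S t) = mat_adjoint (Omega t)"
  unfolding Omega_def by (subst mat_adjoint_mult[of _ d d _ d]) (auto simp: mat_adjoint_adjoint[of _ d d])

lemma StiHH: "Sti t * (H t * mat_adjoint (H t)) = S t"
  unfolding spectral
  by (subst assoc_mult_mat[symmetric, of _ d d _ d _ d]) (auto simp: StiS left_mult_one_mat[OF S_carrier])

lemma mat_coeff_Omega:
  "mat_coeff d d Omega (- int (n + 1 + k + l)) = - (transpose_mat (P l) * T * P k)"
  using phase unfolding Omega_def[abs_def] .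

text \<open>
  The coefficient depends only on k + l, so either order of the two indices is available. Taking
  adjoints puts \<open>P k\<close> on the left, which is the order in which it meets the coefficients of U.
\<close>

lemma mat_coeff_Omega_adjoint:
  "mat_coeff d d (\<lambda>t. mat_adjoint (Omega t)) (int (n + 1 + k + l)) =
    - (mat_adjoint (P k) * mat_adjoint T * mat_cnj (P l))"
proof -
  have Pt: "transpose_mat (P l) \<in> carrier_mat d N" using P by simp
  have "mat_coeff d d (\<lambda>t. mat_adjoint (Omega t)) (int (n + 1 + k + l)) =
      - mat_adjoint (transpose_mat (P l) * T * P k)"
    unfolding mat_coeff_adjoint[OF continuous_Omega] mat_coeff_Omega
    by (rule mat_adjoint_uminus) (rule mult_carrier_mat[OF mult_carrier_mat[OF Pt T] P])
  also have "mat_adjoint (transpose_mat (P l) * T * P k) =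
      mat_adjoint (P k) * (mat_adjoint T * mat_cnj (P l))"
    unfolding mat_adjoint_mult[OF mult_carrier_mat[OF Pt T] P] mat_adjoint_mult[OF Pt T]
      mat_adjoint_transpose[OF P] ..
  also have "\<dots> = mat_adjoint (P k) * mat_adjoint T * mat_cnj (P l)"
    by (rule assoc_mult_mat[symmetric, of _ d N _ N _ d]) (use P T in auto)
  finally show ?thesis .
qed

lemma L_transpose: "mat_sums N N (\<lambda>l. mat_cnj (P l) * transpose_mat (P l)) (transpose_mat L)"
proof -
  have "transpose_mat (P l * mat_adjoint (P l)) = mat_cnj (P l) * transpose_mat (P l)" for l
  proof -
    have "transpose_mat (mat_adjoint (P l)) = mat_cnj (P l)"
      by (rule mat_eqI[of _ N d])
         (use P[of l] in \<open>auto simp: mat_transpose_index[OF mat_adjoint_carrier[OF P]] mat_adjoint_index[OF P]\<close>)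
    then show ?thesis
      using transpose_mult[OF P mat_adjoint_carrier[OF P]] by simp
  qed
  then show ?thesis
    using mat_sums_transpose[OF L] by simp
qed

end

text \<open>
  The mean of \<psi> w \<psi>^* is zero, since \<psi> involves only exponents at which \<psi> w vanishes. Its diagonal
  entries are the squared norms of the rows of \<psi> H, and H is invertible.
\<close>

lemma (in phase_factorization) trig_polynomial_orthogonal_eq_0:
  assumes \<psi>: "mat_series r d int G \<psi>"
    and G: "\<And>l. l \<notin> A \<Longrightarrow> G l = 0\<^sub>m r d"
    and orth: "\<And>l. l \<in> A \<Longrightarrow> mat_coeff r d (\<lambda>t. \<psi> t * H t * mat_adjoint (H t)) (int l) = 0\<^sub>m r d"
  shows "mat_coeff r d \<psi> k = 0\<^sub>m r d"
proof -
  have \<psi>c: "\<psi> t \<in> carrier_mat r d" for t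
    using mat_seriesD(2)[OF \<psi>] .
  have Gc: "G l \<in> carrier_mat r d" for l
    using mat_seriesD(1)[OF \<psi>] .
  note c\<psi> = mat_series_continuous[OF \<psi>]
  note c\<psi>H = mat_continuous_mult[OF c\<psi> continuous_H]
  note c\<psi>HH = mat_continuous_mult[OF c\<psi>H mat_continuous_adjoint[OF continuous_H]]
  have "mat_sums r r (\<lambda>l. 0\<^sub>m r r)
      (mat_coeff r r (\<lambda>t. \<psi> t * H t * mat_adjoint (H t) * mat_adjoint (\<psi> t)) 0)"
  proof -
    have "mat_coeff r d (\<lambda>t. \<psi> t * H t * mat_adjoint (H t)) (0 - - int l) * mat_adjoint (G l) = 0\<^sub>m r r" for l
    proof (cases "l \<in> A")
      case True
      then show ?thesis
        using left_mult_zero_mat[OF mat_adjoint_carrier[OF Gc[of l]]] by (simp add: orth)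
    next
      case False
      then show ?thesis
        using right_mult_zero_mat[OF mat_coeff_carrier[of r d]] by (simp add: G)
    qed
    then show ?thesis
      using mat_coeff_mult_right[OF c\<psi>HH mat_series_adjoint[OF \<psi>], of 0] by (simp only:)
  qed
  then have 0: "mat_coeff r r (\<lambda>t. \<psi> t * H t * mat_adjoint (H t) * mat_adjoint (\<psi> t)) 0 = 0\<^sub>m r r"
    using mat_sums_unique mat_sums_zero by blast
  have \<psi>H: "(\<psi> t * H t) $$ (i, j) = 0" if "i < r" "j < d" "t \<in> {-pi..pi}" for i j t
  proof -
    have eq: "(\<psi> t * H t * mat_adjoint (H t) * mat_adjoint (\<psi> t)) $$ (i, i) =
        (\<Sum>j<d. (\<psi> t * H t) $$ (i, j) * cnj ((\<psi> t * H t) $$ (i, j)))" for t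
    proof -
      have \<psi>Hc: "\<psi> t * H t \<in> carrier_mat r d"
        by (rule mult_carrier_mat[OF \<psi>c]) simp
      have "\<psi> t * H t * mat_adjoint (H t) * mat_adjoint (\<psi> t) = \<psi> t * H t * mat_adjoint (\<psi> t * H t)"
        unfolding mat_adjoint_mult[OF \<psi>c H_carrier]
        by (rule assoc_mult_mat[OF \<psi>Hc, of _ d _ r]) (use \<psi>c in auto)
      then show ?thesis
        using mat_mult_index[OF \<psi>Hc mat_adjoint_carrier[OF \<psi>Hc] \<open>i < r\<close> \<open>i < r\<close>] \<open>i < r\<close>
        by (simp add: mat_adjoint_index[OF \<psi>Hc])
    qed
    have "fourier_coeff (\<lambda>t. \<Sum>j<d. (\<psi> t * H t) $$ (i, j) * cnj ((\<psi> t * H t) $$ (i, j))) 0 = 0"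
      unfolding eq[symmetric] using arg_cong[OF 0, of "\<lambda>A. A $$ (i, i)"] \<open>i < r\<close>
      by (simp add: mat_coeff_index)
    then show ?thesis
      by (intro sum_square_integral_zero[of "{..<d}" "\<lambda>j t. (\<psi> t * H t) $$ (i, j)"])
         (use that in \<open>auto intro!: mat_continuousD(2)[OF c\<psi>H]\<close>)
  qed
  have "mat_coeff r d (\<lambda>t. \<psi> t * H t) k = 0\<^sub>m r d" for k
    by (rule mat_eqI[of _ r d]) (auto simp: mat_coeff_index intro!: fourier_coeff_eq_0 \<psi>H)
  then have "mat_coeff r d (\<lambda>t. \<psi> t * H t * Hi t) k = 0\<^sub>m r d"
    by (intro mat_coeff_mult_right_eq_0[OF c\<psi>H Hi])
  moreover have "\<psi> t * H t * Hi t = \<psi> t" for t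
    using assoc_mult_mat[OF \<psi>c H_carrier Hi_carrier] by (simp add: HHi right_mult_one_mat[OF \<psi>c])
  ultimately show ?thesis
    by simp
qed

section \<open>The orthogonality argument\<close>

text \<open>
  The candidate solution U h^{-1} + z^{n+1} Q (hs^*)^{-1}, with coordinates x of U and y of Q, next to a
  polynomial \<Phi> of degree at most n that satisfies the normal equations. The case of interest is
  \<open>C = c 0\<close> with d rows; the case \<open>C = 0\<close> with a single row describes the kernel of 1 - Gt G.
\<close>

locale predictor_system = phase_factorization +
  fixes r :: nat and C x y :: "complex mat" and F :: "nat \<Rightarrow> complex mat" and \<Phi> :: "real \<Rightarrow> complex mat"
  assumes C: "C \<in> carrier_mat r d" and x: "x \<in> carrier_mat r N" and y: "y \<in> carrier_mat r N"
    and x_eq: "x = y * mat_adjoint T * transpose_mat L"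
    and y_eq: "y = C * mat_adjoint (P 0) + x * T * L"
    and \<Phi>: "mat_series r d int F \<Phi>"
    and F_eq_0: "\<And>l. l > n \<Longrightarrow> F l = 0\<^sub>m r d"
    and F_0: "F 0 * c 0 = C"
    and normal: "\<And>k. k \<in> {1..n} \<Longrightarrow> mat_coeff r d (\<lambda>t. \<Phi> t * H t * mat_adjoint (H t)) (int k) = 0\<^sub>m r d"
begin

definition Uc :: "nat \<Rightarrow> complex mat" where
  "Uc k = (if k = 0 then C else 0\<^sub>m r d) + x * T * P k"

definition Qc :: "nat \<Rightarrow> complex mat" where
  "Qc l = y * mat_adjoint T * mat_cnj (P l)"

definition U :: "real \<Rightarrow> complex mat" where
  "U t = mat r d (\<lambda>(i, j). \<Sum>l. Uc l $$ (i, j) * cis (of_int (- int l) * t))"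

definition Q :: "real \<Rightarrow> complex mat" where
  "Q t = mat r d (\<lambda>(i, j). \<Sum>l. Qc l $$ (i, j) * cis (of_int (int (n + 1) + int l) * t))"

definition D :: "real \<Rightarrow> complex mat" where
  "D t = \<Phi> t - U t * Hi t - Q t * Sti t"

lemma xT: "x * T \<in> carrier_mat r N" and yT: "y * mat_adjoint T \<in> carrier_mat r N"
  using mult_carrier_mat[OF x T] mult_carrier_mat[OF y mat_adjoint_carrier[OF T]] .

lemma xTP: "x * T * P l \<in> carrier_mat r d" and Qc_carrier: "Qc l \<in> carrier_mat r d"
  unfolding Qc_def
  by (rule mult_carrier_mat[OF xT P], rule mult_carrier_mat[OF yT]) (use P in auto)

lemma Uc_carrier: "Uc l \<in> carrier_mat r d"
  unfolding Uc_def by (rule add_carrier_mat[OF xTP])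

lemma summable_mult_P:
  fixes A :: "complex mat" and B :: "nat \<Rightarrow> complex mat"
  assumes A: "A \<in> carrier_mat r N" and B: "\<And>l. B l \<in> carrier_mat N d"
    and eq: "\<And>l i j. i < N \<Longrightarrow> j < d \<Longrightarrow> norm (B l $$ (i, j)) = norm (P l $$ (i, j))"
    and ij: "i < r" "j < d"
  shows "summable (\<lambda>l. norm ((A * B l) $$ (i, j)))"
proof (rule summable_comparison_test')
  show "summable (\<lambda>l. \<Sum>k<N. norm (A $$ (i, k)) * norm (P l $$ (k, j)))"
    using ij by (intro summable_sum summable_mult P_summable) auto
  fix l :: nat
  have "norm ((A * B l) $$ (i, j)) \<le> (\<Sum>k<N. norm (A $$ (i, k) * B l $$ (k, j)))"
    unfolding mat_mult_index[OF A B ij] by (rule norm_sum)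
  also have "\<dots> = (\<Sum>k<N. norm (A $$ (i, k)) * norm (P l $$ (k, j)))"
    using ij by (intro sum.cong refl) (simp add: norm_mult eq)
  finally show "norm (norm ((A * B l) $$ (i, j))) \<le> (\<Sum>k<N. norm (A $$ (i, k)) * norm (P l $$ (k, j)))"
    by simp
qed

lemma U: "mat_series r d (\<lambda>l. - int l) Uc U"
  unfolding U_def[abs_def]
proof (rule mat_series_suminf[OF Uc_carrier])
  fix i j assume ij: "i < r" "j < d"
  (* the extra term C occurs only at the index 0 *)
  have "summable (\<lambda>l. norm ((x * T * P (l + 1)) $$ (i, j)))"
    using summable_mult_P[OF xT P refl ij] by (rule summable_ignore_initial_segment)
  also have "(\<lambda>l. norm ((x * T * P (l + 1)) $$ (i, j))) = (\<lambda>l. norm (Uc (l + 1) $$ (i, j)))"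
    by (simp add: Uc_def left_add_zero_mat[OF xTP])
  finally show "summable (\<lambda>l. norm (Uc l $$ (i, j)))"
    by (rule summable_iff_shift[THEN iffD1])
qed

lemma Q: "mat_series r d (\<lambda>l. int (n + 1) + int l) Qc Q"
  unfolding Q_def[abs_def]
proof (rule mat_series_suminf[OF Qc_carrier])
  fix i j assume ij: "i < r" "j < d"
  have Pc: "mat_cnj (P l) \<in> carrier_mat N d" for l using P[of l] by auto
  have "norm (mat_cnj (P l) $$ (i, j)) = norm (P l $$ (i, j))" if "i < N" "j < d" for i j l
    using that P[of l] by auto
  from summable_mult_P[OF yT Pc this ij] show "summable (\<lambda>l. norm (Qc l $$ (i, j)))"
    by (simp add: Qc_def)
qed

lemmas continuous_\<Phi> = mat_series_continuous[OF \<Phi>]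
lemmas continuous_U = mat_series_continuous[OF U]
lemmas continuous_Q = mat_series_continuous[OF Q]

lemma \<Phi>_carrier: "\<Phi> t \<in> carrier_mat r d" and U_carrier: "U t \<in> carrier_mat r d"
  and Q_carrier: "Q t \<in> carrier_mat r d"
  using mat_seriesD(2)[OF \<Phi>] mat_seriesD(2)[OF U] mat_seriesD(2)[OF Q] .

lemma continuous_D: "mat_continuous r d D"
  unfolding D_def[abs_def]
  by (intro mat_continuous_diff mat_continuous_mult[OF continuous_U continuous_Hi]
      mat_continuous_mult[OF continuous_Q continuous_Sti] continuous_\<Phi>)

lemma D_carrier: "D t \<in> carrier_mat r d"
  using mat_continuousD(1)[OF continuous_D] .

text \<open>
  Multiplying D from the right by H, by the adjoint of S, or by the spectral density cancels one or
  both of the inverses in its definition.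
\<close>

lemma D_mult:
  assumes B: "B \<in> carrier_mat d d"
  shows "D t * B = \<Phi> t * B - U t * (Hi t * B) - Q t * (Sti t * B)"
proof -
  have 1: "U t * Hi t \<in> carrier_mat r d" and 2: "Q t * Sti t \<in> carrier_mat r d"
    using mult_carrier_mat[OF U_carrier Hi_carrier] mult_carrier_mat[OF Q_carrier Sti_carrier] .
  have 3: "\<Phi> t - U t * Hi t \<in> carrier_mat r d"
    by (rule minus_carrier_mat[OF 1])
  show ?thesis
    unfolding D_def minus_mult_distrib_mat[OF 3 2 B] minus_mult_distrib_mat[OF \<Phi>_carrier 1 B]
      assoc_mult_mat[OF U_carrier Hi_carrier B] assoc_mult_mat[OF Q_carrier Sti_carrier B] ..
qed

lemma mat_coeff_U: "mat_coeff r d U (- int k) = Uc k"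
  using mat_coeff_fourier_series[OF U, of k] by (auto simp: inj_def)

lemma mat_coeff_U_pos: "k > 0 \<Longrightarrow> mat_coeff r d U k = 0\<^sub>m r d"
  by (rule mat_coeff_fourier_series_eq_0[OF U]) auto

lemma mat_coeff_Q: "mat_coeff r d Q (int (n + 1 + l)) = Qc l"
  using mat_coeff_fourier_series[OF Q, of l] by (auto simp: inj_def add.assoc)

lemma mat_coeff_Q_small: "k < int (n + 1) \<Longrightarrow> mat_coeff r d Q k = 0\<^sub>m r d"
  by (rule mat_coeff_fourier_series_eq_0[OF Q]) auto

lemma mat_coeff_\<Phi>: "mat_coeff r d \<Phi> (int l) = F l"
  using mat_coeff_fourier_series[OF \<Phi>, of l] by (auto simp: inj_def)

lemma mat_coeff_\<Phi>_eq_0: "k < 0 \<or> k > int n \<Longrightarrow> mat_coeff r d \<Phi> k = 0\<^sub>m r d"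
proof (cases "k \<ge> 0")
  case True
  assume "k < 0 \<or> k > int n"
  with True show ?thesis
    using mat_coeff_\<Phi>[of "nat k"] F_eq_0[of "nat k"] by auto
qed (rule mat_coeff_fourier_series_eq_0[OF \<Phi>], auto)

text \<open>
  At the exponent -q, the product \<Phi> H contributes C if q = 0 and nothing otherwise, and U contributes
  its coefficient. In the product of Q with the phase function, the sum over l of
  conj(P_l) P_l^T is the transpose of \<open>L\<close>, so that the equation for x turns it into the
  part of U that is not C.
\<close>

lemma mat_coeff_DH: "k \<le> 0 \<Longrightarrow> mat_coeff r d (\<lambda>t. D t * H t) k = 0\<^sub>m r d"
proof -
  assume "k \<le> 0"
  then obtain q where k: "k = - int q"
    by (metis nonpos_int_cases)
  have DH: "D t * H t = \<Phi> t * H t - U t - Q t * Omega t" for t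
    unfolding D_mult[OF H_carrier] HiH Omega_eq right_mult_one_mat[OF U_carrier] ..
  note c\<Phi>H = mat_continuous_mult[OF continuous_\<Phi> continuous_H]
  note cQO = mat_continuous_mult[OF continuous_Q continuous_Omega]
  have c0: "c l \<in> carrier_mat d d" for l
    using mat_seriesD(1)[OF H] .
  have 1: "mat_coeff r d (\<lambda>t. \<Phi> t * H t) k = (if q = 0 then C else 0\<^sub>m r d)"
  proof -
    have "mat_coeff r d \<Phi> (k - int l) * c l = (if l = 0 then (if q = 0 then C else 0\<^sub>m r d) else 0\<^sub>m r d)" for l
      using mat_coeff_\<Phi>_eq_0[of "k - int l"] mat_coeff_\<Phi>[of 0] F_0 left_mult_zero_mat[OF c0]
      by (auto simp: k)
    then have "mat_sums r d (\<lambda>l. if l = 0 then (if q = 0 then C else 0\<^sub>m r d) else 0\<^sub>m r d) (mat_coeff r d (\<lambda>t. \<Phi> t * H t) k)"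
      using mat_coeff_mult_right[OF continuous_\<Phi> H, of k] by (simp only:)
    then show ?thesis
      by (rule mat_sums_unique[OF _ mat_sums_single]) (use C in auto)
  qed
  have 2: "mat_coeff r d (\<lambda>t. Q t * Omega t) k = - (x * T * P q)"
  proof -
    have PT: "transpose_mat (P l) \<in> carrier_mat d N" and Pc: "mat_cnj (P l) \<in> carrier_mat N d" for l
      using P[of l] by auto
    have TP: "T * P q \<in> carrier_mat N d"
      using mult_carrier_mat[OF T P] .
    have eq: "Qc l * mat_coeff d d Omega (k - (int (n + 1) + int l)) =
        - (y * mat_adjoint T * (mat_cnj (P l) * transpose_mat (P l)) * (T * P q))" for l
    proof -
      have "k - (int (n + 1) + int l) = - int (n + 1 + q + l)"
        by (simp add: k)
      then have "Qc l * mat_coeff d d Omega (k - (int (n + 1) + int l)) = - (Qc l * (transpose_mat (P l) * T * P q))"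
        by (simp only: mat_coeff_Omega mat_mult_uminus[OF Qc_carrier mult_carrier_mat[OF mult_carrier_mat[OF PT T] P]])
      also have "Qc l * (transpose_mat (P l) * T * P q) = Qc l * transpose_mat (P l) * (T * P q)"
        unfolding assoc_mult_mat[OF PT T P] assoc_mult_mat[OF Qc_carrier PT TP] ..
      also have "Qc l * transpose_mat (P l) = y * mat_adjoint T * (mat_cnj (P l) * transpose_mat (P l))"
        unfolding Qc_def by (rule assoc_mult_mat[OF yT Pc PT])
      finally show ?thesis .
    qed
    have sums: "mat_sums r d (\<lambda>l. - (y * mat_adjoint T * (mat_cnj (P l) * transpose_mat (P l)) * (T * P q)))
        (- (y * mat_adjoint T * transpose_mat L * (T * P q)))"
      by (intro mat_sums_uminus mat_sums_mult_right[OF _ TP] mat_sums_mult_left[OF _ yT] L_transpose)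
    have "mat_coeff r d (\<lambda>t. Q t * Omega t) k = - (y * mat_adjoint T * transpose_mat L * (T * P q))"
      by (rule mat_sums_unique[OF mat_coeff_mult_left[OF Q continuous_Omega, of k, unfolded eq] sums])
    then show ?thesis
      unfolding x_eq[symmetric] assoc_mult_mat[OF x T P] .
  qed
  have "mat_coeff r d (\<lambda>t. D t * H t) k =
      (if q = 0 then C else 0\<^sub>m r d) - Uc q - - (x * T * P q)"
    unfolding DH using 1 2 mat_coeff_U[of q]
    by (simp add: mat_coeff_diff[OF mat_continuous_diff[OF c\<Phi>H continuous_U] cQO]
        mat_coeff_diff[OF c\<Phi>H continuous_U] k)
  also have "\<dots> = 0\<^sub>m r d"
    unfolding Uc_def by (rule mat_diff_add_cancel[OF _ xTP]) (use C in auto)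
  finally show ?thesis .
qed

text \<open>
  This is the equation for y, read as a statement on the moments of U.
\<close>

lemma Uc_moment: "mat_sums r N (\<lambda>k. Uc k * mat_adjoint (P k)) y"
proof -
  have eq: "Uc k * mat_adjoint (P k) =
      (if k = 0 then C * mat_adjoint (P 0) else 0\<^sub>m r N) + x * T * (P k * mat_adjoint (P k))" for k
  proof -
    have Pa: "mat_adjoint (P k) \<in> carrier_mat d N" using P by auto
    have "Uc k * mat_adjoint (P k) = (if k = 0 then C else 0\<^sub>m r d) * mat_adjoint (P k) + x * T * P k * mat_adjoint (P k)"
      unfolding Uc_def by (rule add_mult_distrib_mat[OF _ xTP Pa]) (use C in auto)
    then show ?thesis
      unfolding assoc_mult_mat[OF xT P Pa] using left_mult_zero_mat[OF Pa, of r] by auto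
  qed
  have "C * mat_adjoint (P 0) \<in> carrier_mat r N"
    by (rule mult_carrier_mat[OF C]) (use P in auto)
  then show ?thesis
    unfolding eq by (subst y_eq) (intro mat_sums_add mat_sums_single mat_sums_mult_left[OF L xT])
qed

text \<open>
  The mirror image of the previous computation, at the exponents beyond n: the polynomial \<Phi>
  contributes nothing there, and by the moment formula for U the two other terms cancel.
\<close>

lemma mat_coeff_DS: "k \<ge> int (n + 1) \<Longrightarrow> mat_coeff r d (\<lambda>t. D t * mat_adjoint (S t)) k = 0\<^sub>m r d"
proof -
  assume "k \<ge> int (n + 1)"
  then obtain q where k: "k = int (n + 1 + q)"
    by (metis of_nat_add zle_iff_zadd)
  have Sa: "mat_adjoint (S t) \<in> carrier_mat d d" for t by simp
  have DS: "D t * mat_adjoint (S t) = \<Phi> t * mat_adjoint (S t) - U t * mat_adjoint (Omega t) - Q t" for t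
    unfolding D_mult[OF Sa] StiS Omega_adjoint right_mult_one_mat[OF Q_carrier] ..
  note c\<Phi>S = mat_continuous_mult[OF continuous_\<Phi> mat_continuous_adjoint[OF continuous_S]]
  note cOa = mat_continuous_adjoint[OF continuous_Omega]
  note cUO = mat_continuous_mult[OF continuous_U cOa]
  have 1: "mat_coeff r d (\<lambda>t. \<Phi> t * mat_adjoint (S t)) k = 0\<^sub>m r d"
    by (rule mat_coeff_mult_right_eq_0[OF continuous_\<Phi> mat_series_adjoint[OF S]])
       (rule mat_coeff_\<Phi>_eq_0, simp add: k)
  have 2: "mat_coeff r d (\<lambda>t. U t * mat_adjoint (Omega t)) k = - Qc q"
  proof -
    have Pa: "mat_adjoint (P l) \<in> carrier_mat d N" and Pc: "mat_cnj (P q) \<in> carrier_mat N d" for l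
      using P by auto
    have Ta: "mat_adjoint T \<in> carrier_mat N N" using T by auto
    have TP: "mat_adjoint T * mat_cnj (P q) \<in> carrier_mat N d"
      using mult_carrier_mat[OF Ta Pc] .
    have eq: "Uc l * mat_coeff d d (\<lambda>t. mat_adjoint (Omega t)) (k - - int l) =
        - (Uc l * mat_adjoint (P l) * (mat_adjoint T * mat_cnj (P q)))" for l
    proof -
      have *: "k - - int l = int (n + 1 + l + q)"
        by (simp add: k)
      show ?thesis
        unfolding * mat_coeff_Omega_adjoint assoc_mult_mat[OF Pa Ta Pc]
          assoc_mult_mat[OF Uc_carrier Pa TP]
        by (rule mat_mult_uminus[OF Uc_carrier mult_carrier_mat[OF Pa TP]])
    qed
    have sums: "mat_sums r d (\<lambda>l. - (Uc l * mat_adjoint (P l) * (mat_adjoint T * mat_cnj (P q))))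
        (- (y * (mat_adjoint T * mat_cnj (P q))))"
      by (intro mat_sums_uminus mat_sums_mult_right[OF _ TP] Uc_moment)
    have "mat_coeff r d (\<lambda>t. U t * mat_adjoint (Omega t)) k = - (y * (mat_adjoint T * mat_cnj (P q)))"
      by (rule mat_sums_unique[OF mat_coeff_mult_left[OF U cOa, of k, unfolded eq] sums])
    then show ?thesis
      unfolding Qc_def assoc_mult_mat[OF y Ta Pc] .
  qed
  have "mat_coeff r d (\<lambda>t. D t * mat_adjoint (S t)) k = 0\<^sub>m r d - - Qc q - Qc q"
    unfolding DS using 1 2 mat_coeff_Q[of q]
    by (simp add: mat_coeff_diff[OF mat_continuous_diff[OF c\<Phi>S cUO] continuous_Q]
        mat_coeff_diff[OF c\<Phi>S cUO] k)
  also have "\<dots> = 0\<^sub>m r d"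
    by (rule mat_eqI[of _ r d]) (use Qc_carrier[of q] in auto)
  finally show ?thesis .
qed

lemma continuous_DH: "mat_continuous r d (\<lambda>t. D t * H t)"
  by (rule mat_continuous_mult[OF continuous_D continuous_H])

lemma D_mult_HH: "D t * H t * mat_adjoint (H t) =
    \<Phi> t * H t * mat_adjoint (H t) - U t * mat_adjoint (H t) - Q t * S t"
proof -
  have Ha: "mat_adjoint (H t) \<in> carrier_mat d d" by simp
  have HH: "H t * mat_adjoint (H t) \<in> carrier_mat d d"
    by (rule mult_carrier_mat[OF H_carrier Ha])
  have "Hi t * (H t * mat_adjoint (H t)) = mat_adjoint (H t)"
    unfolding assoc_mult_mat[OF Hi_carrier H_carrier Ha, symmetric] HiH by (rule left_mult_one_mat[OF Ha])
  then show ?thesis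
    unfolding assoc_mult_mat[OF D_carrier H_carrier Ha] assoc_mult_mat[OF \<Phi>_carrier H_carrier Ha]
    by (simp only: D_mult[OF HH] StiHH)
qed

lemma mat_coeff_UH_adjoint: "k > 0 \<Longrightarrow> mat_coeff r d (\<lambda>t. U t * mat_adjoint (H t)) k = 0\<^sub>m r d"
  by (rule mat_coeff_mult_right_eq_0[OF continuous_U mat_series_adjoint[OF H]], rule mat_coeff_U_pos) auto

lemma mat_coeff_QS: "k < int (n + 1) \<Longrightarrow> mat_coeff r d (\<lambda>t. Q t * S t) k = 0\<^sub>m r d"
  by (rule mat_coeff_mult_right_eq_0[OF continuous_Q S], rule mat_coeff_Q_small) auto

lemmas continuous_Ha = mat_continuous_adjoint[OF continuous_H]
lemmas continuous_\<Phi>HH = mat_continuous_mult[OF mat_continuous_mult[OF continuous_\<Phi> continuous_H] continuous_Ha]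
lemmas continuous_UHa = mat_continuous_mult[OF continuous_U continuous_Ha]
lemmas continuous_QS = mat_continuous_mult[OF continuous_Q continuous_S]

lemma mat_coeff_DHH_eq: "mat_coeff r d (\<lambda>t. D t * H t * mat_adjoint (H t)) k =
    mat_coeff r d (\<lambda>t. \<Phi> t * H t * mat_adjoint (H t)) k - mat_coeff r d (\<lambda>t. U t * mat_adjoint (H t)) k
    - mat_coeff r d (\<lambda>t. Q t * S t) k"
  unfolding D_mult_HH
  by (simp only: mat_coeff_diff[OF mat_continuous_diff[OF continuous_\<Phi>HH continuous_UHa] continuous_QS]
      mat_coeff_diff[OF continuous_\<Phi>HH continuous_UHa])

lemma mat_coeff_DHH_middle: "k \<in> {1..n} \<Longrightarrow> mat_coeff r d (\<lambda>t. D t * H t * mat_adjoint (H t)) (int k) = 0\<^sub>m r d"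
  unfolding mat_coeff_DHH_eq by (simp add: normal mat_coeff_UH_adjoint mat_coeff_QS minus_zero_mat)

text \<open>
  The inverse of H is a power series in z and the inverse of the adjoint of S is a power series in
  1/z, so the vanishing on each half line survives the division.
\<close>

lemma mat_coeff_D_outside: "k \<le> 0 \<or> k \<ge> int (n + 1) \<Longrightarrow> mat_coeff r d D k = 0\<^sub>m r d"
proof (elim disjE)
  assume k: "k \<le> 0"
  have "mat_coeff r d (\<lambda>t. D t * H t * Hi t) k = 0\<^sub>m r d"
    by (rule mat_coeff_mult_right_eq_0[OF continuous_DH Hi], rule mat_coeff_DH) (use k in auto)
  moreover have "D t * H t * Hi t = D t" for t
    unfolding assoc_mult_mat[OF D_carrier H_carrier Hi_carrier] HHi by (rule right_mult_one_mat[OF D_carrier])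
  ultimately show ?thesis by simp
next
  assume k: "k \<ge> int (n + 1)"
  have Sa: "mat_adjoint (S t) \<in> carrier_mat d d" for t by simp
  have "mat_coeff r d (\<lambda>t. D t * mat_adjoint (S t) * Sti t) k = 0\<^sub>m r d"
    by (rule mat_coeff_mult_right_eq_0[OF mat_continuous_mult[OF continuous_D mat_continuous_adjoint[OF continuous_S]] Sti],
        rule mat_coeff_DS) (use k in auto)
  moreover have "D t * mat_adjoint (S t) * Sti t = D t" for t
    unfolding assoc_mult_mat[OF D_carrier Sa Sti_carrier] SSti by (rule right_mult_one_mat[OF D_carrier])
  ultimately show ?thesis by simp
qed

text \<open>
  The trigonometric polynomial \<psi> with the coefficients of D has the same Fourier coefficients as D,
  hence so do the products with w. So \<psi> w has no coefficients at 1, ..., n, and positivity can be applied to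
  \<psi>, whose Fourier expansion is finite.
\<close>

theorem mat_coeff_D: "mat_coeff r d D k = 0\<^sub>m r d"
proof -
  define G where "G l = (if l \<in> {1..n} then mat_coeff r d D (int l) else 0\<^sub>m r d)" for l
  define \<psi> where "\<psi> = (\<lambda>t. mat r d (\<lambda>(i, j). \<Sum>l\<le>n. G l $$ (i, j) * cis (of_int (int l) * t)))"
  have \<psi>: "mat_series r d int G \<psi>"
    unfolding \<psi>_def by (rule mat_series_finite) (auto simp: G_def)
  note c\<psi> = mat_series_continuous[OF \<psi>]
  have \<psi>D: "mat_coeff r d \<psi> k = mat_coeff r d D k" for k
  proof (cases "k \<in> {1..int n}")
    case True
    then show ?thesis
      using mat_coeff_fourier_series[OF \<psi>, of "nat k"] by (auto simp: inj_def G_def)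
  next
    case False
    have "mat_coeff r d \<psi> k = 0\<^sub>m r d"
    proof (cases "k \<ge> 0")
      case True
      then show ?thesis
        using False mat_coeff_fourier_series[OF \<psi>, of "nat k"] by (auto simp: inj_def G_def)
    qed (rule mat_coeff_fourier_series_eq_0[OF \<psi>], auto)
    then show ?thesis
      using mat_coeff_D_outside[of k] False by auto
  qed
  have \<psi>H: "mat_coeff r d (\<lambda>t. \<psi> t * H t) k = mat_coeff r d (\<lambda>t. D t * H t) k" for k
    by (rule mat_coeff_mult_right_cong[OF c\<psi> continuous_D H \<psi>D])
  have "mat_coeff r d (\<lambda>t. \<psi> t * H t * mat_adjoint (H t)) k =
      mat_coeff r d (\<lambda>t. D t * H t * mat_adjoint (H t)) k" for k
    by (rule mat_coeff_mult_right_cong[OF mat_continuous_mult[OF c\<psi> continuous_H] continuous_DH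
        mat_series_adjoint[OF H] \<psi>H])
  then have "mat_coeff r d \<psi> k = 0\<^sub>m r d"
    by (intro trig_polynomial_orthogonal_eq_0[OF \<psi>, of "{1..n}"]) (auto simp: G_def mat_coeff_DHH_middle)
  then show ?thesis
    by (simp add: \<psi>D)
qed

text \<open>
  The coefficient of z^j in D = 0. The inverse of H contributes \<open>- a\<close> at the exponents j + l, and the
  inverse of the adjoint of S contributes \<open>- a'\<close> at the exponents j - (n + 1 + l).
\<close>

theorem predictor_formula:
  assumes v: "mat_sums N d (\<lambda>l. P l * a (j + l)) v"
    and v': "mat_sums N d (\<lambda>l. mat_cnj (P l) * a' (n + 1 - j + l)) v'"
    and j: "j \<in> {1..n}"
  shows "F j = - (C * a j + x * T * v + y * mat_adjoint T * v')"
proof -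
  have ac: "a l \<in> carrier_mat d d" and ac': "a' l \<in> carrier_mat d d" for l
    using mat_seriesD(1)[OF Hi, of l] mat_seriesD(1)[OF Sti, of l] by auto
  have vc: "v \<in> carrier_mat N d" and vc': "v' \<in> carrier_mat N d"
    using mat_sumsD(2)[OF v] mat_sumsD(2)[OF v'] .
  have 1: "mat_coeff r d (\<lambda>t. U t * Hi t) (int j) = - (C * a j + x * T * v)"
  proof -
    have eq: "Uc l * mat_coeff d d Hi (int j - - int l) =
        - ((if l = 0 then C * a j else 0\<^sub>m r d) + x * T * (P l * a (j + l)))" for l
    proof -
      have "int j - - int l = int (j + l)" by simp
      then have "mat_coeff d d Hi (int j - - int l) = - a (j + l)"
        using mat_coeff_fourier_series[OF Hi, of "j + l"] by (simp add: inj_def)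
      then have "Uc l * mat_coeff d d Hi (int j - - int l) = - (Uc l * a (j + l))"
        by (simp only: mat_mult_uminus[OF Uc_carrier ac])
      also have "Uc l * a (j + l) = (if l = 0 then C else 0\<^sub>m r d) * a (j + l) + x * T * P l * a (j + l)"
        unfolding Uc_def by (rule add_mult_distrib_mat[OF _ xTP ac]) (use C in auto)
      also have "\<dots> = (if l = 0 then C * a j else 0\<^sub>m r d) + x * T * (P l * a (j + l))"
        unfolding assoc_mult_mat[OF xT P ac] using left_mult_zero_mat[OF ac, of r] by auto
      finally show ?thesis .
    qed
    have sums: "mat_sums r d (\<lambda>l. - ((if l = 0 then C * a j else 0\<^sub>m r d) + x * T * (P l * a (j + l))))
        (- (C * a j + x * T * v))"
      by (intro mat_sums_uminus mat_sums_add mat_sums_single mat_sums_mult_left[OF v xT]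
          mult_carrier_mat[OF C ac])
    show ?thesis
      by (rule mat_sums_unique[OF mat_coeff_mult_left[OF U continuous_Hi, of "int j", unfolded eq] sums])
  qed
  have 2: "mat_coeff r d (\<lambda>t. Q t * Sti t) (int j) = - (y * mat_adjoint T * v')"
  proof -
    have Pc: "mat_cnj (P l) \<in> carrier_mat N d" for l
      using P by auto
    have eq: "Qc l * mat_coeff d d Sti (int j - (int (n + 1) + int l)) =
        - (y * mat_adjoint T * (mat_cnj (P l) * a' (n + 1 - j + l)))" for l
    proof -
      have *: "int j - (int (n + 1) + int l) = - int (n + 1 - j + l)"
        using j by simp
      have "mat_coeff d d Sti (int j - (int (n + 1) + int l)) = - a' (n + 1 - j + l)"
        using mat_coeff_fourier_series[OF Sti, of "n + 1 - j + l"] unfolding * by (simp add: inj_def)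
      then have "Qc l * mat_coeff d d Sti (int j - (int (n + 1) + int l)) = - (Qc l * a' (n + 1 - j + l))"
        by (simp only: mat_mult_uminus[OF Qc_carrier ac'])
      then show ?thesis
        unfolding Qc_def assoc_mult_mat[OF yT Pc ac'] .
    qed
    have sums: "mat_sums r d (\<lambda>l. - (y * mat_adjoint T * (mat_cnj (P l) * a' (n + 1 - j + l))))
        (- (y * mat_adjoint T * v'))"
      by (intro mat_sums_uminus mat_sums_mult_left[OF v' yT])
    show ?thesis
      by (rule mat_sums_unique[OF mat_coeff_mult_left[OF Q continuous_Sti, of "int j", unfolded eq] sums])
  qed
  note cUHi = mat_continuous_mult[OF continuous_U continuous_Hi]
  note cQS = mat_continuous_mult[OF continuous_Q continuous_Sti]
  have "0\<^sub>m r d = F j - - (C * a j + x * T * v) - - (y * mat_adjoint T * v')"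
    using mat_coeff_D[of "int j"] unfolding D_def[abs_def]
    by (simp only: mat_coeff_diff[OF mat_continuous_diff[OF continuous_\<Phi> cUHi] cQS]
        mat_coeff_diff[OF continuous_\<Phi> cUHi] 1 2 mat_coeff_\<Phi>)
  moreover have Fc: "F j \<in> carrier_mat r d"
    using mat_seriesD(1)[OF \<Phi>] .
  moreover have A: "C * a j + x * T * v \<in> carrier_mat r d" and B: "y * mat_adjoint T * v' \<in> carrier_mat r d"
    using mult_carrier_mat[OF xT vc] mult_carrier_mat[OF yT vc'] by auto
  ultimately have eq0: "0\<^sub>m r d = F j - - (C * a j + x * T * v) - - (y * mat_adjoint T * v')"
    by simp
  have Au: "- (C * a j + x * T * v) \<in> carrier_mat r d" and Bu: "- (y * mat_adjoint T * v') \<in> carrier_mat r d"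
    using A B by (simp_all only: uminus_carrier_iff_mat)
  have *: "0 = F j $$ (i, l) + (C * a j + x * T * v) $$ (i, l) + (y * mat_adjoint T * v') $$ (i, l)"
    if "i < r" "l < d" for i l
    using arg_cong[OF eq0, of "\<lambda>A. A $$ (i, l)"] that
    by (simp only: mat_minus_index[OF minus_carrier_mat[OF Au] Bu that] mat_minus_index[OF Fc Au that]
        mat_uminus_index[OF A that] mat_uminus_index[OF B that] index_zero_mat) simp
  show ?thesis
  proof (rule mat_eqI[OF Fc])
    show "- (C * a j + x * T * v + y * mat_adjoint T * v') \<in> carrier_mat r d"
      using add_carrier_mat[OF B] by (simp only: uminus_carrier_iff_mat)
    fix i l assume il: "i < r" "l < d"
    show "F j $$ (i, l) = (- (C * a j + x * T * v + y * mat_adjoint T * v')) $$ (i, l)"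
      using *[OF il] unfolding mat_uminus_index[OF add_carrier_mat[OF B] il] mat_add_index[OF A B il]
      by (simp add: add_eq_0_iff add.commute add.left_commute)
  qed
qed

text \<open>
  Now U H^* + z^{n+1} Q S has no Fourier coefficients at all. The exponents of the two summands are
  disjoint, so U H^* and with it U vanishes, and y is a moment of U.
\<close>

theorem homogeneous_solution_zero:
  assumes 0: "\<And>l. F l = 0\<^sub>m r d"
  shows "y = 0\<^sub>m r N"
proof -
  have "mat_coeff r d (\<lambda>t. D t * H t) k = 0\<^sub>m r d" for k
    by (rule mat_coeff_mult_right_eq_0[OF continuous_D H mat_coeff_D])
  then have DHH: "mat_coeff r d (\<lambda>t. D t * H t * mat_adjoint (H t)) k = 0\<^sub>m r d" for k
    by (intro mat_coeff_mult_right_eq_0[OF continuous_DH mat_series_adjoint[OF H]])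
  have "mat_coeff r d \<Phi> k = 0\<^sub>m r d" for k
    using mat_coeff_\<Phi>[of "nat k"] mat_coeff_\<Phi>_eq_0[of k] 0 by (cases "k \<ge> 0") auto
  then have "mat_coeff r d (\<lambda>t. \<Phi> t * H t) k = 0\<^sub>m r d" for k
    by (intro mat_coeff_mult_right_eq_0[OF continuous_\<Phi> H])
  then have \<Phi>HH: "mat_coeff r d (\<lambda>t. \<Phi> t * H t * mat_adjoint (H t)) k = 0\<^sub>m r d" for k
    by (intro mat_coeff_mult_right_eq_0[OF mat_continuous_mult[OF continuous_\<Phi> continuous_H]
        mat_series_adjoint[OF H]])
  have UH: "mat_coeff r d (\<lambda>t. U t * mat_adjoint (H t)) k = 0\<^sub>m r d" for k
  proof (cases "k > 0")
    case False
    then have "0\<^sub>m r d = 0\<^sub>m r d - mat_coeff r d (\<lambda>t. U t * mat_adjoint (H t)) k - 0\<^sub>m r d"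
      using DHH[of k] unfolding mat_coeff_DHH_eq by (simp add: \<Phi>HH mat_coeff_QS)
    then show ?thesis
      by (rule eq_zero_minus_minus_zero[OF mat_coeff_carrier])
  qed (rule mat_coeff_UH_adjoint)
  have "mat_coeff r d (\<lambda>t. U t * mat_adjoint (H t) * mat_adjoint (Hi t)) k = 0\<^sub>m r d" for k
    by (rule mat_coeff_mult_right_eq_0[OF continuous_UHa mat_series_adjoint[OF Hi] UH])
  moreover have "U t * mat_adjoint (H t) * mat_adjoint (Hi t) = U t" for t
  proof -
    have "U t * mat_adjoint (H t) * mat_adjoint (Hi t) = U t * mat_adjoint (Hi t * H t)"
      unfolding mat_adjoint_mult[OF Hi_carrier H_carrier]
      by (rule assoc_mult_mat[OF U_carrier, of _ d _ d]) auto
    then show ?thesis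
      by (simp add: HiH right_mult_one_mat[OF U_carrier])
  qed
  ultimately have "Uc k = 0\<^sub>m r d" for k
    using mat_coeff_U[of k] by simp
  then have "Uc k * mat_adjoint (P k) = 0\<^sub>m r N" for k
    using left_mult_zero_mat[OF mat_adjoint_carrier[OF P]] by simp
  then show ?thesis
    using Uc_moment mat_sums_unique[OF _ mat_sums_zero] by simp
qed

end

section \<open>Rational matrix functions on the closed disk\<close>

text \<open>
  A radius beyond 1 is what makes power series converge absolutely on the unit circle.
\<close>

definition outer_holomorphic :: "nat \<Rightarrow> real \<Rightarrow> (complex \<Rightarrow> complex mat) \<Rightarrow> bool" where
  "outer_holomorphic d R h \<longleftrightarrow> R > 1 \<and> (\<forall>z. h z \<in> carrier_mat d d) \<and>
     (\<forall>i<d. \<forall>j<d. (\<lambda>z. h z $$ (i, j)) holomorphic_on ball 0 R) \<and>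
     (\<forall>z\<in>ball 0 R. Determinant.det (h z) \<noteq> 0)"

lemma open_superset_cball_imp_ball:
  fixes S :: "complex set"
  assumes "open S" "cball 0 1 \<subseteq> S"
  obtains R where "R > 1" "ball 0 R \<subseteq> S"
proof -
  obtain e where e: "e > 0" "(\<Union>x\<in>cball 0 1. ball x e) \<subseteq> S"
    by (rule compact_subset_open_imp_ball_epsilon_subset[OF compact_cball assms])
  have "ball (0 :: complex) (1 + e) \<subseteq> (\<Union>x\<in>cball 0 1. ball x e)"
  proof (rule subsetI)
    fix z :: complex assume z: "z \<in> ball 0 (1 + e)"
    show "z \<in> (\<Union>x\<in>cball 0 1. ball x e)"
    proof (cases "norm z \<le> 1")
      case True
      then show ?thesis using e by (intro UN_I[of z]) auto
    next
      case False
      then have nz: "norm z > 1" by simp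
      have z0: "z \<noteq> 0"
        using nz by (intro notI) simp
      have "dist (z / norm z) z = norm z - 1"
      proof -
        have "z / norm z - z = of_real (1 / norm z - 1) * z"
          using z0 by (simp add: field_simps)
        then have "dist (z / norm z) z = \<bar>1 / norm z - 1\<bar> * norm z"
          by (simp only: dist_norm norm_mult norm_of_real)
        also have "\<dots> = norm z - 1"
          using nz z0 by (simp add: abs_if field_simps)
        finally show ?thesis .
      qed
      (* the nearest point of the closed disk is the radial projection *)
      then show ?thesis
        using z nz by (intro UN_I[of "z / norm z"]) (auto simp: norm_divide)
    qed
  qed
  then show ?thesis
    using that[of "1 + e"] e by auto
qed

lemma rational_no_poles_imp_holomorphic:
  assumes "rational_no_poles f"
  obtains Z where "finite Z" "Z \<inter> cball 0 1 = {}" "f holomorphic_on - Z"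
proof -
  obtain p q :: "complex poly" where q: "\<And>z. z \<in> cball 0 1 \<Longrightarrow> poly q z \<noteq> 0"
    and f: "\<And>z. poly q z \<noteq> 0 \<Longrightarrow> f z = poly p z / poly q z"
    using assms unfolding rational_no_poles_def by blast
  let ?Z = "{z. poly q z = 0}"
  have "q \<noteq> 0"
    using q[of 0] by auto
  then have "finite ?Z"
    by (rule poly_roots_finite)
  have "(\<lambda>z. poly p z / poly q z) holomorphic_on - ?Z"
    by (intro holomorphic_intros) auto
  then have "f holomorphic_on - ?Z"
    by (rule holomorphic_transform) (simp add: f)
  show ?thesis
    by (rule that[of ?Z]) (use \<open>finite ?Z\<close> \<open>f holomorphic_on - ?Z\<close> q in auto)
qed

lemma mat_rational_imp_holomorphic:
  assumes "\<And>i j. i < d \<Longrightarrow> j < d \<Longrightarrow> rational_no_poles (\<lambda>z. h z $$ (i, j))"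
  obtains Z where "finite Z" "Z \<inter> cball 0 1 = {}"
    "\<And>i j. i < d \<Longrightarrow> j < d \<Longrightarrow> (\<lambda>z. h z $$ (i, j)) holomorphic_on - Z"
proof -
  have "\<exists>Z. finite Z \<and> Z \<inter> cball 0 1 = {} \<and> (\<lambda>z. h z $$ (i, j)) holomorphic_on - Z"
    if "i < d" "j < d" for i j
    using rational_no_poles_imp_holomorphic[OF assms[OF that]] by metis
  then obtain Z where Z: "\<And>i j. i < d \<Longrightarrow> j < d \<Longrightarrow> finite (Z i j) \<and> Z i j \<inter> cball 0 1 = {} \<and>
      (\<lambda>z. h z $$ (i, j)) holomorphic_on - Z i j"
    by metis
  show ?thesis
  proof (rule that[of "\<Union>i\<in>{..<d}. \<Union>j\<in>{..<d}. Z i j"])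
    show "(\<lambda>z. h z $$ (i, j)) holomorphic_on - (\<Union>i\<in>{..<d}. \<Union>j\<in>{..<d}. Z i j)"
      if "i < d" "j < d" for i j
      by (rule holomorphic_on_subset[of _ "- Z i j"]) (use Z that in auto)
  qed (use Z in auto)
qed

lemma det_holomorphic:
  assumes "\<And>z. A z \<in> carrier_mat n n"
    and "\<And>i j. i < n \<Longrightarrow> j < n \<Longrightarrow> (\<lambda>z. A z $$ (i, j)) holomorphic_on S"
  shows "(\<lambda>z. Determinant.det (A z)) holomorphic_on S"
  unfolding Determinant.det_def'[OF assms(1)]
proof (intro holomorphic_intros assms(2))
  fix p i assume "p \<in> {p. p permutes {0..<n}}" "i \<in> {0..<n}"
  then show "p i < n"
    by (metis atLeastLessThan_iff mem_Collect_eq permutes_in_image)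
qed auto

lemma outer_rational_imp_outer_holomorphic:
  assumes "outer_rational d h"
  obtains R where "outer_holomorphic d R h"
proof -
  have hc: "\<And>z. h z \<in> carrier_mat d d"
    and rat: "\<And>i j. i < d \<Longrightarrow> j < d \<Longrightarrow> rational_no_poles (\<lambda>z. h z $$ (i, j))"
    and det: "\<And>z. z \<in> cball 0 1 \<Longrightarrow> Determinant.det (h z) \<noteq> 0"
    using assms unfolding outer_rational_def by blast+
  obtain Z where Z: "finite Z" "Z \<inter> cball 0 1 = {}"
    and holo: "\<And>i j. i < d \<Longrightarrow> j < d \<Longrightarrow> (\<lambda>z. h z $$ (i, j)) holomorphic_on - Z"
    using mat_rational_imp_holomorphic[of d h, OF rat] by metis
  define S0 where "S0 = - Z"
  have S0: "open S0" "cball 0 1 \<subseteq> S0"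
    using Z by (auto simp: S0_def finite_imp_closed)
  note holo = holo[folded S0_def]
  have "(\<lambda>z. Determinant.det (h z)) holomorphic_on S0"
    by (rule det_holomorphic[OF hc holo])
  then have "open (S0 \<inter> (\<lambda>z. Determinant.det (h z)) -` (- {0}))"
    using S0 by (intro continuous_open_preimage holomorphic_on_imp_continuous_on) auto
  moreover have "cball 0 1 \<subseteq> S0 \<inter> (\<lambda>z. Determinant.det (h z)) -` (- {0})"
    using S0 det by auto
  ultimately obtain R where R: "R > 1" "ball 0 R \<subseteq> S0 \<inter> (\<lambda>z. Determinant.det (h z)) -` (- {0})"
    by (rule open_superset_cball_imp_ball)
  have "outer_holomorphic d R h"
    unfolding outer_holomorphic_def using R hc holomorphic_on_subset[OF holo] by auto
  then show ?thesis by (rule that)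
qed

lemma minv:
  assumes A: "A \<in> carrier_mat d d" and det: "Determinant.det A \<noteq> 0"
  shows "minv A \<in> carrier_mat d d" "A * minv A = 1\<^sub>m d" "minv A * A = 1\<^sub>m d"
proof -
  obtain B where B: "mat_inverse A = Some B"
    using mat_inverse(1)[OF A, where b = "()"] det_non_zero_imp_unit[OF A det, of "()"]
    by (cases "mat_inverse A") auto
  from mat_inverse(2)[OF A B] show "minv A \<in> carrier_mat d d" "A * minv A = 1\<^sub>m d" "minv A * A = 1\<^sub>m d"
    by (auto simp: minv_def B)
qed

lemma minv_eqI:
  assumes A: "A \<in> carrier_mat d d" and B: "B \<in> carrier_mat d d" and AB: "A * B = 1\<^sub>m d"
  shows "minv A = B" "Determinant.det A \<noteq> 0"
proof -
  have "Determinant.det A * Determinant.det B = 1"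
    using det_mult[OF A B] by (simp add: AB)
  then show det: "Determinant.det A \<noteq> 0" by auto
  have "minv A = minv A * (A * B)"
    using minv(1)[OF A det] by (simp add: AB)
  also have "\<dots> = minv A * A * B"
    by (rule assoc_mult_mat[symmetric, OF minv(1)[OF A det] A B])
  finally show "minv A = B"
    using B by (simp add: minv(3)[OF A det])
qed

lemma invertible_mat_minv:
  fixes A :: "complex mat"
  assumes A: "A \<in> carrier_mat d d" and det: "Determinant.det A \<noteq> 0"
  shows "invertible_mat A"
  using A minv[OF A det] unfolding invertible_mat_def inverts_mat_def
  by (intro conjI exI[of _ "minv A"]) auto

lemma minv_adjoint:
  assumes A: "A \<in> carrier_mat d d" and det: "Determinant.det A \<noteq> 0"
  shows "minv (mat_adjoint A) = mat_adjoint (minv A)" "Determinant.det (mat_adjoint A) \<noteq> 0"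
proof -
  have "mat_adjoint A * mat_adjoint (minv A) = 1\<^sub>m d"
    unfolding mat_adjoint_mult[OF minv(1)[OF A det] A, symmetric] minv(3)[OF A det] by simp
  from minv_eqI[OF _ _ this] show "minv (mat_adjoint A) = mat_adjoint (minv A)" "Determinant.det (mat_adjoint A) \<noteq> 0"
    using A minv(1)[OF A det] by auto
qed

lemma minv_eq_adj_mat:
  assumes A: "A \<in> carrier_mat d d" and det: "Determinant.det A \<noteq> 0"
  shows "minv A = (1 / Determinant.det A) \<cdot>\<^sub>m adj_mat A"
proof (rule minv_eqI(1)[OF A])
  show "(1 / Determinant.det A) \<cdot>\<^sub>m adj_mat A \<in> carrier_mat d d"
    using adj_mat(1)[OF A] by simp
  have "A * ((1 / Determinant.det A) \<cdot>\<^sub>m adj_mat A) = (1 / Determinant.det A) \<cdot>\<^sub>m (A * adj_mat A)"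
    by (rule mult_smult_distrib[OF A adj_mat(1)[OF A]])
  also have "\<dots> = 1\<^sub>m d"
    unfolding adj_mat(2)[OF A] by (rule mat_eqI[of _ d d]) (use det in auto)
  finally show "A * ((1 / Determinant.det A) \<cdot>\<^sub>m adj_mat A) = 1\<^sub>m d" .
qed

text \<open>
  By Cramer's rule.
\<close>

lemma minv_holomorphic:
  assumes A: "\<And>z. A z \<in> carrier_mat d d"
    and holo: "\<And>i j. i < d \<Longrightarrow> j < d \<Longrightarrow> (\<lambda>z. A z $$ (i, j)) holomorphic_on S"
    and det: "\<And>z. z \<in> S \<Longrightarrow> Determinant.det (A z) \<noteq> 0"
    and ij: "i < d" "j < d"
  shows "(\<lambda>z. minv (A z) $$ (i, j)) holomorphic_on S"
proof -
  have "(\<lambda>z. Determinant.det (mat_delete (A z) j i)) holomorphic_on S"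
  proof (rule det_holomorphic[of _ "d - 1"])
    show "mat_delete (A z) j i \<in> carrier_mat (d - 1) (d - 1)" for z
      using A[of z] by (auto simp: mat_delete_def)
    fix k l assume kl: "k < d - 1" "l < d - 1"
    have "(\<lambda>z. mat_delete (A z) j i $$ (k, l)) =
        (\<lambda>z. A z $$ (if k < j then k else Suc k, if l < i then l else Suc l))"
      using kl by (auto simp: mat_delete_def fun_eq_iff carrier_matD[OF A])
    then show "(\<lambda>z. mat_delete (A z) j i $$ (k, l)) holomorphic_on S"
      using kl by (simp only:) (rule holo, auto)
  qed
  then have "(\<lambda>z. 1 / Determinant.det (A z) * ((-1) ^ (j + i) * Determinant.det (mat_delete (A z) j i))) holomorphic_on S"
    by (intro holomorphic_intros det_holomorphic[OF A holo] det)
  then show ?thesis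
  proof (rule holomorphic_transform)
    fix z assume "z \<in> S"
    then show "1 / Determinant.det (A z) * ((-1) ^ (j + i) * Determinant.det (mat_delete (A z) j i)) = minv (A z) $$ (i, j)"
      using minv_eq_adj_mat[OF A det] ij A[of z] by (simp add: adj_mat_def cofactor_def)
  qed
qed

text \<open>
  Power series coefficients are determined by the values on the open disk, but the Taylor series
  converges at a point outside the closed disk, hence absolutely on the circle.
\<close>

lemma holomorphic_imp_fourier_series:
  assumes R: "R > 1" and f: "f holomorphic_on ball 0 R"
    and c: "\<And>z. z \<in> ball 0 1 \<Longrightarrow> (\<lambda>k. z ^ k * c k) sums f z"
  shows "fourier_series int c (\<lambda>t. f (cis t))"
proof -
  have "eventually (\<lambda>u. u \<in> ball 0 1) (nhds (0::complex))"
    by (rule eventually_nhds_in_open) auto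
  then have "eventually (\<lambda>u. (\<lambda>n. fps_nth (Abs_fps c) n * u ^ n) sums f u) (nhds 0)"
    by eventually_elim (use c in \<open>auto simp: mult.commute\<close>)
  then have "f has_fps_expansion (Abs_fps c)"
    by (rule has_fps_expansionI)
  then have c_eq: "c n = (deriv ^^ n) f 0 / fact n" for n
    using fps_nth_fps_expansion by fastforce
  have sums: "(\<lambda>n. c n * w ^ n) sums f w" if "w \<in> ball 0 R" for w
    using holomorphic_power_series[OF f that] by (simp add: c_eq)
  define r where "r = (1 + R) / 2"
  have "summable (\<lambda>n. c n * of_real r ^ n)"
    using R by (intro sums_summable[OF sums]) (simp add: r_def del: of_real_divide of_real_add)
  from powser_insidea[OF this, of 1] have "summable (\<lambda>n. norm (c n))"
    using R by (simp add: r_def del: of_real_divide of_real_add)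
  moreover have "(\<lambda>l. c l * cis (of_int (int l) * t)) sums f (cis t)" for t
  proof -
    have "(\<lambda>l. c l * cis t ^ l) sums f (cis t)"
      by (rule sums) (use R in simp)
    then show ?thesis
      by (simp add: Complex.DeMoivre)
  qed
  ultimately show ?thesis
    by (auto simp: fourier_series_def)
qed

lemma power_series_imp_mat_fourier_series:
  assumes c: "power_series_coeffs d F c" and F: "\<And>t. F (cis t) \<in> carrier_mat d d" and R: "R > 1"
    and holo: "\<And>i j. i < d \<Longrightarrow> j < d \<Longrightarrow> (\<lambda>z. F z $$ (i, j)) holomorphic_on ball 0 R"
  shows "mat_series d d int c (\<lambda>t. F (cis t))"
proof (rule mat_seriesI)
  fix i j assume ij: "i < d" "j < d"
  show "fourier_series int (\<lambda>l. c l $$ (i, j)) (\<lambda>t. F (cis t) $$ (i, j))"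
    by (rule holomorphic_imp_fourier_series[OF R holo[OF ij]])
       (use c ij in \<open>auto simp: power_series_coeffs_def\<close>)
qed (use c F in \<open>auto simp: power_series_coeffs_def\<close>)

lemma mat_series_reflect:
  assumes "mat_series nr nc e G F"
  shows "mat_series nr nc (\<lambda>l. - e l) G (\<lambda>t. F (- t))"
proof (rule mat_seriesI)
  fix i j assume ij: "i < nr" "j < nc"
  have "(\<lambda>l. G l $$ (i, j) * cis (of_int (e l) * (- t))) sums F (- t) $$ (i, j)" for t
    using mat_seriesD(3)[OF assms ij] unfolding fourier_series_def by blast
  then show "fourier_series (\<lambda>l. - e l) (\<lambda>l. G l $$ (i, j)) (\<lambda>t. F (- t) $$ (i, j))"
    using mat_seriesD(3)[OF assms ij] unfolding fourier_series_def by auto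
qed (rule mat_seriesD[OF assms])+

lemma outer_holomorphic_tilde:
  assumes "outer_holomorphic d R h"
  shows "outer_holomorphic d R (h_tilde h)"
proof -
  have R: "R > 1" and hc: "\<And>z. h z \<in> carrier_mat d d"
    and holo: "\<And>i j. i < d \<Longrightarrow> j < d \<Longrightarrow> (\<lambda>z. h z $$ (i, j)) holomorphic_on ball 0 R"
    and det: "\<And>z. z \<in> ball 0 R \<Longrightarrow> Determinant.det (h z) \<noteq> 0"
    using assms unfolding outer_holomorphic_def by blast+
  have "(\<lambda>z. h_tilde h z $$ (i, j)) holomorphic_on ball 0 R" if ij: "i < d" "j < d" for i j
  proof -
    have "cnj ` ball 0 R = ball 0 R"
      by (auto simp: image_iff intro!: bexI[of _ "cnj _"])
    then have "cnj \<circ> (\<lambda>z. h z $$ (j, i)) \<circ> cnj holomorphic_on ball 0 R"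
      using holo[OF ij(2,1)] by (intro holomorphic_on_compose_cnj_cnj) auto
    also have "cnj \<circ> (\<lambda>z. h z $$ (j, i)) \<circ> cnj = (\<lambda>z. h_tilde h z $$ (i, j))"
      by (auto simp: fun_eq_iff h_tilde_def mat_adjoint_index[OF hc ij])
    finally show ?thesis .
  qed
  moreover have "Determinant.det (h_tilde h z) \<noteq> 0" if "z \<in> ball 0 R" for z
    unfolding h_tilde_def by (rule minv_adjoint(2)[OF hc det]) (use that in auto)
  moreover have "h_tilde h z \<in> carrier_mat d d" for z
    using hc by (auto simp: h_tilde_def)
  ultimately show ?thesis
    using R unfolding outer_holomorphic_def by blast
qed

lemma outer_fourier_series:
  assumes h: "outer_holomorphic d R h" and c: "power_series_coeffs d h c"
  shows "mat_series d d int c (\<lambda>t. h (cis t))"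
  by (rule power_series_imp_mat_fourier_series[OF c, of R])
     (use h in \<open>auto simp: outer_holomorphic_def\<close>)

lemma outer_inverse_fourier_series:
  assumes h: "outer_holomorphic d R h" and a: "power_series_coeffs d (\<lambda>z. - minv (h z)) a"
  shows "mat_series d d int (\<lambda>l. - a l) (\<lambda>t. minv (h (cis t)))"
proof -
  have R: "R > 1" and hc: "\<And>z. h z \<in> carrier_mat d d"
    and holo: "\<And>i j. i < d \<Longrightarrow> j < d \<Longrightarrow> (\<lambda>z. h z $$ (i, j)) holomorphic_on ball 0 R"
    and det: "\<And>z. z \<in> ball 0 R \<Longrightarrow> Determinant.det (h z) \<noteq> 0"
    using h unfolding outer_holomorphic_def by blast+
  have mc: "minv (h z) \<in> carrier_mat d d" if "z \<in> ball 0 R" for z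
    using minv(1)[OF hc det[OF that]] .
  have circle: "cis t \<in> ball 0 R" for t
    using R by simp
  have "mat_series d d int a (\<lambda>t. - minv (h (cis t)))"
  proof (rule power_series_imp_mat_fourier_series[OF a _ R])
    show "- minv (h (cis t)) \<in> carrier_mat d d" for t
      using mc[OF circle] by simp
    fix i j assume ij: "i < d" "j < d"
    have "(\<lambda>z. - (minv (h z) $$ (i, j))) holomorphic_on ball 0 R"
      by (intro holomorphic_intros minv_holomorphic[OF hc holo det ij])
    then show "(\<lambda>z. (- minv (h z)) $$ (i, j)) holomorphic_on ball 0 R"
      by (rule holomorphic_transform) (rule mat_uminus_index[OF mc ij, symmetric])
  qed
  from mat_series_uminus[OF this] show ?thesis
    by (simp add: uminus_uminus_mat)
qed

lemma power_series_coeffs_exist: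
  assumes h: "outer_holomorphic d R h"
  obtains s where "power_series_coeffs d h s"
proof -
  define s where "s l = mat d d (\<lambda>(i, j). (deriv ^^ l) (\<lambda>z. h z $$ (i, j)) 0 / fact l)" for l
  have "(\<lambda>k. z ^ k * s k $$ (i, j)) sums (h z $$ (i, j))" if "z \<in> ball 0 1" "i < d" "j < d" for z i j
  proof -
    have "(\<lambda>z. h z $$ (i, j)) holomorphic_on ball 0 R" "R > 1"
      using h that unfolding outer_holomorphic_def by auto
    from holomorphic_power_series[OF this(1), of z] this(2) show ?thesis
      using that by (simp add: s_def mult.commute)
  qed
  then show ?thesis
    using that[of s] unfolding power_series_coeffs_def by (simp add: s_def)
qed

section \<open>Taylor coefficients and continued partial fractions\<close>

lemma fps_nth_higher_deriv:
  fixes F :: "complex fps"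
  shows "fps_nth ((fps_deriv ^^ k) F) n = fact k * of_nat ((n + k) choose k) * fps_nth F (n + k)"
proof (induction k arbitrary: n)
  case (Suc k)
  have "Suc k * (Suc (n + k) choose Suc k) = Suc n * (Suc (n + k) choose k)"
    using binomial_absorb_comp[of "Suc (n + k)" k] Suc_times_binomial_eq[of "n + k" k]
    by (simp add: mult.commute)
  then have eq: "complex_of_nat (Suc k) * of_nat (Suc (n + k) choose Suc k) =
      of_nat (Suc n) * of_nat (Suc (n + k) choose k)"
    by (simp only: of_nat_mult[symmetric])
  have "fps_nth ((fps_deriv ^^ Suc k) F) n =
      of_nat (Suc n) * (fact k * of_nat (Suc (n + k) choose k) * fps_nth F (Suc (n + k)))"
    by (simp add: Suc.IH)
  also have "\<dots> = fact k * (of_nat (Suc n) * of_nat (Suc (n + k) choose k)) * fps_nth F (Suc (n + k))"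
    by (simp only: mult_ac)
  also have "\<dots> = fact (Suc k) * of_nat ((n + Suc k) choose Suc k) * fps_nth F (n + Suc k)"
    unfolding eq[symmetric] by (simp only: fact_Suc of_nat_mult mult_ac add_Suc_right)
  finally show ?case .
qed simp

text \<open>
  Termwise differentiation. For n < k the binomial coefficient is zero, so the truncated exponent
  n - k is harmless.
\<close>

lemma power_series_taylor_sums:
  fixes f :: "complex \<Rightarrow> complex"
  assumes f: "\<And>z. z \<in> ball 0 1 \<Longrightarrow> (\<lambda>n. b n * z ^ n) sums f z" and w: "w \<in> ball 0 1"
  shows "(\<lambda>n. b n * of_nat (n choose k) * w ^ (n - k)) sums ((deriv ^^ k) f w / fact k)"
proof -
  define F where "F = Abs_fps b"
  have radius: "fps_conv_radius ((fps_deriv ^^ k) F) \<ge> 1" for k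
  proof (induction k)
    case 0
    have "conv_radius b \<ge> ereal 1"
    proof (rule conv_radius_geI_ex')
      fix r :: real assume "0 < r" "ereal r < ereal 1"
      then show "summable (\<lambda>n. b n * of_real r ^ n)"
        by (intro sums_summable[OF f]) auto
    qed
    then show ?case
      by (simp add: F_def fps_conv_radius_def one_ereal_def)
  next
    case (Suc k)
    then show ?case
      using fps_conv_radius_deriv[of "(fps_deriv ^^ k) F"] by simp
  qed
  have deriv: "(deriv ^^ k) f z = eval_fps ((fps_deriv ^^ k) F) z" if "z \<in> ball 0 1" for k z
    using that
  proof (induction k arbitrary: z)
    case 0
    then show ?case
      using f by (auto simp: eval_fps_def F_def sums_iff)
  next
    case (Suc k)
    have "eventually (\<lambda>u. u \<in> ball 0 1) (nhds z)"
      using Suc.prems by (intro eventually_nhds_in_open) auto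
    then have "eventually (\<lambda>u. (deriv ^^ k) f u = eval_fps ((fps_deriv ^^ k) F) u) (nhds z)"
      by eventually_elim (rule Suc.IH)
    then have "deriv ((deriv ^^ k) f) z = deriv (eval_fps ((fps_deriv ^^ k) F)) z"
      by (intro deriv_cong_ev) auto
    also have "\<dots> = eval_fps (fps_deriv ((fps_deriv ^^ k) F)) z"
    proof (rule eval_fps_deriv[symmetric])
      have "ereal (norm z) < 1"
        using Suc.prems by (simp add: one_ereal_def)
      then show "ereal (norm z) < fps_conv_radius ((fps_deriv ^^ k) F)"
        using radius less_le_trans by blast
    qed
    finally show ?case
      by simp
  qed
  have "ereal (norm w) < 1"
    using w by (simp add: one_ereal_def)
  then have "ereal (norm w) < conv_radius (fps_nth ((fps_deriv ^^ k) F))"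
    using radius[of k] less_le_trans unfolding fps_conv_radius_def by blast
  from summable_in_conv_radius[OF this]
  have "(\<lambda>n. fps_nth ((fps_deriv ^^ k) F) n * w ^ n) sums (deriv ^^ k) f w"
    using deriv[OF w, of k] by (simp add: eval_fps_def summable_sums)
  from sums_divide[OF this, of "fact k"]
  have "(\<lambda>n. b (n + k) * of_nat ((n + k) choose k) * w ^ (n + k - k)) sums ((deriv ^^ k) f w / fact k)"
    unfolding fps_nth_higher_deriv by (simp add: F_def mult_ac)
  then show ?thesis
    by (subst (asm) sums_zero_iff_shift) auto
qed

lemma power_series_shifted_taylor_sums:
  fixes f :: "complex \<Rightarrow> complex"
  assumes f: "\<And>z. z \<in> ball 0 1 \<Longrightarrow> (\<lambda>n. b n * z ^ n) sums f z" and w: "w \<in> ball 0 1"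
  shows "(\<lambda>n. b n * of_nat ((n + i) choose k) * w ^ (n + i - k)) sums ((deriv ^^ k) (\<lambda>z. z ^ i * f z) w / fact k)"
proof -
  let ?b = "\<lambda>n. if n < i then 0 else b (n - i)"
  have "(\<lambda>n. ?b n * z ^ n) sums (z ^ i * f z)" if z: "z \<in> ball 0 1" for z
  proof -
    have "(\<lambda>n. ?b (n + i) * z ^ (n + i)) sums (z ^ i * f z)"
      using sums_mult[OF f[OF z], of "z ^ i"] by (simp add: power_add mult_ac)
    then show ?thesis
      by (subst (asm) sums_zero_iff_shift) auto
  qed
  from power_series_taylor_sums[OF this w]
  have "(\<lambda>n. ?b n * of_nat (n choose k) * w ^ (n - k)) sums ((deriv ^^ k) (\<lambda>z. z ^ i * f z) w / fact k)" .
  then have "(\<lambda>n. ?b (n + i) * of_nat ((n + i) choose k) * w ^ (n + i - k)) sums ((deriv ^^ k) (\<lambda>z. z ^ i * f z) w / fact k)"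
    by (subst sums_zero_iff_shift) auto
  then show ?thesis by simp
qed

lemma taylor_coeff_eq:
  assumes f: "f analytic_on {w}" and F: "(\<lambda>x. f (w + x)) has_fps_expansion F"
  shows "(deriv ^^ k) f w / fact k = fps_nth F k"
proof -
  have "fps_nth F k = fps_nth (fps_expansion f w) k"
    using fps_nth_fps_expansion[OF F] fps_nth_fps_expansion[OF analytic_at_imp_has_fps_expansion[OF f]]
    by simp
  then show ?thesis
    by (simp add: fps_expansion_def)
qed

text \<open>
  Only the values off the point w enter the limit, so F may have a removable singularity there.
\<close>

lemma Lim_higher_deriv_eq:
  assumes eq: "eventually (\<lambda>z. F z = G z) (at w)" and G: "G holomorphic_on V" "open V" "w \<in> V"
  shows "Lim (at w) (\<lambda>z. 1 / fact k * (deriv ^^ k) F z) = (deriv ^^ k) G w / fact k"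
proof (rule tendsto_Lim)
  obtain U where U: "open U" "w \<in> U" "\<And>z. z \<in> U \<Longrightarrow> z \<noteq> w \<Longrightarrow> F z = G z"
    using eq unfolding eventually_at_topological by blast
  have "(deriv ^^ k) F z = (deriv ^^ k) G z" if "z \<in> U" "z \<noteq> w" for z
  proof (rule higher_deriv_cong_ev)
    have "eventually (\<lambda>z. z \<in> U - {w}) (nhds z)"
      using that U by (intro eventually_nhds_in_open) auto
    then show "eventually (\<lambda>z. F z = G z) (nhds z)"
      by eventually_elim (use U in auto)
  qed auto
  then have ev: "eventually (\<lambda>z. (deriv ^^ k) G z / fact k = 1 / fact k * (deriv ^^ k) F z) (at w)"
    using U unfolding eventually_at_topological by (intro exI[of _ U]) auto
  have "(deriv ^^ k) G holomorphic_on V"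
    using G by (intro holomorphic_higher_deriv)
  then have "isCont ((deriv ^^ k) G) w"
    using G continuous_on_eq_continuous_at holomorphic_on_imp_continuous_on by blast
  then have "((\<lambda>z. (deriv ^^ k) G z / fact k) \<longlongrightarrow> (deriv ^^ k) G w / fact k) (at w)"
    by (intro tendsto_intros) (auto simp: isCont_def)
  then show "((\<lambda>z. 1 / fact k * (deriv ^^ k) F z) \<longlongrightarrow> (deriv ^^ k) G w / fact k) (at w)"
    by (rule Lim_transform_eventually[OF _ ev])
qed auto

text \<open>
  The entries of the partial fraction expansion as functions on the whole plane, away from the poles.
\<close>

definition partial_fraction_entry ::
    "nat \<Rightarrow> (nat \<Rightarrow> nat) \<Rightarrow> (nat \<Rightarrow> complex) \<Rightarrow> complex mat \<Rightarrow> (nat \<Rightarrow> nat \<Rightarrow> complex mat) \<Rightarrow>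
     nat \<Rightarrow> nat \<Rightarrow> complex \<Rightarrow> complex" where
  "partial_fraction_entry K m p \<rho>\<^sub>0 \<rho> i j z = - \<rho>\<^sub>0 $$ (i, j)
     - (\<Sum>\<mu>=1..K. \<Sum>k=1..m \<mu>. \<rho> \<mu> k $$ (i, j) / (1 - cnj (p \<mu>) * z) ^ k)
     - (\<Sum>k=1..m 0. \<rho> 0 k $$ (i, j) * z ^ k)"

lemma minv_eq_partial_fraction_entry:
  assumes pf: "partial_fractions d h K m p \<rho>\<^sub>0 \<rho>" and z: "z \<in> cball 0 1" and ij: "i < d" "j < d"
  shows "minv (h z) $$ (i, j) = partial_fraction_entry K m p \<rho>\<^sub>0 \<rho> i j z"
proof -
  have \<rho>: "\<rho> \<mu> k \<in> carrier_mat d d" if "\<mu> \<in> {0..K}" "k \<in> {1..m \<mu>}" for \<mu> k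
    using pf that unfolding partial_fractions_def by blast
  have eq: "minv (h z) = - \<rho>\<^sub>0
        - mat_sum d d (\<lambda>\<mu>. mat_sum d d (\<lambda>j. (1 / (1 - cnj (p \<mu>) * z) ^ j) \<cdot>\<^sub>m \<rho> \<mu> j) {1..m \<mu>}) {1..K}
        - mat_sum d d (\<lambda>j. z ^ j \<cdot>\<^sub>m \<rho> 0 j) {1..m 0}"
    and \<rho>0: "\<rho>\<^sub>0 \<in> carrier_mat d d"
    using pf z unfolding partial_fractions_def by blast+
  have smult: "(x \<cdot>\<^sub>m \<rho> \<mu> k) $$ (i, j) = x * \<rho> \<mu> k $$ (i, j)" if "\<mu> \<in> {0..K}" "k \<in> {1..m \<mu>}" for x \<mu> k
    by (rule mat_smult_index[OF \<rho>[OF that] ij])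
  show ?thesis
    using ij \<rho>0 smult unfolding eq partial_fraction_entry_def by (simp add: mat_sum_def mult.commute[of "z ^ _"])
qed

text \<open>
  The hypothesis on the expansion speaks of the closed disk only, but the function h^\<dagger> near a pole
  evaluates h outside of it. Since the entries of h are rational, the identity h B = 1 with the
  expansion B is an identity of holomorphic functions on the complement of a finite set, which is
  connected.
\<close>

lemma partial_fractions_continued:
  assumes pf: "partial_fractions d h K m p \<rho>\<^sub>0 \<rho>" and h: "outer_rational d h"
  obtains Z where "finite Z"
    "\<And>z. z \<notin> Z \<Longrightarrow> Determinant.det (h z) \<noteq> 0"
    "\<And>z i j. z \<notin> Z \<Longrightarrow> i < d \<Longrightarrow> j < d \<Longrightarrow> minv (h z) $$ (i, j) = partial_fraction_entry K m p \<rho>\<^sub>0 \<rho> i j z"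
proof -
  have hc: "\<And>z. h z \<in> carrier_mat d d"
    and rat: "\<And>i j. i < d \<Longrightarrow> j < d \<Longrightarrow> rational_no_poles (\<lambda>z. h z $$ (i, j))"
    and det: "\<And>z. z \<in> cball 0 1 \<Longrightarrow> Determinant.det (h z) \<noteq> 0"
    using h unfolding outer_rational_def by blast+
  have p: "p \<mu> \<in> ball 0 1 - {0}" if "\<mu> \<in> {1..K}" for \<mu>
    using pf that unfolding partial_fractions_def by blast
  obtain Z where Z: "finite Z" "Z \<inter> cball 0 1 = {}"
    and holo: "\<And>i j. i < d \<Longrightarrow> j < d \<Longrightarrow> (\<lambda>z. h z $$ (i, j)) holomorphic_on - Z"
    using mat_rational_imp_holomorphic[of d h, OF rat] by metis
  define Z' where "Z' = Z \<union> (\<lambda>\<mu>. 1 / cnj (p \<mu>)) ` {1..K}"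
  have Z'f: "finite Z'"
    using Z by (simp add: Z'_def)
  have Z'1: "ball 0 1 \<subseteq> - Z'"
  proof
    fix z :: complex assume z: "z \<in> ball 0 1"
    have "z \<noteq> 1 / cnj (p \<mu>)" if "\<mu> \<in> {1..K}" for \<mu>
    proof
      assume "z = 1 / cnj (p \<mu>)"
      then have "norm z * norm (p \<mu>) = 1"
        using p[OF that] by (simp add: norm_divide)
      moreover have "norm z * norm (p \<mu>) < 1"
        using z p[OF that] mult_strict_mono[of "norm z" 1 "norm (p \<mu>)" 1] by auto
      ultimately show False by simp
    qed
    then show "z \<in> - Z'"
      using z Z unfolding Z'_def by (metis (no_types, lifting) ComplI IntI UnE ball_subset_cball empty_iff image_iff subsetD)
  qed
  have conn: "connected (- Z')" and op: "open (- Z')"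
    using connected_open_delete_finite[of "UNIV :: complex set" Z'] Z'f
    by (auto simp: Compl_eq_Diff_UNIV finite_imp_closed open_Diff)
  have nz: "1 - cnj (p \<mu>) * z \<noteq> 0" if "\<mu> \<in> {1..K}" "z \<in> - Z'" for \<mu> z
  proof
    assume "1 - cnj (p \<mu>) * z = 0"
    then have "z = 1 / cnj (p \<mu>)"
      using p[OF that(1)] by (auto simp: field_simps)
    then show False
      using that by (auto simp: Z'_def)
  qed
  have pf_holo: "partial_fraction_entry K m p \<rho>\<^sub>0 \<rho> i j holomorphic_on - Z'" for i j
    unfolding partial_fraction_entry_def[abs_def] by (intro holomorphic_intros) (use nz in auto)
  have h_holo: "(\<lambda>z. h z $$ (i, j)) holomorphic_on - Z'" if "i < d" "j < d" for i j
    by (rule holomorphic_on_subset[OF holo[OF that]]) (auto simp: Z'_def)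
  have id: "(\<Sum>k<d. h z $$ (i, k) * partial_fraction_entry K m p \<rho>\<^sub>0 \<rho> k j z) = 1\<^sub>m d $$ (i, j)"
    if ij: "i < d" "j < d" and z: "z \<in> - Z'" for i j z
  proof (rule analytic_continuation_open[of "ball 0 1" "- Z'" _ _ z])
    show "(\<lambda>z. \<Sum>k<d. h z $$ (i, k) * partial_fraction_entry K m p \<rho>\<^sub>0 \<rho> k j z) holomorphic_on - Z'"
      using ij by (intro holomorphic_intros pf_holo h_holo) auto
    fix z :: complex assume z: "z \<in> ball 0 1"
    then have zc: "z \<in> cball 0 1" by auto
    have "(\<Sum>k<d. h z $$ (i, k) * minv (h z) $$ (k, j)) = (h z * minv (h z)) $$ (i, j)"
      by (rule mat_mult_index[symmetric, OF hc minv(1)[OF hc det[OF zc]] ij])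
    then show "(\<Sum>k<d. h z $$ (i, k) * partial_fraction_entry K m p \<rho>\<^sub>0 \<rho> k j z) = 1\<^sub>m d $$ (i, j)"
      using ij by (simp add: minv(2)[OF hc det[OF zc]] minv_eq_partial_fraction_entry[OF pf zc])
  qed (use conn op Z'1 z in auto)
  define B where "B z = mat d d (\<lambda>(i, j). partial_fraction_entry K m p \<rho>\<^sub>0 \<rho> i j z)" for z
  have Bc: "B z \<in> carrier_mat d d" for z
    by (simp add: B_def)
  have hB: "h z * B z = 1\<^sub>m d" if "z \<notin> Z'" for z
  proof (rule mat_eqI[of _ d d])
    fix i j assume ij: "i < d" "j < d"
    have "(h z * B z) $$ (i, j) = (\<Sum>k<d. h z $$ (i, k) * B z $$ (k, j))"
      by (rule mat_mult_index[OF hc Bc ij])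
    also have "\<dots> = (\<Sum>k<d. h z $$ (i, k) * partial_fraction_entry K m p \<rho>\<^sub>0 \<rho> k j z)"
      using ij by (intro sum.cong) (auto simp: B_def)
    finally show "(h z * B z) $$ (i, j) = 1\<^sub>m d $$ (i, j)"
      using id[OF ij] that by simp
  qed (rule mult_carrier_mat[OF hc Bc], simp)
  show ?thesis
  proof (rule that[OF Z'f])
    show "Determinant.det (h z) \<noteq> 0" if "z \<notin> Z'" for z
      using minv_eqI(2)[OF hc Bc hB[OF that]] .
    show "minv (h z) $$ (i, j) = partial_fraction_entry K m p \<rho>\<^sub>0 \<rho> i j z" if "z \<notin> Z'" "i < d" "j < d" for z i j
      using minv_eqI(1)[OF hc Bc hB[OF that(1)]] that by (simp add: B_def)
  qed
qed

section \<open>Principal parts of the phase function\<close>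

text \<open>
  Near w = p_\<mu>, the inverse of h^\<dagger> is the sum of a holomorphic function and of the terms
  -(z / (z - w))^i \<rho>_{\<mu>,i}^*. After multiplication by hs and (z - w)^m with m = m_\<mu>, the holomorphic
  part has no Taylor coefficients below m, and the i-th term becomes -(z - w)^{m-i} z^i hs \<rho>_{\<mu>,i}^*,
  whose sign cancels the one in the definition of \<theta>. The Taylor coefficient of (z - w)^{m-i} z^i hs at
  m - j is the one of z^i hs at i - j, which is a sum over the power series of hs.
\<close>

lemma theta_sums:
  assumes pf: "partial_fractions d h K m p \<rho>\<^sub>0 \<rho>" and h: "outer_rational d h"
    and hs: "outer_holomorphic d R hs"
    and s: "\<And>z i j. z \<in> ball 0 1 \<Longrightarrow> i < d \<Longrightarrow> j < d \<Longrightarrow> (\<lambda>l. s l $$ (i, j) * z ^ l) sums hs z $$ (i, j)"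
    and \<mu>: "\<mu> \<in> {1..K}" and j: "j \<in> {1..m \<mu>}" and rc: "r < d" "c < d"
  shows "(\<lambda>l. \<Sum>t<d. \<Sum>i=j..m \<mu>. cnj (\<rho> \<mu> i $$ (c, t)) *
      (s l $$ (r, t) * of_nat ((l + i) choose (i - j)) * p \<mu> ^ (l + j)))
    sums theta_mat d h hs m p \<mu> j $$ (r, c)"
proof -
  define w where "w = p \<mu>"
  have hc: "\<And>z. h z \<in> carrier_mat d d"
    using h unfolding outer_rational_def by blast
  have hsc: "\<And>z. hs z \<in> carrier_mat d d" and R: "R > 1"
    and hs_holo: "\<And>i j. i < d \<Longrightarrow> j < d \<Longrightarrow> (\<lambda>z. hs z $$ (i, j)) holomorphic_on ball 0 R"
    using hs unfolding outer_holomorphic_def by blast+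
  have p: "\<And>\<mu>. \<mu> \<in> {1..K} \<Longrightarrow> p \<mu> \<in> ball 0 1 - {0}" and inj: "inj_on p {1..K}"
    using pf unfolding partial_fractions_def by blast+
  have w: "w \<in> ball 0 1" "w \<noteq> 0"
    using p[OF \<mu>] by (auto simp: w_def)
  obtain Z where Z: "finite Z" "\<And>z. z \<notin> Z \<Longrightarrow> Determinant.det (h z) \<noteq> 0"
    "\<And>z i j. z \<notin> Z \<Longrightarrow> i < d \<Longrightarrow> j < d \<Longrightarrow> minv (h z) $$ (i, j) = partial_fraction_entry K m p \<rho>\<^sub>0 \<rho> i j z"
    by (rule partial_fractions_continued[OF pf h]) (rule that)
  define V where "V = ball 0 1 - {0} - p ` ({1..K} - {\<mu>})"
  have V: "open V" "w \<in> V" and VR: "V \<subseteq> ball 0 R"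
  proof -
    show "open V" unfolding V_def
      by (intro open_Diff) (auto intro: finite_imp_closed)
    have "w \<notin> p ` ({1..K} - {\<mu>})"
      unfolding w_def using \<mu> by (subst inj_on_image_mem_iff[OF inj]) auto
    then show "w \<in> V" using w by (simp add: V_def)
    show "V \<subseteq> ball 0 R" using R by (auto simp: V_def)
  qed
  (* the part of the (t, c) entry of the inverse of the dagger function that is holomorphic at w *)
  define B where "B t z = - cnj (\<rho>\<^sub>0 $$ (c, t))
     - (\<Sum>\<nu>\<in>{1..K} - {\<mu>}. \<Sum>k=1..m \<nu>. cnj (\<rho> \<nu> k $$ (c, t)) * (z / (z - p \<nu>)) ^ k)
     - (\<Sum>k=1..m 0. cnj (\<rho> 0 k $$ (c, t)) * (1 / z) ^ k)" for t z
  have B_holo: "B t holomorphic_on V" for t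
    unfolding B_def[abs_def] by (intro holomorphic_intros) (auto simp: V_def)
  define F where "F z = (z - w) ^ m \<mu> * ((hs z * minv (h_dagger h z)) $$ (r, c))" for z
  (* the holomorphic continuation of F through w *)
  define G where "G z = (\<Sum>t<d. hs z $$ (r, t) * ((z - w) ^ m \<mu> * B t z) -
      (\<Sum>i=1..m \<mu>. cnj (\<rho> \<mu> i $$ (c, t)) * ((z - w) ^ (m \<mu> - i) * (z ^ i * hs z $$ (r, t)))))" for z
  have hs_V: "(\<lambda>z. hs z $$ (r, t)) holomorphic_on V" if "t < d" for t
    by (rule holomorphic_on_subset[OF hs_holo[OF rc(1) that] VR])
  have G_holo: "G holomorphic_on V"
    unfolding G_def[abs_def] by (intro holomorphic_intros hs_V B_holo) auto
  have ev: "eventually (\<lambda>z. F z = G z) (at w)"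
  proof -
    define Z' where "Z' = (\<lambda>\<zeta>. 1 / cnj \<zeta>) ` Z"
    have "finite Z'" using Z by (simp add: Z'_def)
    then have "open (V - (Z' - {w}))"
      using V by (intro open_Diff finite_imp_closed) auto
    then have "eventually (\<lambda>z. z \<in> V - (Z' - {w}) \<and> z \<noteq> w) (at w)"
      using V unfolding eventually_at_topological by (intro exI[of _ "V - (Z' - {w})"]) auto
    then show ?thesis
    proof eventually_elim
      case (elim z)
      then have z: "z \<noteq> w" "z \<noteq> 0" "z \<notin> Z'" "z \<in> V"
        by (auto simp: V_def)
      define \<zeta> where "\<zeta> = 1 / cnj z"
      have \<zeta>: "\<zeta> \<notin> Z"
      proof
        assume "\<zeta> \<in> Z"
        then have "1 / cnj \<zeta> \<in> Z'" by (auto simp: Z'_def)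
        then show False using z by (simp add: \<zeta>_def)
      qed
      have dag: "minv (h_dagger h z) = mat_adjoint (minv (h \<zeta>))"
        unfolding h_dagger_def \<zeta>_def[symmetric] by (rule minv_adjoint(1)[OF hc Z(2)[OF \<zeta>]])
      have mc: "minv (h \<zeta>) \<in> carrier_mat d d"
        by (rule minv(1)[OF hc Z(2)[OF \<zeta>]])
      have entry: "mat_adjoint (minv (h \<zeta>)) $$ (t, c) =
          B t z - (\<Sum>i=1..m \<mu>. cnj (\<rho> \<mu> i $$ (c, t)) * (z / (z - w)) ^ i)" if t: "t < d" for t
      proof -
        have "cnj (1 - cnj (p \<nu>) * \<zeta>) = (z - p \<nu>) / z" for \<nu>
          using z by (simp add: \<zeta>_def field_simps)
        then have frac: "cnj (x / (1 - cnj (p \<nu>) * \<zeta>) ^ k) = cnj x * (z / (z - p \<nu>)) ^ k" for x \<nu> k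
          by (simp add: power_divide)
        have "cnj (x * \<zeta> ^ k) = cnj x * (1 / z) ^ k" for x k
          by (simp add: \<zeta>_def power_divide)
        note simps = frac this
        have "mat_adjoint (minv (h \<zeta>)) $$ (t, c) = cnj (partial_fraction_entry K m p \<rho>\<^sub>0 \<rho> c t \<zeta>)"
          using t rc by (simp add: mat_adjoint_index[OF mc] Z(3)[OF \<zeta>])
        also have "\<dots> = - cnj (\<rho>\<^sub>0 $$ (c, t))
           - (\<Sum>\<nu>\<in>{1..K}. \<Sum>k=1..m \<nu>. cnj (\<rho> \<nu> k $$ (c, t)) * (z / (z - p \<nu>)) ^ k)
           - (\<Sum>k=1..m 0. cnj (\<rho> 0 k $$ (c, t)) * (1 / z) ^ k)"
          unfolding partial_fraction_entry_def complex_cnj_diff complex_cnj_minus cnj_sum simps ..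
        also have "(\<Sum>\<nu>\<in>{1..K}. \<Sum>k=1..m \<nu>. cnj (\<rho> \<nu> k $$ (c, t)) * (z / (z - p \<nu>)) ^ k) =
            (\<Sum>i=1..m \<mu>. cnj (\<rho> \<mu> i $$ (c, t)) * (z / (z - w)) ^ i) +
            (\<Sum>\<nu>\<in>{1..K} - {\<mu>}. \<Sum>k=1..m \<nu>. cnj (\<rho> \<nu> k $$ (c, t)) * (z / (z - p \<nu>)) ^ k)"
          unfolding w_def by (rule sum.remove[OF _ \<mu>]) simp
        finally show ?thesis
          by (simp add: B_def)
      qed
      have pw: "(z - w) ^ m \<mu> * (z / (z - w)) ^ i = (z - w) ^ (m \<mu> - i) * z ^ i" if "i \<le> m \<mu>" for i
      proof -
        have "(z - w) ^ m \<mu> = (z - w) ^ (m \<mu> - i) * (z - w) ^ i"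
          using that by (simp add: power_add[symmetric])
        then show ?thesis
          using z by (simp add: power_divide)
      qed
      have "F z = (z - w) ^ m \<mu> * (\<Sum>t<d. hs z $$ (r, t) *
          (B t z - (\<Sum>i=1..m \<mu>. cnj (\<rho> \<mu> i $$ (c, t)) * (z / (z - w)) ^ i)))"
        unfolding F_def dag mat_mult_index[OF hsc mat_adjoint_carrier[OF mc] rc] by (simp add: entry)
      also have "\<dots> = (\<Sum>t<d. hs z $$ (r, t) * ((z - w) ^ m \<mu> * B t z) -
          (\<Sum>i=1..m \<mu>. cnj (\<rho> \<mu> i $$ (c, t)) * (((z - w) ^ m \<mu> * (z / (z - w)) ^ i) * hs z $$ (r, t))))"
        unfolding sum_distrib_left sum_distrib_right right_diff_distrib
        by (intro sum.cong refl arg_cong2[of _ _ _ _ "(-)"]) (simp_all only: mult_ac)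
      also have "\<dots> = G z"
        unfolding G_def by (intro sum.cong refl arg_cong2[of _ _ _ _ "(-)"]) (auto simp: pw mult.assoc)
      finally show ?case .
    qed
  qed
  have an: "f analytic_on {w}" if "f holomorphic_on V" for f
    unfolding analytic_at using that V by (intro exI[of _ V]) auto
  define HT where "HT t = fps_expansion (\<lambda>z. hs z $$ (r, t)) w" for t
  define BT where "BT t = fps_expansion (B t) w" for t
  define ZT where "ZT i t = fps_expansion (\<lambda>z. z ^ i * hs z $$ (r, t)) w" for i t
  define GT where "GT = (\<Sum>t<d. HT t * (fps_X ^ m \<mu> * BT t) -
      (\<Sum>i=1..m \<mu>. fps_const (cnj (\<rho> \<mu> i $$ (c, t))) * (fps_X ^ (m \<mu> - i) * ZT i t)))"
  have HT: "(\<lambda>x. hs (w + x) $$ (r, t)) has_fps_expansion HT t"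
    and ZT: "(\<lambda>x. (w + x) ^ i * hs (w + x) $$ (r, t)) has_fps_expansion ZT i t" if "t < d" for t i
    unfolding HT_def ZT_def
    by (rule analytic_at_imp_has_fps_expansion[OF an], intro holomorphic_intros hs_V that)+
  have BT: "(\<lambda>x. B t (w + x)) has_fps_expansion BT t" for t
    unfolding BT_def by (intro analytic_at_imp_has_fps_expansion an B_holo)
  have "(\<lambda>x. G (w + x)) has_fps_expansion GT"
    unfolding G_def GT_def add_diff_cancel_left'
  proof (intro has_fps_expansion_sum has_fps_expansion_diff)
    fix t i assume t: "t \<in> {..<d}"
    show "(\<lambda>x. hs (w + x) $$ (r, t) * (x ^ m \<mu> * B t (w + x))) has_fps_expansion HT t * (fps_X ^ m \<mu> * BT t)"
      using t by (intro has_fps_expansion_mult has_fps_expansion_fps_X_power HT BT) simp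
    show "(\<lambda>x. cnj (\<rho> \<mu> i $$ (c, t)) * (x ^ (m \<mu> - i) * ((w + x) ^ i * hs (w + x) $$ (r, t)))) has_fps_expansion
        fps_const (cnj (\<rho> \<mu> i $$ (c, t))) * (fps_X ^ (m \<mu> - i) * ZT i t)"
      using t by (intro has_fps_expansion_cmult_left has_fps_expansion_mult[of "\<lambda>x. x ^ (m \<mu> - i)"]
          has_fps_expansion_fps_X_power ZT) simp
  qed
  then have taylor: "(deriv ^^ k) G w / fact k = fps_nth GT k" for k
    by (rule taylor_coeff_eq[OF an[OF G_holo]])
  have "theta_mat d h hs m p \<mu> j $$ (r, c) = - fps_nth GT (m \<mu> - j)"
    using rc Lim_higher_deriv_eq[OF ev G_holo V, of "m \<mu> - j"]
    unfolding taylor F_def[abs_def] by (simp add: theta_mat_def w_def)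
  also have "\<dots> = (\<Sum>t<d. \<Sum>i=1..m \<mu>. cnj (\<rho> \<mu> i $$ (c, t)) * (if i < j then 0 else fps_nth (ZT i t) (i - j)))"
  proof -
    have 1: "fps_nth (HT t * (fps_X ^ m \<mu> * BT t)) (m \<mu> - j) = 0" for t
    proof -
      have eq: "HT t * (fps_X ^ m \<mu> * BT t) = fps_X ^ m \<mu> * (HT t * BT t)"
        by (rule mult.left_commute)
      have "m \<mu> - j < m \<mu>"
        using j by auto
      then show ?thesis
        unfolding eq fps_X_power_mult_nth by simp
    qed
    have 2: "fps_nth (fps_X ^ (m \<mu> - i) * ZT i t) (m \<mu> - j) = (if i < j then 0 else fps_nth (ZT i t) (i - j))"
      if "i \<in> {1..m \<mu>}" for i t
    proof -
      have "(m \<mu> - j < m \<mu> - i) = (i < j)" "m \<mu> - j - (m \<mu> - i) = i - j"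
        using j that by auto
      then show ?thesis
        by (simp add: fps_X_power_mult_nth)
    qed
    show ?thesis
      unfolding GT_def fps_sum_nth fps_sub_nth 1 fps_mult_left_const_nth sum_negf[symmetric]
      by (intro sum.cong refl) (simp add: 2)
  qed
  also have "\<dots> = (\<Sum>t<d. \<Sum>i=j..m \<mu>. cnj (\<rho> \<mu> i $$ (c, t)) * fps_nth (ZT i t) (i - j))"
    using j by (intro sum.cong sum.mono_neutral_cong_right refl) auto
  finally have theta: "theta_mat d h hs m p \<mu> j $$ (r, c) =
      (\<Sum>t<d. \<Sum>i=j..m \<mu>. cnj (\<rho> \<mu> i $$ (c, t)) * fps_nth (ZT i t) (i - j))" .
  show ?thesis
    unfolding theta
  proof (intro sums_sum sums_mult)
    fix t i assume t: "t \<in> {..<d}" and i: "i \<in> {j..m \<mu>}"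
    have "(\<lambda>l. s l $$ (r, t) * of_nat ((l + i) choose (i - j)) * w ^ (l + i - (i - j))) sums
        ((deriv ^^ (i - j)) (\<lambda>z. z ^ i * hs z $$ (r, t)) w / fact (i - j))"
      by (rule power_series_shifted_taylor_sums[OF s w(1)]) (use rc t in auto)
    moreover have "l + i - (i - j) = l + j" for l
      using i by auto
    ultimately show "(\<lambda>l. s l $$ (r, t) * of_nat ((l + i) choose (i - j)) * p \<mu> ^ (l + j)) sums
        fps_nth (ZT i t) (i - j)"
      by (simp add: ZT_def fps_expansion_def w_def)
  qed
qed

section \<open>Fourier coefficients of the phase function\<close>

lemma power_series_coeff_eq:
  fixes f :: "complex \<Rightarrow> complex"
  assumes c: "\<And>z. z \<in> ball 0 1 \<Longrightarrow> (\<lambda>k. c k * z ^ k) sums f z"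
  shows "c n = (deriv ^^ n) f 0 / fact n"
proof -
  have "(\<lambda>k. c k * of_nat (k choose n) * 0 ^ (k - n)) = (\<lambda>k. if k = n then c k else 0)"
    by (auto simp: fun_eq_iff power_0_left)
  moreover have "(\<lambda>k. c k * of_nat (k choose n) * 0 ^ (k - n)) sums ((deriv ^^ n) f 0 / fact n)"
    by (rule power_series_taylor_sums[OF c]) auto
  ultimately show ?thesis
    using sums_single[of n c] sums_unique2 by metis
qed

lemma neg_binomial_sums:
  fixes w :: complex
  assumes w: "norm w < 1" and i: "i \<ge> 1"
  shows "(\<lambda>k. of_nat ((k + i - 1) choose (i - 1)) * w ^ k) sums (1 / (1 - w) ^ i)"
proof -
  have w1: "1 - w \<noteq> 0"
    using w by auto
  have "(\<lambda>k. ((- of_nat i) gchoose k) * (- w) ^ k) sums (1 + (- w)) powr (- of_nat i)"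
    using gen_binomial_complex[of "- w" "- of_nat i"] w by simp
  moreover have "((- of_nat i) gchoose k) * (- w) ^ k = of_nat ((k + i - 1) choose (i - 1)) * w ^ k" for k
  proof -
    have "(- complex_of_nat i) gchoose k = (- 1) ^ k * (of_nat (i + k - 1) gchoose k)"
      using i by (simp add: gbinomial_minus of_nat_diff)
    also have "complex_of_nat (i + k - 1) gchoose k = of_nat ((i + k - 1) choose k)"
      by (simp add: binomial_gbinomial)
    also have "(i + k - 1) choose k = (k + i - 1) choose (i - 1)"
      using binomial_symmetric[of k "i + k - 1"] i by (simp add: add.commute)
    finally have "((- complex_of_nat i) gchoose k) * (- w) ^ k =
        ((- 1) ^ k * (- 1) ^ k) * (of_nat ((k + i - 1) choose (i - 1)) * w ^ k)"
      unfolding power_minus[of w k] by (simp only: mult_ac)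
    then show ?thesis
      by (simp flip: power_mult_distrib)
  qed
  moreover have "(1 + (- w)) powr (- of_nat i) = 1 / (1 - w) ^ i"
    using w1 by (simp add: powr_minus powr_nat' field_simps)
  ultimately show ?thesis
    by simp
qed

text \<open>
  Above m_0 the polynomial part of the expansion no longer contributes, and each pole contributes a
  negative binomial series.
\<close>

lemma inverse_coeff_tail:
  assumes pf: "partial_fractions d h K m p \<rho>\<^sub>0 \<rho>" and h: "outer_rational d h"
    and a: "power_series_coeffs d (\<lambda>z. - minv (h z)) a"
    and N: "N > m 0" and ij: "i < d" "j < d"
  shows "a N $$ (i, j) =
    (\<Sum>\<mu>=1..K. \<Sum>k=1..m \<mu>. \<rho> \<mu> k $$ (i, j) * (of_nat ((N + k - 1) choose (k - 1)) * cnj (p \<mu>) ^ N))"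
proof -
  have hc: "\<And>z. h z \<in> carrier_mat d d"
    and det: "\<And>z. z \<in> cball 0 1 \<Longrightarrow> Determinant.det (h z) \<noteq> 0"
    using h unfolding outer_rational_def by blast+
  have p: "p \<mu> \<in> ball 0 1" if "\<mu> \<in> {1..K}" for \<mu>
    using pf that unfolding partial_fractions_def by blast
  define f where "f z = (- minv (h z)) $$ (i, j)" for z
  have a': "(\<lambda>k. a k $$ (i, j) * z ^ k) sums f z" if "z \<in> ball 0 1" for z
    using a that ij unfolding power_series_coeffs_def f_def by (simp add: mult.commute)
  define b where "b l = (if l = 0 then \<rho>\<^sub>0 $$ (i, j) else 0) +
      (\<Sum>\<mu>=1..K. \<Sum>k=1..m \<mu>. \<rho> \<mu> k $$ (i, j) * (of_nat ((l + k - 1) choose (k - 1)) * cnj (p \<mu>) ^ l)) +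
      (\<Sum>k=1..m 0. if l = k then \<rho> 0 k $$ (i, j) else 0)" for l
  have "(\<lambda>l. b l * z ^ l) sums f z" if z: "z \<in> ball 0 1" for z
  proof -
    have zc: "z \<in> cball 0 1" using z by auto
    have "(\<lambda>l. (if l = 0 then \<rho>\<^sub>0 $$ (i, j) * z ^ l else 0) +
        (\<Sum>\<mu>=1..K. \<Sum>k=1..m \<mu>. \<rho> \<mu> k $$ (i, j) * (of_nat ((l + k - 1) choose (k - 1)) * (cnj (p \<mu>) * z) ^ l)) +
        (\<Sum>k=1..m 0. if l = k then \<rho> 0 k $$ (i, j) * z ^ l else 0)) sums
      (\<rho>\<^sub>0 $$ (i, j) * z ^ 0 + (\<Sum>\<mu>=1..K. \<Sum>k=1..m \<mu>. \<rho> \<mu> k $$ (i, j) * (1 / (1 - cnj (p \<mu>) * z) ^ k)) +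
        (\<Sum>k=1..m 0. \<rho> 0 k $$ (i, j) * z ^ k))"
    proof (intro sums_add sums_sum sums_mult neg_binomial_sums sums_single)
      fix \<mu> assume "\<mu> \<in> {1..K}"
      then have "norm (p \<mu>) * norm z < 1 * 1"
        using p z by (intro mult_strict_mono) auto
      then show "norm (cnj (p \<mu>) * z) < 1"
        by (simp add: norm_mult)
    qed auto
    also have "(\<lambda>l. (if l = 0 then \<rho>\<^sub>0 $$ (i, j) * z ^ l else 0) +
        (\<Sum>\<mu>=1..K. \<Sum>k=1..m \<mu>. \<rho> \<mu> k $$ (i, j) * (of_nat ((l + k - 1) choose (k - 1)) * (cnj (p \<mu>) * z) ^ l)) +
        (\<Sum>k=1..m 0. if l = k then \<rho> 0 k $$ (i, j) * z ^ l else 0)) = (\<lambda>l. b l * z ^ l)"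
      unfolding b_def distrib_right sum_distrib_right power_mult_distrib
      by (intro ext arg_cong2[of _ _ _ _ "(+)"] sum.cong refl) (auto simp: mult_ac)
    also have "\<rho>\<^sub>0 $$ (i, j) * z ^ 0 + (\<Sum>\<mu>=1..K. \<Sum>k=1..m \<mu>. \<rho> \<mu> k $$ (i, j) * (1 / (1 - cnj (p \<mu>) * z) ^ k)) +
        (\<Sum>k=1..m 0. \<rho> 0 k $$ (i, j) * z ^ k) = f z"
      using mat_uminus_index[OF minv(1)[OF hc det[OF zc]] ij] minv_eq_partial_fraction_entry[OF pf zc ij]
      by (simp add: f_def partial_fraction_entry_def)
    finally show ?thesis .
  qed
  from power_series_coeff_eq[OF this, of N] power_series_coeff_eq[OF a', of N]
  have "a N $$ (i, j) = b N"
    by simp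
  also have "(\<Sum>k=1..m 0. if N = k then \<rho> 0 k $$ (i, j) else 0) = 0"
    using N by (intro sum.neutral) auto
  then have "b N = (\<Sum>\<mu>=1..K. \<Sum>k=1..m \<mu>. \<rho> \<mu> k $$ (i, j) * (of_nat ((N + k - 1) choose (k - 1)) * cnj (p \<mu>) ^ N))"
    using N by (simp add: b_def)
  finally show ?thesis .
qed

text \<open>
  The binomial that couples N and l is separated into factors depending on N and on l only. The former
  are the entries of the vector p_{N-1}, and the latter are the weights in the series for \<theta>.
\<close>

lemma p_scalar_vandermonde:
  assumes i: "i \<ge> 1" and N: "N \<ge> 1"
  shows "of_nat ((N + l + i - 1) choose (i - 1)) * p \<mu> ^ (N + l) =
    (\<Sum>j=1..i. p_scalar p \<mu> j (N - 1) * (of_nat ((l + i) choose (i - j)) * p \<mu> ^ (l + j)))"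
proof -
  have "(\<Sum>j=1..i. p_scalar p \<mu> j (N - 1) * (of_nat ((l + i) choose (i - j)) * p \<mu> ^ (l + j))) =
      (\<Sum>j=1..i. of_nat (((N - 1) choose (j - 1)) * ((l + i) choose (i - j))) * p \<mu> ^ (N + l))"
  proof (intro sum.cong refl)
    fix j assume j: "j \<in> {1..i}"
    show "p_scalar p \<mu> j (N - 1) * (of_nat ((l + i) choose (i - j)) * p \<mu> ^ (l + j)) =
        of_nat (((N - 1) choose (j - 1)) * ((l + i) choose (i - j))) * p \<mu> ^ (N + l)"
    proof (cases "j \<le> N")
      case True
      then have "p \<mu> ^ (N - 1 + 1 - j) * p \<mu> ^ (l + j) = p \<mu> ^ (N + l)"
        using N by (simp flip: power_add)
      then show ?thesis
        by (simp add: p_scalar_def mult_ac)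
    qed (use N j in \<open>auto simp: p_scalar_def\<close>)
  qed
  also have "\<dots> = of_nat (\<Sum>j=1..i. ((N - 1) choose (j - 1)) * ((l + i) choose (i - j))) * p \<mu> ^ (N + l)"
    by (simp add: sum_distrib_right)
  also have "(\<Sum>j=1..i. ((N - 1) choose (j - 1)) * ((l + i) choose (i - j))) =
      (\<Sum>k\<le>i - 1. ((N - 1) choose k) * ((l + i) choose (i - 1 - k)))"
    by (rule sum.reindex_bij_witness[of _ Suc "\<lambda>j. j - 1"]) (use i in auto)
  also have "\<dots> = (N - 1 + (l + i)) choose (i - 1)"
    by (rule vandermonde)
  also have "N - 1 + (l + i) = N + l + i - 1"
    using N by simp
  finally show ?thesis ..
qed

text \<open>
  For a fixed pole, these are the coefficients of t^{j-1} in (p_\<mu> + t)^l (p_\<mu> + t)^n.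
\<close>

lemma p_scalar_convolution:
  assumes j: "j \<ge> 1"
  shows "(\<Sum>i=1..j. p_scalar p \<mu> i l * p_scalar p \<mu> (j - i + 1) n) = p_scalar p \<mu> j (l + n)"
proof -
  have "(\<Sum>i=1..j. p_scalar p \<mu> i l * p_scalar p \<mu> (j - i + 1) n) =
      (\<Sum>i=1..j. of_nat ((l choose (i - 1)) * (n choose (j - i))) * p \<mu> ^ (l + n + 1 - j))"
  proof (intro sum.cong refl)
    fix i assume i: "i \<in> {1..j}"
    show "p_scalar p \<mu> i l * p_scalar p \<mu> (j - i + 1) n =
        of_nat ((l choose (i - 1)) * (n choose (j - i))) * p \<mu> ^ (l + n + 1 - j)"
    proof (cases "i - 1 \<le> l \<and> j - i \<le> n")
      case True
      then have "l + 1 - i + (n + 1 - (j - i + 1)) = l + n + 1 - j"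
        using i by auto
      then have "p \<mu> ^ (l + 1 - i) * p \<mu> ^ (n + 1 - (j - i + 1)) = p \<mu> ^ (l + n + 1 - j)"
        by (simp only: power_add[symmetric])
      then show ?thesis
        by (simp add: p_scalar_def mult_ac)
    qed (auto simp: p_scalar_def)
  qed
  also have "\<dots> = of_nat (\<Sum>i=1..j. (l choose (i - 1)) * (n choose (j - i))) * p \<mu> ^ (l + n + 1 - j)"
    by (simp add: sum_distrib_right)
  also have "(\<Sum>i=1..j. (l choose (i - 1)) * (n choose (j - i))) =
      (\<Sum>k\<le>j - 1. (l choose k) * (n choose (j - 1 - k)))"
    by (rule sum.reindex_bij_witness[of _ Suc "\<lambda>j. j - 1"]) (use j in auto)
  also have "\<dots> = (l + n) choose (j - 1)"
    by (rule vandermonde)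
  finally show ?thesis
    by (simp add: p_scalar_def)
qed

lemma sum_triangle_swap:
  fixes g :: "nat \<Rightarrow> nat \<Rightarrow> complex"
  shows "(\<Sum>j=1..n. \<Sum>i=j..n. g i j) = (\<Sum>i=1..n. \<Sum>j=1..i. g i j)"
proof -
  have "(\<Sum>j\<in>{1..n}. \<Sum>i\<in>{i. i \<in> {1..n} \<and> j \<le> i}. g i j) = (\<Sum>i\<in>{1..n}. \<Sum>j\<in>{j. j \<in> {1..n} \<and> j \<le> i}. g i j)"
    by (rule sum.swap_restrict) auto
  moreover have "{i. i \<in> {1..n} \<and> j \<le> i} = {j..n}" if "j \<in> {1..n}" for j
    using that by auto
  moreover have "{j. j \<in> {1..n} \<and> j \<le> i} = {1..i}" if "i \<in> {1..n}" for i
    using that by auto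
  ultimately show ?thesis
    by simp
qed

text \<open>
  The coefficient is -(sum over l of s_l a_{N+l}^*). Inserting the tail of the inverse, separating the
  binomials and exchanging the order of summation leaves exactly the series for \<theta>.
\<close>

lemma phase_coeff:
  assumes pf: "partial_fractions d h K m p \<rho>\<^sub>0 \<rho>" and h: "outer_rational d h"
    and hs: "outer_holomorphic d R hs"
    and S: "mat_series d d int s (\<lambda>t. hs (cis t))"
    and s: "\<And>z i j. z \<in> ball 0 1 \<Longrightarrow> i < d \<Longrightarrow> j < d \<Longrightarrow> (\<lambda>l. s l $$ (i, j) * z ^ l) sums hs z $$ (i, j)"
    and a: "power_series_coeffs d (\<lambda>z. - minv (h z)) a"
    and Hi: "mat_series d d int (\<lambda>l. - a l) (\<lambda>t. minv (h (cis t)))"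
    and N: "N > m 0" and rc: "r < d" "c < d"
  shows "mat_coeff d d (\<lambda>t. hs (cis t) * mat_adjoint (minv (h (cis t)))) (- int N) $$ (r, c) =
    - (\<Sum>\<mu>=1..K. \<Sum>j=1..m \<mu>. p_scalar p \<mu> j (N - 1) * theta_mat d h hs m p \<mu> j $$ (r, c))"
proof -
  let ?Om = "\<lambda>t. hs (cis t) * mat_adjoint (minv (h (cis t)))"
    and ?\<Sigma> = "\<lambda>l. \<Sum>\<mu>=1..K. \<Sum>j=1..m \<mu>. p_scalar p \<mu> j (N - 1) *
        (\<Sum>t<d. \<Sum>i=j..m \<mu>. cnj (\<rho> \<mu> i $$ (c, t)) *
          (s l $$ (r, t) * of_nat ((l + i) choose (i - j)) * p \<mu> ^ (l + j)))"
  note cHi = mat_series_continuous[OF Hi]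
  have ac: "a l \<in> carrier_mat d d" for l
    using a unfolding power_series_coeffs_def by blast
  have sc: "s l \<in> carrier_mat d d" for l
    using mat_seriesD(1)[OF S] .
  have fourier_coeff_Hi: "mat_coeff d d (\<lambda>t. mat_adjoint (minv (h (cis t)))) (- int N - int l) = - mat_adjoint (a (N + l))" for l
  proof -
    have *: "- (- int N - int l) = int (N + l)" by simp
    show ?thesis
      unfolding mat_coeff_adjoint[OF cHi] * using mat_coeff_fourier_series[OF Hi, of "N + l"] mat_adjoint_uminus[OF ac]
      by (simp add: inj_def)
  qed
  have "mat_sums d d (\<lambda>l. s l * - mat_adjoint (a (N + l))) (mat_coeff d d ?Om (- int N))"
    using mat_coeff_mult_left[OF S mat_continuous_adjoint[OF cHi], of "- int N"] unfolding fourier_coeff_Hi .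
  from mat_sumsD(3)[OF this rc]
  have "(\<lambda>l. (s l * - mat_adjoint (a (N + l))) $$ (r, c)) sums mat_coeff d d ?Om (- int N) $$ (r, c)" .
  moreover have "(s l * - mat_adjoint (a (N + l))) $$ (r, c) =
      - ?\<Sigma> l" for l
  proof -
    let ?g = "\<lambda>t \<mu> i j. cnj (\<rho> \<mu> i $$ (c, t)) * s l $$ (r, t) *
      (p_scalar p \<mu> j (N - 1) * (of_nat ((l + i) choose (i - j)) * p \<mu> ^ (l + j)))"
    have ma: "- mat_adjoint (a (N + l)) \<in> carrier_mat d d"
      using mat_adjoint_carrier[OF ac] by simp
    have "(s l * - mat_adjoint (a (N + l))) $$ (r, c) = - (\<Sum>t<d. s l $$ (r, t) * cnj (a (N + l) $$ (c, t)))"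
      unfolding mat_mult_index[OF sc ma rc] sum_negf[symmetric]
      using rc by (intro sum.cong refl)
        (simp add: mat_uminus_index[OF mat_adjoint_carrier[OF ac]] mat_adjoint_index[OF ac])
    also have "(\<Sum>t<d. s l $$ (r, t) * cnj (a (N + l) $$ (c, t))) =
        (\<Sum>t<d. \<Sum>\<mu>=1..K. \<Sum>i=1..m \<mu>. \<Sum>j=1..i. ?g t \<mu> i j)"
    proof (intro sum.cong refl)
      fix t assume "t \<in> {..<d}"
      then have t: "t < d" by simp
      have "s l $$ (r, t) * cnj (a (N + l) $$ (c, t)) =
          (\<Sum>\<mu>=1..K. \<Sum>i=1..m \<mu>. cnj (\<rho> \<mu> i $$ (c, t)) * s l $$ (r, t) *
            (of_nat ((N + l + i - 1) choose (i - 1)) * p \<mu> ^ (N + l)))"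
        using N by (subst inverse_coeff_tail[OF pf h a _ rc(2) t])
          (auto simp: sum_distrib_left mult_ac)
      also have "\<dots> = (\<Sum>\<mu>=1..K. \<Sum>i=1..m \<mu>. \<Sum>j=1..i. ?g t \<mu> i j)"
      proof (intro sum.cong refl)
        fix \<mu> i assume "i \<in> {1..m \<mu>}"
        then show "cnj (\<rho> \<mu> i $$ (c, t)) * s l $$ (r, t) * (of_nat ((N + l + i - 1) choose (i - 1)) * p \<mu> ^ (N + l)) =
            (\<Sum>j=1..i. ?g t \<mu> i j)"
          using N by (subst p_scalar_vandermonde) (auto simp: sum_distrib_left)
      qed
      finally show "s l $$ (r, t) * cnj (a (N + l) $$ (c, t)) = (\<Sum>\<mu>=1..K. \<Sum>i=1..m \<mu>. \<Sum>j=1..i. ?g t \<mu> i j)" .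
    qed
    also have "\<dots> = (\<Sum>t<d. \<Sum>\<mu>=1..K. \<Sum>j=1..m \<mu>. \<Sum>i=j..m \<mu>. ?g t \<mu> i j)"
      by (simp only: sum_triangle_swap)
    also have "\<dots> = (\<Sum>\<mu>=1..K. \<Sum>t<d. \<Sum>j=1..m \<mu>. \<Sum>i=j..m \<mu>. ?g t \<mu> i j)"
      by (rule sum.swap)
    also have "\<dots> = (\<Sum>\<mu>=1..K. \<Sum>j=1..m \<mu>. \<Sum>t<d. \<Sum>i=j..m \<mu>. ?g t \<mu> i j)"
      by (intro sum.cong refl sum.swap)
    finally show ?thesis
      by (simp add: sum_distrib_left mult_ac)
  qed
  ultimately have "(\<lambda>l. - ?\<Sigma> l)
      sums mat_coeff d d ?Om (- int N) $$ (r, c)"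
    by (simp only:)
  moreover have "(\<lambda>l. - ?\<Sigma> l)
      sums (- (\<Sum>\<mu>=1..K. \<Sum>j=1..m \<mu>. p_scalar p \<mu> j (N - 1) * theta_mat d h hs m p \<mu> j $$ (r, c)))"
    by (intro sums_minus sums_sum sums_mult theta_sums[OF pf h hs s _ _ rc])
  ultimately show ?thesis
    by (rule sums_unique2)
qed

section \<open>Block matrices\<close>

lemma length_block_labels: "length (block_labels K m) = M_dim K m"
  by (induction K) (simp_all add: block_labels_def)

lemma set_block_labels: "set (block_labels K m) = {(\<mu>, i). \<mu> \<in> {1..K} \<and> i \<in> {1..m \<mu>}}"
  by (force simp: block_labels_def less_Suc_eq_le simp del: upt_Suc)

lemma sum_list_upt: "sum_list (map f [1..<Suc n]) = (\<Sum>i=1..n. f i :: complex)"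
  by (induction n) auto

lemma sum_block_labels:
  fixes g :: "nat \<times> nat \<Rightarrow> complex"
  shows "(\<Sum>q<M_dim K m. g (block_labels K m ! q)) = (\<Sum>\<mu>=1..K. \<Sum>i=1..m \<mu>. g (\<mu>, i))"
proof -
  have "(\<Sum>q<M_dim K m. g (block_labels K m ! q)) = sum_list (map g (block_labels K m))"
    by (simp add: sum_list_sum_nth length_block_labels atLeast0LessThan)
  also have "\<dots> = (\<Sum>\<mu>=1..K. \<Sum>i=1..m \<mu>. g (\<mu>, i))"
  proof (induction K)
    case (Suc K)
    have "sum_list (map g (block_labels (Suc K) m)) =
        sum_list (map g (block_labels K m)) + sum_list (map (\<lambda>i. g (Suc K, i)) [1..<Suc (m (Suc K))])"
      by (simp add: block_labels_def comp_def)
    then show ?case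
      unfolding sum_list_upt using Suc.IH by simp
  qed (simp add: block_labels_def)
  finally show ?thesis .
qed

lemma sum_div_mod:
  fixes f :: "nat \<Rightarrow> nat \<Rightarrow> complex"
  assumes d: "d > 0"
  shows "(\<Sum>b<d * M. f (b div d) (b mod d)) = (\<Sum>q<M. \<Sum>r<d. f q r)"
proof -
  have "(\<Sum>q<M. \<Sum>r<d. f q r) = (\<Sum>(q, r)\<in>{..<M} \<times> {..<d}. f q r)"
    by (rule sum.cartesian_product)
  also have "\<dots> = (\<Sum>b<d * M. f (b div d) (b mod d))"
  proof (rule sum.reindex_bij_witness[of _ "\<lambda>b. (b div d, b mod d)" "\<lambda>(q, r). q * d + r"])
    fix x assume "x \<in> {..<M} \<times> {..<d}"
    then obtain q r where x: "x = (q, r)" "q < M" "r < d" by auto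
    have "q * d + r < (q + 1) * d" using x by simp
    also have "\<dots> \<le> M * d" using x by (intro mult_right_mono) auto
    finally show "(case x of (q, r) \<Rightarrow> q * d + r) \<in> {..<d * M}"
      using x by (simp add: mult.commute)
  qed (use d in \<open>auto simp: less_mult_imp_div_less mult.commute\<close>)
  finally show ?thesis ..
qed

text \<open>
  A row index of a block matrix is a label together with a position inside the block.
\<close>

lemma sum_blocks:
  fixes f :: "nat \<times> nat \<Rightarrow> nat \<Rightarrow> complex"
  assumes "d > 0"
  shows "(\<Sum>b<d * M_dim K m. f (block_labels K m ! (b div d)) (b mod d)) =
    (\<Sum>\<mu>=1..K. \<Sum>i=1..m \<mu>. \<Sum>r<d. f (\<mu>, i) r)"
proof -
  have "(\<Sum>b<d * M_dim K m. f (block_labels K m ! (b div d)) (b mod d)) =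
      (\<Sum>q<M_dim K m. \<Sum>r<d. f (block_labels K m ! q) r)"
    using sum_div_mod[OF assms, of "\<lambda>q. f (block_labels K m ! q)" "M_dim K m"] .
  also have "\<dots> = (\<Sum>\<mu>=1..K. \<Sum>i=1..m \<mu>. \<Sum>r<d. f (\<mu>, i) r)"
    using sum_block_labels[of "\<lambda>x. \<Sum>r<d. f x r"] by simp
  finally show ?thesis .
qed

lemma block_label_cases:
  assumes "b < d * M_dim K m"
  obtains \<mu> i where "block_labels K m ! (b div d) = (\<mu>, i)" "\<mu> \<in> {1..K}" "i \<in> {1..m \<mu>}" "b mod d < d"
proof -
  have "d > 0"
    using assms by (cases d) auto
  moreover have "b div d < M_dim K m"
    using assms by (simp add: less_mult_imp_div_less mult.commute)
  then have "block_labels K m ! (b div d) \<in> set (block_labels K m)"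
    by (intro nth_mem) (simp add: length_block_labels)
  ultimately show ?thesis
    using that unfolding set_block_labels by force
qed

lemma p_mat_carrier: "p_mat d K m p n \<in> carrier_mat (d * M_dim K m) d"
  by (simp add: p_mat_def block_mat_def length_block_labels)

lemma p_mat_index:
  assumes b: "b < d * M_dim K m" and c: "c < d"
  shows "p_mat d K m p n $$ (b, c) =
    (case block_labels K m ! (b div d) of (\<mu>, i) \<Rightarrow> p_scalar p \<mu> i n) * of_bool (c = b mod d)"
proof -
  obtain \<mu> i where "block_labels K m ! (b div d) = (\<mu>, i)" "b mod d < d"
    using block_label_cases[OF b] by metis
  then show ?thesis
    using b c by (simp add: p_mat_def block_mat_def length_block_labels p_block_def)
qed

lemma Theta_mat_carrier: "Theta_mat d h hs K m p \<in> carrier_mat (d * M_dim K m) (d * M_dim K m)"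
  and Pi_mat_carrier: "Pi_mat d K m p n \<in> carrier_mat (d * M_dim K m) (d * M_dim K m)"
  by (simp_all add: Theta_mat_def Pi_mat_def block_mat_def length_block_labels)

lemma Theta_mat_index:
  assumes b: "b < d * M_dim K m" and c: "c < d * M_dim K m"
  shows "Theta_mat d h hs K m p $$ (b, c) =
    (case block_labels K m ! (b div d) of (\<mu>, i) \<Rightarrow> case block_labels K m ! (c div d) of (\<nu>, j) \<Rightarrow>
      if \<mu> = \<nu> \<and> i + j - 1 \<le> m \<mu> then theta_mat d h hs m p \<mu> (i + j - 1) $$ (b mod d, c mod d) else 0)"
proof -
  obtain \<mu> i \<nu> j where "block_labels K m ! (b div d) = (\<mu>, i)" "b mod d < d"
      "block_labels K m ! (c div d) = (\<nu>, j)" "c mod d < d"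
    using block_label_cases[OF b] block_label_cases[OF c] by metis
  then show ?thesis
    using b c by (auto simp: Theta_mat_def block_mat_def length_block_labels)
qed

lemma Pi_mat_index:
  assumes b: "b < d * M_dim K m" and c: "c < d * M_dim K m"
  shows "Pi_mat d K m p n $$ (b, c) =
    (case block_labels K m ! (b div d) of (\<mu>, i) \<Rightarrow> case block_labels K m ! (c div d) of (\<nu>, j) \<Rightarrow>
      if \<mu> = \<nu> \<and> i \<le> j then p_scalar p \<mu> (j - i + 1) n * of_bool (b mod d = c mod d) else 0)"
proof -
  obtain \<mu> i \<nu> j where "block_labels K m ! (b div d) = (\<mu>, i)" "b mod d < d"
      "block_labels K m ! (c div d) = (\<nu>, j)" "c mod d < d"
    using block_label_cases[OF b] block_label_cases[OF c] by metis
  then show ?thesis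
    using b c by (simp add: Pi_mat_def block_mat_def length_block_labels p_block_def)
qed

lemma p_mat_transpose_index:
  assumes "b < d * M_dim K m" "c < d"
  shows "transpose_mat (p_mat d K m p n) $$ (c, b) =
    (case block_labels K m ! (b div d) of (\<mu>, i) \<Rightarrow> p_scalar p \<mu> i n) * of_bool (c = b mod d)"
  using p_mat_index[OF assms] mat_transpose_index[OF p_mat_carrier assms(2,1)] by simp

lemma sum_of_bool_delta:
  fixes f :: "nat \<Rightarrow> complex"
  assumes "c < d"
  shows "(\<Sum>r<d. of_bool (c = r) * f r) = f c"
proof -
  have "(\<Sum>r<d. of_bool (c = r) * f r) = (\<Sum>r<d. if r = c then f r else 0)"
    by (intro sum.cong) auto
  then show ?thesis
    using assms by simp
qed

text \<open>
  The matrix \<Pi>_n acts on the sequence p_l as translation by n.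
\<close>

lemma p_mat_transpose_Pi:
  assumes d: "d > 0"
  shows "transpose_mat (p_mat d K m p l) * Pi_mat d K m p n = transpose_mat (p_mat d K m p (l + n))"
proof (rule mat_eqI)
  have Pt: "transpose_mat (p_mat d K m p l) \<in> carrier_mat d (d * M_dim K m)" for l
    using p_mat_carrier by simp
  show "transpose_mat (p_mat d K m p l) * Pi_mat d K m p n \<in> carrier_mat d (d * M_dim K m)"
    by (rule mult_carrier_mat[OF Pt Pi_mat_carrier])
  show "transpose_mat (p_mat d K m p (l + n)) \<in> carrier_mat d (d * M_dim K m)"
    by (rule Pt)
  fix c b assume cb: "c < d" "b < d * M_dim K m"
  obtain \<nu> j where \<nu>j: "block_labels K m ! (b div d) = (\<nu>, j)" "\<nu> \<in> {1..K}" "j \<in> {1..m \<nu>}" "b mod d < d"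
    using block_label_cases[OF cb(2)] by metis
  let ?f = "\<lambda>x r. (case x of (\<mu>, i) \<Rightarrow> p_scalar p \<mu> i l) * of_bool (c = r) *
      (case x of (\<mu>, i) \<Rightarrow> if \<mu> = \<nu> \<and> i \<le> j then p_scalar p \<mu> (j - i + 1) n * of_bool (r = b mod d) else 0)"
  have "(transpose_mat (p_mat d K m p l) * Pi_mat d K m p n) $$ (c, b) =
      (\<Sum>b'<d * M_dim K m. ?f (block_labels K m ! (b' div d)) (b' mod d))"
    unfolding mat_mult_index[OF Pt Pi_mat_carrier cb]
    by (intro sum.cong refl) (simp add: p_mat_transpose_index[OF _ cb(1)] Pi_mat_index[OF _ cb(2)] \<nu>j(1))
  also have "\<dots> = (\<Sum>\<mu>=1..K. \<Sum>i=1..m \<mu>. \<Sum>r<d. ?f (\<mu>, i) r)"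
    by (rule sum_blocks[OF d])
  also have "\<dots> = (\<Sum>\<mu>=1..K. if \<mu> = \<nu> then (\<Sum>i=1..m \<mu>. \<Sum>r<d. ?f (\<mu>, i) r) else 0)"
    by (intro sum.cong refl) auto
  also have "\<dots> = (\<Sum>i=1..m \<nu>. \<Sum>r<d. ?f (\<nu>, i) r)"
    using \<nu>j by simp
  also have "\<dots> = (\<Sum>i=1..m \<nu>. if i \<le> j then p_scalar p \<nu> i l * p_scalar p \<nu> (j - i + 1) n * of_bool (c = b mod d) else 0)"
  proof (intro sum.cong refl)
    fix i
    have "(\<Sum>r<d. ?f (\<nu>, i) r) = (\<Sum>r<d. of_bool (c = r) * (p_scalar p \<nu> i l *
        (if i \<le> j then p_scalar p \<nu> (j - i + 1) n * of_bool (r = b mod d) else 0)))"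
      by (intro sum.cong refl) auto
    also have "\<dots> = p_scalar p \<nu> i l * (if i \<le> j then p_scalar p \<nu> (j - i + 1) n * of_bool (c = b mod d) else 0)"
      by (rule sum_of_bool_delta[OF cb(1)])
    finally show "(\<Sum>r<d. ?f (\<nu>, i) r) =
        (if i \<le> j then p_scalar p \<nu> i l * p_scalar p \<nu> (j - i + 1) n * of_bool (c = b mod d) else 0)"
      by simp
  qed
  also have "\<dots> = (\<Sum>i=1..j. p_scalar p \<nu> i l * p_scalar p \<nu> (j - i + 1) n * of_bool (c = b mod d))"
    using \<nu>j by (intro sum.mono_neutral_cong_right) auto
  also have "\<dots> = p_scalar p \<nu> j (l + n) * of_bool (c = b mod d)"
    using \<nu>j by (subst p_scalar_convolution[symmetric]) (auto simp: sum_distrib_right)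
  also have "\<dots> = transpose_mat (p_mat d K m p (l + n)) $$ (c, b)"
    by (simp add: p_mat_transpose_index[OF cb(2,1)] \<nu>j(1))
  finally show "(transpose_mat (p_mat d K m p l) * Pi_mat d K m p n) $$ (c, b) =
      transpose_mat (p_mat d K m p (l + n)) $$ (c, b)" .
qed

text \<open>
  The blocks of \<Theta> are constant along antidiagonals, which makes the following a convolution.
\<close>

lemma sum_antidiagonal:
  fixes g :: "nat \<Rightarrow> nat \<Rightarrow> complex"
  shows "(\<Sum>i=1..n. \<Sum>j=1..n. if i + j - 1 \<le> n then g i j else 0) = (\<Sum>t=1..n. \<Sum>i=1..t. g i (t - i + 1))"
proof -
  have "(\<Sum>i=1..n. \<Sum>j=1..n. if i + j - 1 \<le> n then g i j else 0) = (\<Sum>i=1..n. \<Sum>t=i..n. g i (t - i + 1))"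
  proof (rule sum.cong[OF refl])
    fix i assume i: "i \<in> {1..n}"
    have "(\<Sum>j=1..n. if i + j - 1 \<le> n then g i j else 0) = (\<Sum>j=1..n + 1 - i. g i j)"
      by (rule sum.mono_neutral_cong_right) (use i in auto)
    also have "\<dots> = (\<Sum>t=i..n. g i (t - i + 1))"
      by (rule sum.reindex_bij_witness[of _ "\<lambda>t. t - i + 1" "\<lambda>j. i + j - 1"]) (use i in auto)
    finally show "(\<Sum>j=1..n. if i + j - 1 \<le> n then g i j else 0) = (\<Sum>t=i..n. g i (t - i + 1))" .
  qed
  also have "\<dots> = (\<Sum>t=1..n. \<Sum>i=1..t. g i (t - i + 1))"
    by (rule sum_triangle_swap)
  finally show ?thesis .
qed

lemma p_mat_transpose_Theta_p_mat:
  assumes d: "d > 0" and rc: "r < d" "c < d"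
  shows "(transpose_mat (p_mat d K m p l) * Theta_mat d h hs K m p * p_mat d K m p k) $$ (r, c) =
    (\<Sum>\<mu>=1..K. \<Sum>t=1..m \<mu>. p_scalar p \<mu> t (l + k) * theta_mat d h hs m p \<mu> t $$ (r, c))"
proof -
  let ?\<theta> = "theta_mat d h hs m p"
  let ?a = "\<lambda>\<nu> i j s. if i + j - 1 \<le> m \<nu> then p_scalar p \<nu> i l * ?\<theta> \<nu> (i + j - 1) $$ (r, s) else 0"
    and ?b = "\<lambda>\<nu> i j. if i + j - 1 \<le> m \<nu>
      then p_scalar p \<nu> i l * p_scalar p \<nu> j k * ?\<theta> \<nu> (i + j - 1) $$ (r, c) else 0"
  let ?P = "\<lambda>l. p_mat d K m p l" and ?T = "Theta_mat d h hs K m p" and ?N = "d * M_dim K m"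
  have Pt: "transpose_mat (?P l) \<in> carrier_mat d ?N" for l
    using p_mat_carrier by simp
  have 1: "(transpose_mat (?P l) * ?T) $$ (r, b) =
      (case block_labels K m ! (b div d) of (\<nu>, j) \<Rightarrow>
        (\<Sum>i=1..m \<nu>. ?a \<nu> i j (b mod d)))"
    if b: "b < ?N" for b
  proof -
    obtain \<nu> j where \<nu>j: "block_labels K m ! (b div d) = (\<nu>, j)" "\<nu> \<in> {1..K}" "j \<in> {1..m \<nu>}" "b mod d < d"
      using block_label_cases[OF b] by metis
    let ?f = "\<lambda>x r'. (case x of (\<mu>, i) \<Rightarrow> p_scalar p \<mu> i l) * of_bool (r = r') *
      (case x of (\<mu>, i) \<Rightarrow> if \<mu> = \<nu> \<and> i + j - 1 \<le> m \<mu> then ?\<theta> \<mu> (i + j - 1) $$ (r', b mod d) else 0)"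
    have "(transpose_mat (?P l) * ?T) $$ (r, b) =
        (\<Sum>b'<?N. ?f (block_labels K m ! (b' div d)) (b' mod d))"
      unfolding mat_mult_index[OF Pt Theta_mat_carrier rc(1) b]
      by (intro sum.cong refl) (simp add: p_mat_transpose_index[OF _ rc(1)] Theta_mat_index[OF _ b] \<nu>j(1))
    also have "\<dots> = (\<Sum>\<mu>=1..K. \<Sum>i=1..m \<mu>. \<Sum>r'<d. ?f (\<mu>, i) r')"
      by (rule sum_blocks[OF d])
    also have "\<dots> = (\<Sum>\<mu>=1..K. if \<mu> = \<nu> then (\<Sum>i=1..m \<mu>. \<Sum>r'<d. ?f (\<mu>, i) r') else 0)"
      by (intro sum.cong refl) auto
    also have "\<dots> = (\<Sum>i=1..m \<nu>. \<Sum>r'<d. ?f (\<nu>, i) r')"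
      using \<nu>j by simp
    also have "\<dots> = (\<Sum>i=1..m \<nu>. ?a \<nu> i j (b mod d))"
    proof (intro sum.cong refl)
      fix i
      have "(\<Sum>r'<d. ?f (\<nu>, i) r') = (\<Sum>r'<d. of_bool (r = r') * (if i + j - 1 \<le> m \<nu> then p_scalar p \<nu> i l * ?\<theta> \<nu> (i + j - 1) $$ (r', b mod d) else 0))"
        by (intro sum.cong refl) auto
      then show "(\<Sum>r'<d. ?f (\<nu>, i) r') = (?a \<nu> i j (b mod d))"
        by (simp only: sum_of_bool_delta[OF rc(1)])
    qed
    finally show ?thesis
      by (simp add: \<nu>j)
  qed
  let ?g = "\<lambda>x s. (case x of (\<nu>, j) \<Rightarrow>
        (\<Sum>i=1..m \<nu>. ?a \<nu> i j s)) *
      ((case x of (\<nu>, j) \<Rightarrow> p_scalar p \<nu> j k) * of_bool (c = s))"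
  have "(transpose_mat (?P l) * ?T * ?P k) $$ (r, c) =
      (\<Sum>b<?N. ?g (block_labels K m ! (b div d)) (b mod d))"
    unfolding mat_mult_index[OF mult_carrier_mat[OF Pt Theta_mat_carrier] p_mat_carrier rc]
    by (intro sum.cong refl arg_cong2[of _ _ _ _ "(*)"]) (simp_all add: 1 p_mat_index[OF _ rc(2)])
  also have "\<dots> = (\<Sum>\<nu>=1..K. \<Sum>j=1..m \<nu>. \<Sum>s<d. ?g (\<nu>, j) s)"
    by (rule sum_blocks[OF d])
  also have "\<dots> = (\<Sum>\<nu>=1..K. \<Sum>t=1..m \<nu>. p_scalar p \<nu> t (l + k) * ?\<theta> \<nu> t $$ (r, c))"
  proof (rule sum.cong[OF refl])
    fix \<nu>
    have "(\<Sum>s<d. ?g (\<nu>, j) s) = (\<Sum>i=1..m \<nu>. ?b \<nu> i j)" for j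
    proof -
      have "(\<Sum>s<d. ?g (\<nu>, j) s) = (\<Sum>s<d. of_bool (c = s) * ((\<Sum>i=1..m \<nu>. ?a \<nu> i j s) * p_scalar p \<nu> j k))"
        by (intro sum.cong refl) simp
      also have "\<dots> = (\<Sum>i=1..m \<nu>. ?a \<nu> i j c) * p_scalar p \<nu> j k"
        by (rule sum_of_bool_delta[OF rc(2)])
      also have "\<dots> = (\<Sum>i=1..m \<nu>. ?b \<nu> i j)"
        unfolding sum_distrib_right by (intro sum.cong refl) auto
      finally show ?thesis .
    qed
    then have "(\<Sum>j=1..m \<nu>. \<Sum>s<d. ?g (\<nu>, j) s) =
        (\<Sum>j=1..m \<nu>. \<Sum>i=1..m \<nu>. ?b \<nu> i j)"
      by (simp only:)
    also have "\<dots> = (\<Sum>i=1..m \<nu>. \<Sum>j=1..m \<nu>. ?b \<nu> i j)"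
      by (rule sum.swap)
    also have "\<dots> = (\<Sum>t=1..m \<nu>. \<Sum>i=1..t. p_scalar p \<nu> i l * p_scalar p \<nu> (t - i + 1) k * ?\<theta> \<nu> (i + (t - i + 1) - 1) $$ (r, c))"
      by (rule sum_antidiagonal)
    also have "\<dots> = (\<Sum>t=1..m \<nu>. \<Sum>i=1..t. p_scalar p \<nu> i l * p_scalar p \<nu> (t - i + 1) k * ?\<theta> \<nu> t $$ (r, c))"
      by (intro sum.cong refl) auto
    also have "\<dots> = (\<Sum>t=1..m \<nu>. p_scalar p \<nu> t (l + k) * ?\<theta> \<nu> t $$ (r, c))"
      by (intro sum.cong refl) (simp only: sum_distrib_right[symmetric], subst p_scalar_convolution, auto)
    finally show "(\<Sum>j=1..m \<nu>. \<Sum>s<d. ?g (\<nu>, j) s) = (\<Sum>t=1..m \<nu>. p_scalar p \<nu> t (l + k) * ?\<theta> \<nu> t $$ (r, c))" .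
  qed
  finally show ?thesis .
qed

lemma p_mat_summable:
  assumes p: "\<And>\<mu>. \<mu> \<in> {1..K} \<Longrightarrow> p \<mu> \<in> ball 0 1" and bc: "b < d * M_dim K m" "c < d"
  shows "summable (\<lambda>l. norm (p_mat d K m p l $$ (b, c)))"
proof -
  obtain \<mu> i where \<mu>i: "block_labels K m ! (b div d) = (\<mu>, i)" "\<mu> \<in> {1..K}" "i \<in> {1..m \<mu>}"
    using block_label_cases[OF bc(1)] by metis
  let ?w = "complex_of_real (norm (p \<mu>))"
  have "(\<lambda>n. 1 * of_nat (n choose (i - 1)) * ?w ^ (n - (i - 1))) sums
      ((deriv ^^ (i - 1)) (\<lambda>z. 1 / (1 - z)) ?w / fact (i - 1))"
  proof (rule power_series_taylor_sums)
    show "(\<lambda>n. 1 * z ^ n) sums (1 / (1 - z))" if "z \<in> ball 0 1" for z :: complex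
      using geometric_sums[of z] that by simp
    show "?w \<in> ball 0 1"
      using p[OF \<mu>i(2)] by simp
  qed
  then have "summable (\<lambda>n. complex_of_real (of_nat (n choose (i - 1)) * norm (p \<mu>) ^ (n - (i - 1))))"
    by (auto dest: sums_summable)
  then have "summable (\<lambda>n. of_nat (n choose (i - 1)) * norm (p \<mu>) ^ (n - (i - 1)))"
    by (subst (asm) summable_complex_of_real)
  moreover have "n + 1 - i = n - (i - 1)" for n
    using \<mu>i by auto
  ultimately have "summable (\<lambda>n. norm (p_scalar p \<mu> i n))"
    by (simp add: p_scalar_def norm_mult norm_power)
  from summable_mult2[OF this, of "norm (of_bool (c = b mod d) :: complex)"] show ?thesis
    by (simp add: p_mat_index[OF bc] \<mu>i(1) norm_mult)
qed

lemma summable_product: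
  fixes f g :: "nat \<Rightarrow> complex"
  assumes f: "summable (\<lambda>l. norm (f l))" and g: "summable (\<lambda>l. norm (g l))"
  shows "summable (\<lambda>l. f l * g l)"
proof -
  have "g \<longlonglongrightarrow> 0"
    by (rule summable_LIMSEQ_zero[OF summable_norm_cancel[OF g]])
  then have "eventually (\<lambda>l. norm (g l) < 1) sequentially"
    by (auto simp: tendsto_iff dist_norm)
  then have "eventually (\<lambda>l. norm (f l * g l) \<le> norm (f l)) sequentially"
  proof eventually_elim
    case (elim l)
    then show ?case
      using mult_left_mono[of "norm (g l)" 1 "norm (f l)"] by (simp add: norm_mult)
  qed
  then show ?thesis
    by (rule summable_comparison_test_ev[OF _ f])
qed

lemma mat_sums_suminf_mult:
  assumes A: "\<And>l. A l \<in> carrier_mat nr n" and B: "\<And>l. B l \<in> carrier_mat n nc"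
    and sA: "\<And>i j. i < nr \<Longrightarrow> j < n \<Longrightarrow> summable (\<lambda>l. norm (A l $$ (i, j)))"
    and sB: "\<And>i j. i < n \<Longrightarrow> j < nc \<Longrightarrow> summable (\<lambda>l. norm (B l $$ (i, j)))"
  shows "mat_sums nr nc (\<lambda>l. A l * B l) (mat_suminf nr nc (\<lambda>l. A l * B l))"
proof (rule mat_sumsI)
  fix i j assume ij: "i < nr" "j < nc"
  have "summable (\<lambda>l. (A l * B l) $$ (i, j))"
    unfolding mat_mult_index[OF A B ij] using ij by (intro summable_sum summable_product sA sB) auto
  then show "(\<lambda>l. (A l * B l) $$ (i, j)) sums mat_suminf nr nc (\<lambda>l. A l * B l) $$ (i, j)"
    using ij by (simp add: mat_suminf_def summable_sums)
qed (rule mult_carrier_mat[OF A B], simp add: mat_suminf_def)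

section \<open>Normal equations of the predictor\<close>

lemma borel_measurable_cnj:
  assumes "f \<in> borel_measurable M"
  shows "(\<lambda>x. cnj (f x)) \<in> borel_measurable M"
  by (rule borel_measurable_continuous_on[OF _ assms]) (intro continuous_intros)

lemma integrable_mult_square_integrable:
  fixes f g :: "'w \<Rightarrow> complex"
  assumes f: "f \<in> borel_measurable P" "integrable P (\<lambda>\<omega>. (cmod (f \<omega>))\<^sup>2)"
    and g: "g \<in> borel_measurable P" "integrable P (\<lambda>\<omega>. (cmod (g \<omega>))\<^sup>2)"
  shows "integrable P (\<lambda>\<omega>. f \<omega> * cnj (g \<omega>))"
proof (rule Bochner_Integration.integrable_bound)
  show "integrable P (\<lambda>\<omega>. (cmod (f \<omega>))\<^sup>2 + (cmod (g \<omega>))\<^sup>2)"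
    using f g by simp
  show "(\<lambda>\<omega>. f \<omega> * cnj (g \<omega>)) \<in> borel_measurable P"
    using f g by (intro borel_measurable_times borel_measurable_cnj)
  have "cmod (f \<omega> * cnj (g \<omega>)) \<le> (cmod (f \<omega>))\<^sup>2 + (cmod (g \<omega>))\<^sup>2" for \<omega>
  proof -
    have "2 * cmod (f \<omega>) * cmod (g \<omega>) \<le> (cmod (f \<omega>))\<^sup>2 + (cmod (g \<omega>))\<^sup>2"
      by (rule sum_squares_bound)
    moreover have "0 \<le> cmod (f \<omega>) * cmod (g \<omega>)"
      by simp
    ultimately have "cmod (f \<omega>) * cmod (g \<omega>) \<le> (cmod (f \<omega>))\<^sup>2 + (cmod (g \<omega>))\<^sup>2"
      by linarith
    then show ?thesis
      by (simp add: norm_mult)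
  qed
  then show "AE \<omega> in P. norm (f \<omega> * cnj (g \<omega>)) \<le> norm ((cmod (f \<omega>))\<^sup>2 + (cmod (g \<omega>))\<^sup>2)"
    by (intro AE_I2) simp
qed

lemma covariance_entry_eq_fc:
  assumes "arma_process P d X h hs" "i < d" "j < d"
  shows "covariance_entry P X k l i j = fourier_coeff (\<lambda>t. (h (cis t) * mat_adjoint (h (cis t))) $$ (i, j)) (k - l)"
proof -
  have "exp (- \<i> * of_int (k - l) * of_real \<theta>) = cis (- of_int (k - l) * \<theta>)" for \<theta>
    unfolding cis_conv_exp by (rule arg_cong[of _ _ exp]) (simp add: algebra_simps)
  then show ?thesis
    using assms unfolding arma_process_def fourier_coeff_def by simp
qed

text \<open>
  The prediction error is orthogonal to each entry of X_{-k}, and the covariance of X_{-j} and X_{-k} is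
  the Fourier coefficient of the spectral density at k - j.
\<close>

lemma predictor_normal_equations:
  assumes arma: "arma_process P d X h hs" and \<phi>: "predictor_coeffs P d X \<phi>"
    and n: "n \<ge> 1" and k: "k \<in> {1..n}" and rc: "r < d" "c < d"
  defines "w \<equiv> \<lambda>i j t. (h (cis t) * mat_adjoint (h (cis t))) $$ (i, j)"
  shows "fourier_coeff (w r c) (int k) = (\<Sum>j=1..n. \<Sum>t<d. \<phi> n j $$ (r, t) * fourier_coeff (w t c) (int k - int j))"
proof -
  interpret prob_space P
    using arma by (simp add: arma_process_def)
  have stat: "centered_weakly_stationary P d X"
    using arma by (simp add: arma_process_def)
  then have Xc: "X k \<omega> \<in> carrier_vec d" if "\<omega> \<in> space P" for k \<omega>
    using that unfolding centered_weakly_stationary_def by blast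
  have Xm: "(\<lambda>\<omega>. X k \<omega> $ i) \<in> borel_measurable P"
    and Xi: "integrable P (\<lambda>\<omega>. (cmod (X k \<omega> $ i))\<^sup>2)" if "i < d" for k i
    using stat that unfolding centered_weakly_stationary_def by blast+
  have \<phi>c: "\<phi> n j \<in> carrier_mat d d" if "j \<in> {1..n}" for j
    using \<phi> n that unfolding predictor_coeffs_def by blast
  let ?y = "\<lambda>\<omega>. \<Sum>j=1..n. (\<phi> n j *\<^sub>v X (- int j) \<omega>) $ r"
  let ?s = "\<lambda>\<omega>. X (- int k) \<omega> $ c"
  have "orth_proj P (entries_span d X {- int n..-1}) (\<lambda>\<omega>. X 0 \<omega> $ r) ?y"
    using \<phi> n rc unfolding predictor_coeffs_def by blast
  then obtain y' where y': "y' \<in> entries_span d X {- int n..-1}" "AE \<omega> in P. ?y \<omega> = y' \<omega>"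
    and orth: "\<And>s. s \<in> entries_span d X {- int n..-1} \<Longrightarrow> (LINT \<omega>|P. (X 0 \<omega> $ r - y' \<omega>) * cnj (s \<omega>)) = 0"
    unfolding orth_proj_def by blast
  (* one entry of one variable is the combination with a single nonzero coefficient *)
  have s_mem: "?s \<in> entries_span d X {- int n..-1}"
  proof -
    have "?s = (\<lambda>\<omega>. \<Sum>l\<in>{- int n..-1}. \<Sum>i<d. (if l = - int k \<and> i = c then 1 else 0) * X l \<omega> $ i)"
    proof
      fix \<omega>
      have "(\<Sum>l\<in>{- int n..-1}. \<Sum>i<d. (if l = - int k \<and> i = c then 1 else 0) * X l \<omega> $ i) =
          (\<Sum>l\<in>{- int n..-1}. if l = - int k then X l \<omega> $ c else 0)"
      proof (rule sum.cong[OF refl])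
        fix l
        show "(\<Sum>i<d. (if l = - int k \<and> i = c then 1 else 0) * X l \<omega> $ i) = (if l = - int k then X l \<omega> $ c else 0)"
          using rc by (cases "l = - int k") (simp_all add: if_distrib[of "\<lambda>x. x * _"] cong: if_cong)
      qed
      also have "\<dots> = X (- int k) \<omega> $ c"
        using k by simp
      finally show "?s \<omega> = (\<Sum>l\<in>{- int n..-1}. \<Sum>i<d. (if l = - int k \<and> i = c then 1 else 0) * X l \<omega> $ i)" ..
    qed
    then show ?thesis
      unfolding entries_span_def
      by (intro CollectI exI[of _ "\<lambda>l i. if l = - int k \<and> i = c then 1 else 0"] conjI TrueI)
  qed
  have y_eq: "?y \<omega> = (\<Sum>j=1..n. \<Sum>t<d. \<phi> n j $$ (r, t) * X (- int j) \<omega> $ t)" if "\<omega> \<in> space P" for \<omega>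
  proof (rule sum.cong[OF refl])
    fix j assume "j \<in> {1..n}"
    then show "(\<phi> n j *\<^sub>v X (- int j) \<omega>) $ r = (\<Sum>t<d. \<phi> n j $$ (r, t) * X (- int j) \<omega> $ t)"
      using \<phi>c[of j] Xc[OF that, of "- int j"] rc by (auto simp: scalar_prod_def atLeast0LessThan)
  qed
  let ?z = "\<lambda>\<omega>. \<Sum>j=1..n. \<Sum>t<d. \<phi> n j $$ (r, t) * X (- int j) \<omega> $ t"
  have zm: "?z \<in> borel_measurable P"
    by (intro borel_measurable_sum, rule borel_measurable_times[OF borel_measurable_const Xm]) simp
  have y'm: "y' \<in> borel_measurable P"
  proof -
    obtain b where "y' = (\<lambda>\<omega>. \<Sum>l\<in>{- int n..-1}. \<Sum>i<d. b l i * X l \<omega> $ i)"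
      using y'(1) unfolding entries_span_def by blast
    then show ?thesis
      by (simp only:) (intro borel_measurable_sum,
          rule borel_measurable_times[OF borel_measurable_const Xm], simp)
  qed
  have AE: "AE \<omega> in P. ?z \<omega> = y' \<omega>"
    using y'(2) AE_space by eventually_elim (simp only: y_eq)
  have sm: "(\<lambda>\<omega>. cnj (?s \<omega>)) \<in> borel_measurable P" and x0m: "(\<lambda>\<omega>. X 0 \<omega> $ r) \<in> borel_measurable P"
    by (rule borel_measurable_cnj[OF Xm[OF rc(2)]], rule Xm[OF rc(1)])
  have "(LINT \<omega>|P. (X 0 \<omega> $ r - ?z \<omega>) * cnj (?s \<omega>)) = (LINT \<omega>|P. (X 0 \<omega> $ r - y' \<omega>) * cnj (?s \<omega>))"
  proof (rule integral_cong_AE)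
    show "(\<lambda>\<omega>. (X 0 \<omega> $ r - ?z \<omega>) * cnj (?s \<omega>)) \<in> borel_measurable P"
      by (intro borel_measurable_times borel_measurable_diff x0m zm sm)
    show "(\<lambda>\<omega>. (X 0 \<omega> $ r - y' \<omega>) * cnj (?s \<omega>)) \<in> borel_measurable P"
      by (intro borel_measurable_times borel_measurable_diff x0m y'm sm)
    show "AE \<omega> in P. (X 0 \<omega> $ r - ?z \<omega>) * cnj (?s \<omega>) = (X 0 \<omega> $ r - y' \<omega>) * cnj (?s \<omega>)"
      using AE by eventually_elim (simp only:)
  qed
  then have 0: "(LINT \<omega>|P. (X 0 \<omega> $ r - ?z \<omega>) * cnj (?s \<omega>)) = 0"
    by (rule trans[OF _ orth[OF s_mem]])
  have int: "integrable P (\<lambda>\<omega>. X l \<omega> $ i * cnj (?s \<omega>))" if "i < d" for l i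
    by (rule integrable_mult_square_integrable[OF Xm[OF that] Xi[OF that] Xm[OF rc(2)] Xi[OF rc(2)]])
  let ?q = "\<lambda>j t \<omega>. \<phi> n j $$ (r, t) * (X (- int j) \<omega> $ t * cnj (?s \<omega>))"
  have eq: "(\<lambda>\<omega>. (X 0 \<omega> $ r - ?z \<omega>) * cnj (?s \<omega>)) = (\<lambda>\<omega>. X 0 \<omega> $ r * cnj (?s \<omega>) -
      (\<Sum>j=1..n. \<Sum>t<d. ?q j t \<omega>))"
    unfolding left_diff_distrib sum_distrib_right mult.assoc ..
  have term_int: "integrable P (\<lambda>\<omega>. ?q j t \<omega>)" if "t \<in> {..<d}" for j t
    using int that by (intro integrable_mult_right) auto
  have sum_int: "integrable P (\<lambda>\<omega>. \<Sum>t<d. ?q j t \<omega>)" for j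
    by (rule Bochner_Integration.integrable_sum[OF term_int])
  have "(LINT \<omega>|P. (X 0 \<omega> $ r - ?z \<omega>) * cnj (?s \<omega>)) =
      (LINT \<omega>|P. X 0 \<omega> $ r * cnj (?s \<omega>)) -
      (LINT \<omega>|P. (\<Sum>j=1..n. \<Sum>t<d. ?q j t \<omega>))"
    unfolding eq
    by (rule Bochner_Integration.integral_diff[OF int[OF rc(1)] Bochner_Integration.integrable_sum[OF sum_int]])
  also have "(LINT \<omega>|P. (\<Sum>j=1..n. \<Sum>t<d. ?q j t \<omega>)) =
      (\<Sum>j=1..n. LINT \<omega>|P. (\<Sum>t<d. ?q j t \<omega>))"
    by (rule Bochner_Integration.integral_sum[OF sum_int])
  also have "\<dots> = (\<Sum>j=1..n. \<Sum>t<d. LINT \<omega>|P. ?q j t \<omega>)"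
    by (rule sum.cong[OF refl]) (rule Bochner_Integration.integral_sum[OF term_int])
  also have "\<dots> = (\<Sum>j=1..n. \<Sum>t<d. \<phi> n j $$ (r, t) * (LINT \<omega>|P. X (- int j) \<omega> $ t * cnj (?s \<omega>)))"
    by (simp only: integral_mult_right_zero)
  finally have "(LINT \<omega>|P. X 0 \<omega> $ r * cnj (?s \<omega>)) =
      (\<Sum>j=1..n. \<Sum>t<d. \<phi> n j $$ (r, t) * (LINT \<omega>|P. X (- int j) \<omega> $ t * cnj (?s \<omega>)))"
    unfolding 0 by simp
  moreover have cov: "(LINT \<omega>|P. X l \<omega> $ i * cnj (?s \<omega>)) = fourier_coeff (w i c) (l + int k)" if "i < d" for i l
    using covariance_entry_eq_fc[OF arma that rc(2), of l "- int k"]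
    unfolding w_def covariance_entry_def by simp
  ultimately have "fourier_coeff (w r c) (0 + int k) = (\<Sum>j=1..n. \<Sum>t<d. \<phi> n j $$ (r, t) * fourier_coeff (w t c) (- int j + int k))"
    using rc by simp
  then show ?thesis
    by (simp add: add.commute[of "- int _"])
qed

section \<open>The closed form of the predictor\<close>

text \<open>
  For the Hankel structure, \<Pi>_n moves the index of p_l to l + n, and then \<Theta> turns the product of p_{l+n}
  and p_k into the sum over the poles that describes the coefficient of \<Omega> at -(n+1+k+l).
\<close>

lemma arma_phase_factorization:
  assumes d: "d \<ge> 1" and arma: "arma_process P d X h hs"
    and pf: "partial_fractions d h K m p \<rho>\<^sub>0 \<rho>"
    and c: "power_series_coeffs d h c"
    and a: "power_series_coeffs d (\<lambda>z. - minv (h z)) a"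
    and a': "power_series_coeffs d (\<lambda>z. - minv (h_tilde hs z)) a'"
    and n: "n \<ge> m 0"
  obtains s where "phase_factorization d (d * M_dim K m) n (\<lambda>t. h (cis t)) (\<lambda>t. minv (h (cis t)))
    (\<lambda>t. hs (cis t)) (\<lambda>t. minv (h_tilde hs (cis (- t)))) c a s a' (p_mat d K m p)
    (Pi_mat d K m p n * Theta_mat d h hs K m p) (Lambda_mat d K m p)"
proof -
  have h: "outer_rational d h" and hs: "outer_rational d hs"
    and spectral: "\<And>\<theta>. h (cis \<theta>) * mat_adjoint (h (cis \<theta>)) = mat_adjoint (hs (cis \<theta>)) * hs (cis \<theta>)"
    using arma unfolding arma_process_def by blast+
  obtain R where R: "outer_holomorphic d R h"
    using outer_rational_imp_outer_holomorphic[OF h] .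
  obtain R' where R': "outer_holomorphic d R' hs"
    using outer_rational_imp_outer_holomorphic[OF hs] .
  obtain s where s: "power_series_coeffs d hs s"
    using power_series_coeffs_exist[OF R'] .
  have p: "p \<mu> \<in> ball 0 1" if "\<mu> \<in> {1..K}" for \<mu>
    using pf that unfolding partial_fractions_def by blast
  have hc: "\<And>z. h z \<in> carrier_mat d d" and deth: "\<And>t. Determinant.det (h (cis t)) \<noteq> 0"
    using h unfolding outer_rational_def by auto
  have hsc: "\<And>z. hs z \<in> carrier_mat d d" and deths: "\<And>t. Determinant.det (hs (cis t)) \<noteq> 0"
    using hs unfolding outer_rational_def by auto
  note H = outer_fourier_series[OF R c]
  note Hi = outer_inverse_fourier_series[OF R a]
  note S = outer_fourier_series[OF R' s]
  note Sti = mat_series_reflect[OF outer_inverse_fourier_series[OF outer_holomorphic_tilde[OF R'] a']]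
  have tilde: "h_tilde hs (cis (- t)) = mat_adjoint (hs (cis t))" for t
    by (simp add: h_tilde_def cis_cnj)
  have Pc: "p_mat d K m p l \<in> carrier_mat (d * M_dim K m) d" for l
    by (rule p_mat_carrier)
  show ?thesis
  proof (rule that, unfold_locales)
    show "h (cis t) * minv (h (cis t)) = 1\<^sub>m d" "minv (h (cis t)) * h (cis t) = 1\<^sub>m d" for t
      using minv[OF hc deth] by auto
    show "mat_adjoint (hs (cis t)) * minv (h_tilde hs (cis (- t))) = 1\<^sub>m d"
      "minv (h_tilde hs (cis (- t))) * mat_adjoint (hs (cis t)) = 1\<^sub>m d" for t
      unfolding tilde using minv[OF mat_adjoint_carrier[OF hsc] minv_adjoint(2)[OF hsc deths]] by auto
    show "Pi_mat d K m p n * Theta_mat d h hs K m p \<in> carrier_mat (d * M_dim K m) (d * M_dim K m)"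
      by (rule mult_carrier_mat[OF Pi_mat_carrier Theta_mat_carrier])
    show "mat_sums (d * M_dim K m) (d * M_dim K m) (\<lambda>l. p_mat d K m p l * mat_adjoint (p_mat d K m p l)) (Lambda_mat d K m p)"
      unfolding Lambda_mat_def
      by (rule mat_sums_suminf_mult[OF Pc mat_adjoint_carrier[OF Pc] p_mat_summable[OF p]])
         (simp_all only: mat_adjoint_index[OF Pc] complex_mod_cnj p_mat_summable[OF p])
    fix k l
    let ?P = "p_mat d K m p" and ?\<Pi> = "Pi_mat d K m p n" and ?\<Theta> = "Theta_mat d h hs K m p"
    have Pt: "transpose_mat (?P l) \<in> carrier_mat d (d * M_dim K m)" for l
      using Pc by simp
    have eq: "transpose_mat (?P l) * (?\<Pi> * ?\<Theta>) * ?P k = transpose_mat (?P (l + n)) * ?\<Theta> * ?P k"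
      unfolding assoc_mult_mat[OF Pt Pi_mat_carrier Theta_mat_carrier, symmetric]
      using d by (simp add: p_mat_transpose_Pi)
    show "mat_coeff d d (\<lambda>t. hs (cis t) * mat_adjoint (minv (h (cis t)))) (- int (n + 1 + k + l)) =
      - (transpose_mat (?P l) * (?\<Pi> * ?\<Theta>) * ?P k)"
      unfolding eq
    proof (rule mat_eqI)
      have c1: "transpose_mat (?P (l + n)) * ?\<Theta> * ?P k \<in> carrier_mat d d"
        by (rule mult_carrier_mat[OF mult_carrier_mat[OF Pt Theta_mat_carrier] Pc])
      then show "- (transpose_mat (?P (l + n)) * ?\<Theta> * ?P k) \<in> carrier_mat d d"
        by (simp only: uminus_carrier_iff_mat)
      fix r q assume rq: "r < d" "q < d"
      have "mat_coeff d d (\<lambda>t. hs (cis t) * mat_adjoint (minv (h (cis t)))) (- int (n + 1 + k + l)) $$ (r, q) =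
          - (\<Sum>\<mu>=1..K. \<Sum>j=1..m \<mu>. p_scalar p \<mu> j (n + 1 + k + l - 1) * theta_mat d h hs m p \<mu> j $$ (r, q))"
      proof (rule phase_coeff[OF pf h R' S _ a Hi _ rq])
        show "(\<lambda>l. s l $$ (i, j) * z ^ l) sums hs z $$ (i, j)" if "z \<in> ball 0 1" "i < d" "j < d" for z i j
          using s that unfolding power_series_coeffs_def by (simp add: mult.commute)
      qed (use n in auto)
      also have "n + 1 + k + l - 1 = l + n + k" by simp
      also have "(\<Sum>\<mu>=1..K. \<Sum>j=1..m \<mu>. p_scalar p \<mu> j (l + n + k) * theta_mat d h hs m p \<mu> j $$ (r, q)) =
          (transpose_mat (?P (l + n)) * ?\<Theta> * ?P k) $$ (r, q)"
        using d by (intro p_mat_transpose_Theta_p_mat[symmetric] rq) simp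
      finally show "mat_coeff d d (\<lambda>t. hs (cis t) * mat_adjoint (minv (h (cis t)))) (- int (n + 1 + k + l)) $$ (r, q) =
          (- (transpose_mat (?P (l + n)) * ?\<Theta> * ?P k)) $$ (r, q)"
        by (simp only: mat_uminus_index[OF c1 rq])
    qed simp
  qed (rule H Hi S Sti spectral Pc p_mat_summable[OF p] | assumption)+
qed

lemma predictor_polynomial_normal:
  assumes arma: "arma_process P d X h hs" and \<phi>: "predictor_coeffs P d X \<phi>"
    and n: "n \<ge> 1" and k: "k \<in> {1..n}"
    and H: "mat_continuous d d (\<lambda>t. h (cis t))"
    and F: "\<And>l. F l = (if l = 0 then 1\<^sub>m d else if l \<le> n then - \<phi> n l else 0\<^sub>m d d)"
    and \<Phi>: "mat_series d d int F \<Phi>"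
  shows "mat_coeff d d (\<lambda>t. \<Phi> t * h (cis t) * mat_adjoint (h (cis t))) (int k) = 0\<^sub>m d d"
proof -
  have \<phi>c: "\<phi> n j \<in> carrier_mat d d" if "j \<in> {1..n}" for j
    using \<phi> n that unfolding predictor_coeffs_def by blast
  let ?W = "\<lambda>t. h (cis t) * mat_adjoint (h (cis t))"
  have cW: "mat_continuous d d ?W"
    by (rule mat_continuous_mult[OF H mat_continuous_adjoint[OF H]])
  have assoc: "\<Phi> t * h (cis t) * mat_adjoint (h (cis t)) = \<Phi> t * ?W t" for t
    by (rule assoc_mult_mat[OF mat_seriesD(2)[OF \<Phi>] mat_continuousD(1)[OF H]
        mat_adjoint_carrier[OF mat_continuousD(1)[OF H]]])
  show ?thesis
    unfolding assoc
  proof (rule mat_eqI)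
    fix r q assume rq: "r < d" "q < d"
    let ?w = "\<lambda>i j t. ?W t $$ (i, j)"
    let ?G = "\<lambda>l. F l * mat_coeff d d ?W (int k - int l)"
    have Fc: "F l \<in> carrier_mat d d" for l
      by (rule mat_seriesD(1)[OF \<Phi>])
    have G: "?G l $$ (r, q) = (\<Sum>t<d. F l $$ (r, t) * fourier_coeff (?w t q) (int k - int l))" for l
      unfolding mat_mult_index[OF Fc mat_coeff_carrier rq] using rq by (intro sum.cong refl) (simp add: mat_coeff_index)
    have "(\<lambda>l. ?G l $$ (r, q)) sums mat_coeff d d (\<lambda>t. \<Phi> t * ?W t) (int k) $$ (r, q)"
      by (rule mat_sumsD(3)[OF mat_coeff_mult_left[OF \<Phi> cW] rq])
    moreover have "(\<lambda>l. ?G l $$ (r, q)) sums (\<Sum>l\<le>n. ?G l $$ (r, q))"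
      by (rule sums_finite) (simp, unfold G, simp add: F rq)
    ultimately have "mat_coeff d d (\<lambda>t. \<Phi> t * ?W t) (int k) $$ (r, q) = (\<Sum>l\<le>n. ?G l $$ (r, q))"
      by (rule sums_unique2)
    also have "\<dots> = ?G 0 $$ (r, q) + (\<Sum>l=1..n. ?G l $$ (r, q))"
      by (simp add: atMost_atLeast0 sum.atLeast_Suc_atMost[of 0 n])
    also have "?G 0 $$ (r, q) = fourier_coeff (?w r q) (int k)"
      unfolding G using rq by (simp add: F if_distrib[of "\<lambda>x. x * _"] cong: if_cong)
    also have "(\<Sum>l=1..n. ?G l $$ (r, q)) = - (\<Sum>j=1..n. \<Sum>t<d. \<phi> n j $$ (r, t) * fourier_coeff (?w t q) (int k - int j))"
      unfolding G sum_negf[symmetric]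
      by (intro sum.cong refl) (use rq in \<open>auto simp: F mat_uminus_index[OF \<phi>c]\<close>)
    also have "fourier_coeff (?w r q) (int k) = (\<Sum>j=1..n. \<Sum>t<d. \<phi> n j $$ (r, t) * fourier_coeff (?w t q) (int k - int j))"
      by (rule predictor_normal_equations[OF arma \<phi> n k rq])
    finally show "mat_coeff d d (\<lambda>t. \<Phi> t * ?W t) (int k) $$ (r, q) = 0\<^sub>m d d $$ (r, q)"
      using rq by simp
  qed auto
qed

lemma (in phase_factorization) mult_Gt_G:
  assumes y: "y \<in> carrier_mat r N"
  shows "y * mat_adjoint T * transpose_mat L * T * L = y * (mat_adjoint T * transpose_mat L * (T * L))"
proof -
  have Ta: "mat_adjoint T \<in> carrier_mat N N" and Lt: "transpose_mat L \<in> carrier_mat N N"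
    using T L_carrier by auto
  note TaLt = mult_carrier_mat[OF Ta Lt]
  show ?thesis
    unfolding assoc_mult_mat[OF y Ta Lt]
    by (simp only: assoc_mult_mat[OF mult_carrier_mat[OF y TaLt] T L_carrier]
        assoc_mult_mat[OF y TaLt mult_carrier_mat[OF T L_carrier]])
qed

text \<open>
  A vector in the kernel of the transpose is a row y with y = y Gt G. It solves the homogeneous
  system, in which the polynomial and the constant term are zero.
\<close>

lemma (in phase_factorization) det_one_minus_Gt_G_nonzero:
  defines "Gt \<equiv> mat_adjoint T * transpose_mat L" and "G \<equiv> T * L"
  shows "Determinant.det (1\<^sub>m N - Gt * G) \<noteq> 0"
proof
  let ?A = "1\<^sub>m N - Gt * G"
  have Gt: "Gt \<in> carrier_mat N N" and G: "G \<in> carrier_mat N N"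
    using T L_carrier unfolding Gt_def G_def by (auto intro!: mult_carrier_mat)
  have GG: "Gt * G \<in> carrier_mat N N"
    by (rule mult_carrier_mat[OF Gt G])
  have A: "?A \<in> carrier_mat N N"
    by (rule minus_carrier_mat[OF GG])
  assume "Determinant.det ?A = 0"
  then have "Determinant.det (transpose_mat ?A) = 0"
    by (simp add: det_transpose[OF A])
  then obtain v where v: "v \<in> carrier_vec N" "v \<noteq> 0\<^sub>v N" "transpose_mat ?A *\<^sub>v v = 0\<^sub>v N"
    using det_0_iff_vec_prod_zero[of "transpose_mat ?A" N] A by auto
  define y where "y = mat 1 N (\<lambda>(i, j). v $ j)"
  have y: "y \<in> carrier_mat 1 N"
    by (simp add: y_def)
  have yA: "y * ?A = 0\<^sub>m 1 N"
  proof (rule mat_eqI)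
    fix i j :: nat
    assume ij: "i < 1" "j < N"
    have "(y * ?A) $$ (i, j) = (\<Sum>l<N. v $ l * ?A $$ (l, j))"
      unfolding mat_mult_index[OF y A ij] using ij by (intro sum.cong refl) (simp add: y_def)
    also have "\<dots> = (transpose_mat ?A *\<^sub>v v) $ j"
      by (rule transpose_mult_vec_index[OF A v(1) ij(2), symmetric])
    finally show "(y * ?A) $$ (i, j) = 0\<^sub>m 1 N $$ (i, j)"
      using ij v(3) by simp
  qed (rule mult_carrier_mat[OF y A], simp)
  define x where "x = y * mat_adjoint T * transpose_mat L"
  have Ta: "mat_adjoint T \<in> carrier_mat N N" and Lt: "transpose_mat L \<in> carrier_mat N N"
    using T L_carrier by auto
  have x: "x \<in> carrier_mat 1 N"
    unfolding x_def by (rule mult_carrier_mat[OF mult_carrier_mat[OF y Ta] Lt])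
  have xTL: "x * T * L = y * (Gt * G)"
    unfolding x_def Gt_def G_def by (rule mult_Gt_G[OF y])
  have yGG: "y * (Gt * G) \<in> carrier_mat 1 N"
    by (rule mult_carrier_mat[OF y GG])
  have "y * ?A = y * 1\<^sub>m N - y * (Gt * G)"
    by (rule mult_minus_distrib_mat[OF y _ GG]) simp
  then have "y - y * (Gt * G) = 0\<^sub>m 1 N"
    using yA right_mult_one_mat[OF y] by simp
  then have y_eq: "y = y * (Gt * G)"
    by (rule mat_eq_if_diff_eq_zero[OF y yGG])
  have 0: "0\<^sub>m 1 d * mat_adjoint (P 0) = 0\<^sub>m 1 N"
    by (rule left_mult_zero_mat[OF mat_adjoint_carrier[OF P]])
  define F where "F l = (0\<^sub>m 1 d :: complex mat)" for l :: nat
  obtain \<Phi> where \<Phi>: "mat_series 1 d int F \<Phi>"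
    using mat_series_finite[of F 1 d n int] by (auto simp: F_def)
  have \<Phi>0: "mat_coeff 1 d \<Phi> k = 0\<^sub>m 1 d" for k
  proof (cases "k \<in> range int")
    case True
    then show ?thesis
      using mat_coeff_fourier_series[OF \<Phi>] by (auto simp: F_def inj_def)
  qed (rule mat_coeff_fourier_series_eq_0[OF \<Phi>])
  note c\<Phi> = mat_series_continuous[OF \<Phi>]
  interpret predictor_system d N n H Hi S Sti c a s a' P T L 1 "0\<^sub>m 1 d" x y F \<Phi>
  proof unfold_locales
    show "x = y * mat_adjoint T * transpose_mat L" by (rule x_def)
    show "y = 0\<^sub>m 1 d * mat_adjoint (P 0) + x * T * L"
      unfolding 0 xTL using y_eq left_add_zero_mat[OF yGG] by simp
    show "F 0 * c 0 = 0\<^sub>m 1 d"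
      unfolding F_def by (rule left_mult_zero_mat[OF mat_seriesD(1)[OF H]])
    show "mat_coeff 1 d (\<lambda>t. \<Phi> t * H t * mat_adjoint (H t)) (int k) = 0\<^sub>m 1 d" for k
      by (intro mat_coeff_mult_right_eq_0[OF mat_continuous_mult[OF c\<Phi> continuous_H] mat_series_adjoint[OF H]]
          mat_coeff_mult_right_eq_0[OF c\<Phi> H] \<Phi>0)
  qed (use x y \<Phi> in \<open>auto simp: F_def\<close>)
  have "y = 0\<^sub>m 1 N"
    by (rule homogeneous_solution_zero) (simp add: F_def)
  have "v = 0\<^sub>v N"
  proof (rule eq_vecI)
    fix j assume "j < dim_vec (0\<^sub>v N)"
    then have "v $ j = y $$ (0, j)"
      by (simp add: y_def)
    then show "v $ j = 0\<^sub>v N $ j"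
      using \<open>y = 0\<^sub>m 1 N\<close> \<open>j < dim_vec (0\<^sub>v N)\<close> by simp
  qed (use v in auto)
  then show False
    using v(2) by simp
qed

text \<open>
  In the definitions of v_j and its counterpart with a tilde, the coefficients enter with a shifted index.
\<close>

lemma series_tail_summable:
  assumes F: "mat_series nr nc e (\<lambda>l. - a l) F" and ij: "i < nr" "k < nc"
  shows "summable (\<lambda>l. norm (a (j + l) $$ (i, k)))"
proof -
  have a: "a l \<in> carrier_mat nr nc" for l
    using mat_seriesD(1)[OF F, of l] by simp
  have "summable (\<lambda>l. norm ((- a l) $$ (i, k)))"
    using mat_seriesD(3)[OF F ij] by (simp add: fourier_series_def)
  then have "summable (\<lambda>l. norm (a l $$ (i, k)))"
    by (simp only: mat_uminus_index[OF a ij] norm_minus_cancel)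
  from summable_ignore_initial_segment[OF this, of j] show ?thesis
    by (simp add: add.commute)
qed

text \<open>
  The entries of p_0 are 0 and 1, since the binomial coefficients of 0 vanish for i > 1.
\<close>

lemma mat_adjoint_p_mat_0: "mat_adjoint (p_mat d K m p 0) = transpose_mat (p_mat d K m p 0)"
proof (rule mat_eqI)
  fix c b assume cb: "c < d" "b < d * M_dim K m"
  obtain \<mu> i where \<mu>i: "block_labels K m ! (b div d) = (\<mu>, i)" "i \<in> {1..m \<mu>}"
    using block_label_cases[OF cb(2)] by metis
  have "cnj (p_scalar p \<mu> i 0) = p_scalar p \<mu> i 0"
    using \<mu>i by (cases "i = 1") (auto simp: p_scalar_def)
  then show "mat_adjoint (p_mat d K m p 0) $$ (c, b) = transpose_mat (p_mat d K m p 0) $$ (c, b)"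
    by (simp add: mat_adjoint_index[OF p_mat_carrier cb] p_mat_index[OF cb(2,1)]
        p_mat_transpose_index[OF cb(2,1)] \<mu>i(1))
qed (use p_mat_carrier[of d K m p 0] in auto)

theorem theorem6:
  fixes P :: "'w measure" and d :: nat
    and X :: "int \<Rightarrow> 'w \<Rightarrow> complex Matrix.vec"
    and h hs :: "complex \<Rightarrow> complex mat"
    and \<phi> :: "nat \<Rightarrow> nat \<Rightarrow> complex mat"
    and K :: nat and m :: "nat \<Rightarrow> nat" and p :: "nat \<Rightarrow> complex"
    and \<rho>\<^sub>0 :: "complex mat" and \<rho> :: "nat \<Rightarrow> nat \<Rightarrow> complex mat"
    and a a' c :: "nat \<Rightarrow> complex mat" and n j :: nat
  assumes "d \<ge> 1"
    and "arma_process P d X h hs"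
    and "predictor_coeffs P d X \<phi>"
    and "partial_fractions d h K m p \<rho>\<^sub>0 \<rho>" and "K \<ge> 1"
    and "power_series_coeffs d h c"
    and "power_series_coeffs d (\<lambda>z. - minv (h z)) a"
    and "power_series_coeffs d (\<lambda>z. - minv (h_tilde hs z)) a'"
    and "n \<ge> max (m 0) 1" and "j \<in> {1..n}"
  shows "invertible_mat (1\<^sub>m (d * M_dim K m) - G_tilde_mat d h hs K m p n * G_mat d h hs K m p n) \<and>
    \<phi> n j = c 0 * a j +
      c 0 * transpose_mat (p_mat d K m p 0)
        * minv (1\<^sub>m (d * M_dim K m) - G_tilde_mat d h hs K m p n * G_mat d h hs K m p n)
        * mat_adjoint (Pi_mat d K m p n * Theta_mat d h hs K m p)
        * (transpose_mat (Lambda_mat d K m p) * Pi_mat d K m p n * Theta_mat d h hs K m p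
             * v_mat d K m p a j
           + v_tilde_mat d K m p a' (n - j + 1))"
proof -
  let ?N = "d * M_dim K m" and ?P = "p_mat d K m p" and ?L = "Lambda_mat d K m p"
  let ?\<Pi> = "Pi_mat d K m p n" and ?\<Theta> = "Theta_mat d h hs K m p"
  let ?T = "?\<Pi> * ?\<Theta>" and ?v = "v_mat d K m p a j" and ?v' = "v_tilde_mat d K m p a' (n - j + 1)"
  have n: "n \<ge> m 0" "n \<ge> 1"
    using assms(9) by auto
  obtain s where pf: "phase_factorization d ?N n (\<lambda>t. h (cis t)) (\<lambda>t. minv (h (cis t)))
    (\<lambda>t. hs (cis t)) (\<lambda>t. minv (h_tilde hs (cis (- t)))) c a s a' ?P ?T ?L"
    using arma_phase_factorization[OF assms(1,2,4,6,7,8) n(1)] .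
  interpret phase_factorization d ?N n "\<lambda>t. h (cis t)" "\<lambda>t. minv (h (cis t))"
    "\<lambda>t. hs (cis t)" "\<lambda>t. minv (h_tilde hs (cis (- t)))" c a s a' ?P ?T ?L
    by (rule pf)
  define Gt where "Gt = mat_adjoint ?T * transpose_mat ?L"
  define G where "G = ?T * ?L"
  let ?A = "1\<^sub>m ?N - Gt * G"
  have Gt_eq: "G_tilde_mat d h hs K m p n = Gt" and G_eq: "G_mat d h hs K m p n = G"
    by (simp_all add: G_tilde_mat_def G_mat_def Gt_def G_def)
  have Ta: "mat_adjoint ?T \<in> carrier_mat ?N ?N" and Lt: "transpose_mat ?L \<in> carrier_mat ?N ?N"
    using T L_carrier by auto
  have Gt: "Gt \<in> carrier_mat ?N ?N" and G: "G \<in> carrier_mat ?N ?N"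
    unfolding Gt_def G_def by (rule mult_carrier_mat[OF Ta Lt], rule mult_carrier_mat[OF T L_carrier])
  have GG: "Gt * G \<in> carrier_mat ?N ?N"
    by (rule mult_carrier_mat[OF Gt G])
  have A: "?A \<in> carrier_mat ?N ?N"
    by (rule minus_carrier_mat[OF GG])
  have det: "Determinant.det ?A \<noteq> 0"
    unfolding Gt_def G_def by (rule det_one_minus_Gt_G_nonzero)
  note B = minv[OF A det]
  have inv: "invertible_mat ?A"
    by (rule invertible_mat_minv[OF A det])
  have c0: "c 0 \<in> carrier_mat d d" and ac: "a l \<in> carrier_mat d d" and ac': "a' l \<in> carrier_mat d d" for l
    using assms(6,7,8) unfolding power_series_coeffs_def by blast+
  have Pc: "?P l \<in> carrier_mat ?N d" for l by (rule P)
  have Pt: "transpose_mat (?P 0) \<in> carrier_mat d ?N"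
    using Pc by simp
  define CP where "CP = c 0 * transpose_mat (?P 0)"
  have CP: "CP \<in> carrier_mat d ?N"
    unfolding CP_def by (rule mult_carrier_mat[OF c0 Pt])
  (* the solution of y = CP + y * (Gt * G) *)
  define y where "y = CP * minv ?A"
  have y: "y \<in> carrier_mat d ?N"
    unfolding y_def by (rule mult_carrier_mat[OF CP B(1)])
  define x where "x = y * mat_adjoint ?T * transpose_mat ?L"
  have yT: "y * mat_adjoint ?T \<in> carrier_mat d ?N"
    by (rule mult_carrier_mat[OF y Ta])
  have x: "x \<in> carrier_mat d ?N"
    unfolding x_def by (rule mult_carrier_mat[OF yT Lt])
  have xTL: "x * ?T * ?L = y * (Gt * G)"
    unfolding x_def Gt_def G_def by (rule mult_Gt_G[OF y])
  have yGG: "y * (Gt * G) \<in> carrier_mat d ?N"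
    by (rule mult_carrier_mat[OF y GG])
  have "y * ?A = CP"
    unfolding y_def assoc_mult_mat[OF CP B(1) A] B(3) by (rule right_mult_one_mat[OF CP])
  moreover have "y * ?A = y * 1\<^sub>m ?N - y * (Gt * G)"
    by (rule mult_minus_distrib_mat[OF y _ GG]) simp
  ultimately have CP_eq: "CP = y - y * (Gt * G)"
    by (simp only: right_mult_one_mat[OF y])
  have y_eq: "y = CP + x * ?T * ?L"
    unfolding CP_eq xTL by (rule mat_eqI[OF y]) (use y yGG in auto)
  define F where "F l = (if l = 0 then 1\<^sub>m d else if l \<le> n then - \<phi> n l else 0\<^sub>m d d)" for l
  have \<phi>c: "\<phi> n l \<in> carrier_mat d d" if "l \<in> {1..n}" for l
    using assms(3) n that unfolding predictor_coeffs_def by blast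
  have Fc: "F l \<in> carrier_mat d d" for l
    using \<phi>c[of l] by (auto simp: F_def)
  obtain \<Phi> where \<Phi>: "mat_series d d int F \<Phi>"
    using mat_series_finite[of F d d n int, OF Fc] by (auto simp: F_def)
  interpret predictor_system d ?N n "\<lambda>t. h (cis t)" "\<lambda>t. minv (h (cis t))"
    "\<lambda>t. hs (cis t)" "\<lambda>t. minv (h_tilde hs (cis (- t)))" c a s a' ?P ?T ?L d "c 0" x y F \<Phi>
  proof unfold_locales
    show "x = y * mat_adjoint ?T * transpose_mat ?L" by (rule x_def)
    show "y = c 0 * mat_adjoint (?P 0) + x * ?T * ?L"
      using y_eq unfolding CP_def mat_adjoint_p_mat_0 .
    show "F 0 * c 0 = c 0"
      using left_mult_one_mat[OF c0] by (simp add: F_def)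
    show "mat_coeff d d (\<lambda>t. \<Phi> t * h (cis t) * mat_adjoint (h (cis t))) (int k) = 0\<^sub>m d d" if "k \<in> {1..n}" for k
      by (rule predictor_polynomial_normal[OF assms(2,3) n(2) that continuous_H _ \<Phi>]) (simp add: F_def)
  qed (use c0 x y \<Phi> in \<open>auto simp: F_def\<close>)
  note summable_a = series_tail_summable[OF Hi, of _ _ j]
  note summable_a' = series_tail_summable[OF Sti, of _ _ "n - j + 1"]
  have v: "mat_sums ?N d (\<lambda>l. ?P l * a (j + l)) ?v"
    unfolding v_mat_def by (rule mat_sums_suminf_mult[OF Pc ac P_summable summable_a])
  have Pcc: "mat_cnj (?P l) \<in> carrier_mat ?N d" for l
    using Pc by simp
  have "mat_cnj (?P l) $$ (i, k) = cnj (?P l $$ (i, k))" if "i < ?N" "k < d" for l i k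
    using Pc[of l] that by auto
  then have "summable (\<lambda>l. norm (mat_cnj (?P l) $$ (i, k)))" if "i < ?N" "k < d" for i k
    using P_summable[OF that] that by simp
  then have "mat_sums ?N d (\<lambda>l. mat_cnj (?P l) * a' (n - j + 1 + l)) ?v'"
    unfolding v_tilde_mat_def by (intro mat_sums_suminf_mult[OF Pcc ac' _ summable_a'])
  moreover have "n - j + 1 = n + 1 - j"
    using assms(10) by auto
  ultimately have v': "mat_sums ?N d (\<lambda>l. mat_cnj (?P l) * a' (n + 1 - j + l)) ?v'"
    by (simp only:)
  have vc: "?v \<in> carrier_mat ?N d" and vc': "?v' \<in> carrier_mat ?N d"
    using mat_sumsD(2)[OF v] mat_sumsD(2)[OF v'] .
  have Fj: "F j = - (c 0 * a j + x * ?T * ?v + y * mat_adjoint ?T * ?v')"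
    by (rule predictor_formula[OF v v' assms(10)])
  have "F j = - \<phi> n j"
    using assms(10) by (simp add: F_def)
  then have "\<phi> n j = c 0 * a j + x * ?T * ?v + y * mat_adjoint ?T * ?v'"
    using Fj by (metis uminus_uminus_mat)
  also have "\<dots> = c 0 * a j + (x * ?T * ?v + y * mat_adjoint ?T * ?v')"
    by (rule assoc_add_mat[OF mult_carrier_mat[OF c0 ac] mult_carrier_mat[OF mult_carrier_mat[OF x T] vc]
        mult_carrier_mat[OF yT vc']])
  also have "x * ?T * ?v + y * mat_adjoint ?T * ?v' =
      y * mat_adjoint ?T * (transpose_mat ?L * ?\<Pi> * ?\<Theta> * ?v + ?v')"
  proof -
    have LT: "transpose_mat ?L * ?T \<in> carrier_mat ?N ?N"
      by (rule mult_carrier_mat[OF Lt T])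
    have "x * ?T * ?v = y * mat_adjoint ?T * (transpose_mat ?L * ?T * ?v)"
      unfolding x_def assoc_mult_mat[OF yT Lt T] by (rule assoc_mult_mat[OF yT LT vc])
    moreover have "transpose_mat ?L * ?T = transpose_mat ?L * ?\<Pi> * ?\<Theta>"
      by (rule assoc_mult_mat[OF Lt Pi_mat_carrier Theta_mat_carrier, symmetric])
    ultimately show ?thesis
      using mult_add_distrib_mat[OF yT mult_carrier_mat[OF LT vc] vc'] by simp
  qed
  finally have "\<phi> n j = c 0 * a j + y * mat_adjoint ?T * (transpose_mat ?L * ?\<Pi> * ?\<Theta> * ?v + ?v')" .
  then show ?thesis
    using inv unfolding Gt_eq G_eq y_def CP_def by simp
qed

end
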